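(* For every integer $n \geq 2$ we have $\Pi^0_1 = \bar\Pi_n$ as classes of two-dimensional subshifts. That is, for every finite alphabet $A$ and every set $\mathsf{X} \subset A^{\mathbb{Z}^2}$, the following are equivalent: (i) $\mathsf{X}$ is a $\Pi^0_1$ subshift, i.e. a subshift whose language $\mathcal{B}(\mathsf{X})$ is $\Pi^0_1$; (ii) $\mathsf{X} = \mathsf{X}_\psi$ for some $\bar\Pi_n$ formula $\psi$ over $A$.
   Context: **Subshifts.** Let $A$ be a finite alphabet. A pattern is a map $P : D \to A$ with $D = D(P) \subset \mathbb{Z}^2$; $A^{**}$ is the set of patterns with finite domain, and elements of $A^{\mathbb{Z}^2}$ are configurations. A pattern $P$ occurs in a pattern $Q$ if there is $\vec v \in \mathbb{Z}^2$ such that $\vec v + \vec w \in D(Q)$ and $Q_{\vec v+\vec w} = P_{\vec w}$ for all $\vec w \in D(P)$. A subshift is a set of the form $\mathsf{X}_F = \{x \in A^{\mathbb{Z}^2} \mid \text{no } P \in F \text{ occurs in } x\}$ for some $F \subset A^{**}$. The language of a subshift $\mathsf{X}$ is $\mathcal{B}(\mathsf{X}) = \{P \in A^{**} \mid P \text{ occurs in some } x \in \mathsf{X}\}$. **Arithmetical classification.** $\Pi^0_k$ and $\Sigma^0_k$ denote the levels of the usual arithmetical hierarchy of subsets of $\mathbb{N}$ ($\Sigma^0_1$ = recursively enumerable, $\Pi^0_1$ = co-recursively enumerable). Subsets of other countable sets such as $A^{**}$ are classified via a natural computable bijection with $\mathbb{N}$. A subshift is given the classification of its language; $\Pi^0_k$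 also denotes the class of subshifts (over finite alphabets) whose language is $\Pi^0_k$. **Formulas.** First-order variables range over $\mathbb{Z}^2$. A term is a chain of finitely many nested applications of the functions $\mathsf{North}(a,b)=(a,b+1)$, $\mathsf{South}(a,b)=(a,b-1)$, $\mathsf{East}(a,b)=(a+1,b)$, $\mathsf{West}(a,b)=(a-1,b)$ to a first-order variable. For a subshift $\mathsf{Y} \subset B^{\mathbb{Z}^2}$ over a finite alphabet $B$, the quantifiers $\forall X[\mathsf{Y}]$, $\exists X[\mathsf{Y}]$ quantify a configuration variable $X$ over the elements of $\mathsf{Y}$. Atomic formulas over $A$ are $t = t'$, $P_a(t)$ for $a \in A$ (true in a configuration $x \in A^{\mathbb{Z}^2}$ iff $x$ has the letter $a$ at the coordinate $t$), and $X_t = b$ (true iff the configuration $X$ has the letter $b \in B$ at the coordinate $t$), where $t,t'$ are terms. For a class $C$ of subshifts, a $C$-u-MSO formula over $A$ is a closed formula $$\psi = Q_1 X_1[\mathsf{X}_1] \cdots Q_m X_m[\mathsf{X}_m]\, \forall \vec n_1 \cdots \forall \vec n_\ell\, \phi,$$ where each $Q_i \in \{\forall,\exists\}$, each $\mathsf{X}_i \in C$, and $\phi$ is quantifier-free (a Boolean combination of atomic formulas). It is $\bar\Pi_k[C]$ (resp. $\bar\Sigma_k[C]$) if the prefix $Q_1 \cdots Q_m$ consists of $k$ maximal blocks of equal quantifiers and, for $k\ge 1$, $Q_1 = \forall$ (resp. $Q_1 = \exists$); for $k=0$ there are no second-order quantifiers. $\mathsf{X}_\psi \subset A^{\mathbb{Z}^2}$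 is the set of configurations $x$ in which $\psi$ is true, and $\bar\Pi_k[C]$ also denotes the class of all sets $\mathsf{X}_\psi$ with $\psi$ a $\bar\Pi_k[C]$ formula (over any finite alphabet $A$). If $C$ consists only of the binary full shift $\{0,1\}^{\mathbb{Z}^2}$, we write $\bar\Pi_k = \bar\Pi_k[C]$. *)

theory Defs
  imports "HOL-Library.Nat_Bijection" "HOL-Library.Cardinality" "HOL-Library.Product_Plus"
begin

type_synonym cell = "int \<times> int"
type_synonym 'a pattern = "cell \<rightharpoonup> 'a"
type_synonym 'a config = "cell \<Rightarrow> 'a"


section \<open>Subshifts\<close>

definition finite_patterns :: "'a pattern set" where
  "finite_patterns = {P. finite (dom P)}"

definition occurs_in :: "'a pattern \<Rightarrow> 'a pattern \<Rightarrow> bool" where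
  "occurs_in P Q \<longleftrightarrow> (\<exists>v. \<forall>w \<in> dom P. v + w \<in> dom Q \<and> Q (v + w) = P w)"

text \<open>A configuration \<open>x\<close> is viewed as the pattern \<open>Some \<circ> x\<close> with domain \<open>UNIV\<close>.\<close>

definition avoiding :: "'a pattern set \<Rightarrow> 'a config set" where
  "avoiding F = {x. \<not> (\<exists>P \<in> F. occurs_in P (Some \<circ> x))}"

definition subshift :: "'a config set \<Rightarrow> bool" where
  "subshift X \<longleftrightarrow> (\<exists>F. F \<subseteq> finite_patterns \<and> X = avoiding F)"

definition language :: "'a config set \<Rightarrow> 'a pattern set" where
  "language X = {P \<in> finite_patterns. \<exists>x \<in> X. occurs_in P (Some \<circ> x)}"


section \<open>Recursively enumerable sets of natural numbers\<close>

text \<open>Programs for the partial recursive functions. Arities are not part of the syntax: a program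
  applied to an argument list of a wrong length may simply have no value.\<close>

datatype recf =
    Zero
  | Succ
  | Proj nat
  | Comp recf "recf list"
  | Prim recf recf
  | Mu recf

inductive computes :: "recf \<Rightarrow> nat list \<Rightarrow> nat \<Rightarrow> bool" where
  zero: "computes Zero xs 0"
| succ: "computes Succ [x] (Suc x)"
| proj: "i < length xs \<Longrightarrow> computes (Proj i) xs (xs ! i)"
| comp: "list_all2 (\<lambda>g y. computes g xs y) gs ys \<Longrightarrow> computes f ys z
    \<Longrightarrow> computes (Comp f gs) xs z"
| prim_0: "computes f xs y \<Longrightarrow> computes (Prim f g) (0 # xs) y"
| prim_Suc: "computes (Prim f g) (k # xs) r \<Longrightarrow> computes g (r # k # xs) y
    \<Longrightarrow> computes (Prim f g) (Suc k # xs) y"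
| mu: "computes f (k # xs) 0 \<Longrightarrow> (\<forall>j < k. \<exists>y > 0. computes f (j # xs) y)
    \<Longrightarrow> computes (Mu f) xs k"

definition recursively_enumerable :: "nat set \<Rightarrow> bool" where
  "recursively_enumerable S \<longleftrightarrow> (\<exists>f. S = {k. \<exists>y. computes f [k] y})"

definition Pi01 :: "nat set \<Rightarrow> bool" where
  "Pi01 S \<longleftrightarrow> recursively_enumerable (- S)"


section \<open>Coding of finite patterns\<close>

text \<open>The class of sets of patterns obtained below does not depend on the chosen numbering
  of the letters.\<close>

definition letter_code :: "'a::finite \<Rightarrow> nat" where
  "letter_code = (SOME f. bij_betw f UNIV {0..<CARD('a)})"

definition cell_code :: "cell \<Rightarrow> nat" where
  "cell_code v = prod_encode (int_encode (fst v), int_encode (snd v))"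

text \<open>A finite pattern is coded by a number written in base \<open>CARD('a) + 1\<close>: the digit at
  position \<open>cell_code v\<close> is \<open>0\<close> if \<open>v\<close> is outside the domain, and otherwise one more than the
  code of the letter at \<open>v\<close>.\<close>

definition pattern_code :: "'a::finite pattern \<Rightarrow> nat" where
  "pattern_code P =
     (\<Sum>v \<in> dom P. Suc (letter_code (the (P v))) * Suc CARD('a) ^ cell_code v)"

lemma bij_letter_code: "bij_betw (letter_code :: 'a::finite \<Rightarrow> nat) UNIV {0..<CARD('a)}"
  unfolding letter_code_def
  by (rule someI_ex[where P="\<lambda>f. bij_betw f UNIV {0..<CARD('a)}"]) (rule ex_bij_betw_finite_nat, simp)

lemma bij_cell_code: "bij cell_code"
proof -
  have "cell_code = prod_encode \<circ> map_prod int_encode int_encode"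
    by (auto simp: cell_code_def fun_eq_iff)
  moreover have "bij (map_prod int_encode int_encode)"
    using bij_betw_map_prod[OF bij_int_encode bij_int_encode] by simp
  ultimately show ?thesis
    using bij_prod_encode by (metis bij_comp)
qed

lemma digits_unique:
  fixes d e :: "nat \<Rightarrow> nat"
  assumes "\<And>i. d i < b" "\<And>i. e i < b"
    and "(\<Sum>i<k. d i * b ^ i) = (\<Sum>i<k. e i * b ^ i)"
  shows "i < k \<Longrightarrow> d i = e i"
  using assms
proof (induction k arbitrary: d e i)
  case (Suc k)
  have split: "(\<Sum>i<Suc k. f i * b ^ i) = f 0 + b * (\<Sum>i<k. f (Suc i) * b ^ i)"
    for f :: "nat \<Rightarrow> nat"
    by (subst sum.lessThan_Suc_shift) (simp add: sum_distrib_left algebra_simps)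
  have eq: "d 0 + b * (\<Sum>i<k. d (Suc i) * b ^ i) = e 0 + b * (\<Sum>i<k. e (Suc i) * b ^ i)"
    using Suc.prems(4) unfolding split .
  have b: "d 0 < b" "e 0 < b" using Suc.prems by auto
  have 0: "d 0 = e 0"
    using arg_cong[OF eq, of "\<lambda>n. n mod b"] b by simp
  then have "(\<Sum>i<k. d (Suc i) * b ^ i) = (\<Sum>i<k. e (Suc i) * b ^ i)"
    using eq b by simp
  then have "d (Suc j) = e (Suc j)" if "j < k" for j
    using Suc.IH[of j "\<lambda>i. d (Suc i)" "\<lambda>i. e (Suc i)"] Suc.prems that by auto
  with 0 show ?case using Suc.prems(1) by (cases i) auto
qed simp

lemma digits_exist:
  fixes b :: nat
  assumes "b > 0" "n < b ^ k"
  shows "\<exists>d. (\<forall>i. d i < b) \<and> (\<forall>i \<ge> k. d i = 0) \<and> n = (\<Sum>i<k. d i * b ^ i)"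
  using assms
proof (induction k arbitrary: n)
  case 0
  then show ?case by (intro exI[of _ "\<lambda>_. 0"]) auto
next
  case (Suc k)
  have "n div b < b ^ k"
    using Suc.prems by (simp add: less_mult_imp_div_less mult.commute)
  then obtain d where d: "\<forall>i. d i < b" "\<forall>i \<ge> k. d i = 0" "n div b = (\<Sum>i<k. d i * b ^ i)"
    using Suc.IH[of "n div b"] Suc.prems by blast
  define e where "e = (\<lambda>i. case i of 0 \<Rightarrow> n mod b | Suc i \<Rightarrow> d i)"
  have "(\<Sum>i<Suc k. e i * b ^ i) = n mod b + b * (\<Sum>i<k. d i * b ^ i)"
    by (subst sum.lessThan_Suc_shift) (simp add: e_def sum_distrib_left algebra_simps)
  also have "\<dots> = n"
    unfolding d(3)[symmetric] by simp
  finally have "n = (\<Sum>i<Suc k. e i * b ^ i)"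
    by (rule sym)
  moreover have "\<forall>i. e i < b" "\<forall>i \<ge> Suc k. e i = 0"
    using d Suc.prems by (auto simp: e_def split: nat.split)
  ultimately show ?case by blast
qed

definition pattern_digit :: "'a::finite pattern \<Rightarrow> nat \<Rightarrow> nat" where
  "pattern_digit P i = (case P (inv cell_code i) of None \<Rightarrow> 0 | Some a \<Rightarrow> Suc (letter_code a))"

lemma pattern_digit_less: "pattern_digit (P :: 'a::finite pattern) i < Suc CARD('a)"
  using bij_letter_code[where 'a='a]
  by (auto simp: pattern_digit_def bij_betw_def split: option.split)

lemma pattern_code_digits:
  fixes P :: "'a::finite pattern"
  assumes "cell_code ` dom P \<subseteq> {..<k}"
  shows "pattern_code P = (\<Sum>i<k. pattern_digit P i * Suc CARD('a) ^ i)"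
proof -
  have inj: "inj cell_code" using bij_cell_code by (rule bij_is_inj)
  have "(\<Sum>i<k. pattern_digit P i * Suc CARD('a) ^ i)
      = (\<Sum>i \<in> cell_code ` dom P. pattern_digit P i * Suc CARD('a) ^ i)"
  proof (rule sum.mono_neutral_right)
    show "\<forall>i \<in> {..<k} - cell_code ` dom P. pattern_digit P i * Suc CARD('a) ^ i = 0"
    proof
      fix i assume "i \<in> {..<k} - cell_code ` dom P"
      moreover have "cell_code (inv cell_code i) = i"
        using bij_cell_code by (simp add: bij_is_surj surj_f_inv_f)
      ultimately have "P (inv cell_code i) = None"
        by (metis DiffD2 domIff image_eqI)
      then show "pattern_digit P i * Suc CARD('a) ^ i = 0"
        by (simp add: pattern_digit_def)
    qed
  qed (use assms in auto)
  also have "\<dots> = (\<Sum>v \<in> dom P. pattern_digit P (cell_code v) * Suc CARD('a) ^ cell_code v)"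
    by (rule sum.reindex_cong[of cell_code]) (use inj in \<open>auto simp: inj_on_def\<close>)
  also have "\<dots> = pattern_code P"
    unfolding pattern_code_def
    by (rule sum.cong) (use inj in \<open>auto simp: pattern_digit_def\<close>)
  finally show ?thesis by simp
qed

lemma bij_pattern_code: "bij_betw (pattern_code :: 'a::finite pattern \<Rightarrow> nat) finite_patterns UNIV"
proof (rule bij_betw_imageI)
  note letter = bij_letter_code[where 'a='a]
  have inv: "inv cell_code (cell_code v) = v" for v
    using bij_cell_code by (simp add: bij_is_inj)
  show "inj_on (pattern_code :: 'a pattern \<Rightarrow> nat) finite_patterns"
  proof (rule inj_onI)
    fix P Q :: "'a pattern"
    assume fin: "P \<in> finite_patterns" "Q \<in> finite_patterns" and eq: "pattern_code P = pattern_code Q"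
    show "P = Q"
    proof
      fix v
      have "finite (insert (cell_code v) (cell_code ` dom P \<union> cell_code ` dom Q))"
        using fin by (simp add: finite_patterns_def)
      then obtain k where k: "insert (cell_code v) (cell_code ` dom P \<union> cell_code ` dom Q) \<subseteq> {..<k}"
        using bounded_nat_set_is_finite finite_nat_set_iff_bounded by (metis lessThan_iff subsetI)
      have "pattern_digit P (cell_code v) = pattern_digit Q (cell_code v)"
        by (rule digits_unique[where k=k and b="Suc CARD('a)"])
          (use k eq pattern_digit_less pattern_code_digits[of P k] pattern_code_digits[of Q k] in auto)
      then show "P v = Q v"
        using letter
        by (auto simp: pattern_digit_def inv bij_betw_def inj_on_def split: option.splits)
    qed
  qed
  show "(pattern_code :: 'a pattern \<Rightarrow> nat) ` finite_patterns = UNIV"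
  proof (intro equalityI subsetI UNIV_I)
    fix n :: nat
    have "n < Suc CARD('a) ^ n"
      by (rule less_exp[THEN less_le_trans]) (simp add: power_mono Suc_le_eq)
    then obtain d where d: "\<And>i. d i < Suc CARD('a)" "\<And>i. i \<ge> n \<Longrightarrow> d i = 0"
      "n = (\<Sum>i<n. d i * Suc CARD('a) ^ i)"
      using digits_exist[of "Suc CARD('a)" n n] by auto
    define P :: "'a pattern" where
      "P = (\<lambda>v. if d (cell_code v) = 0 then None
                else Some (inv letter_code (d (cell_code v) - 1)))"
    have code: "cell_code (inv cell_code i) = i" for i
      using bij_cell_code by (simp add: bij_is_surj surj_f_inv_f)
    have dom: "cell_code ` dom P \<subseteq> {..<n}"
      using d(2) by (auto simp: P_def dom_def) (metis not_le less_irrefl)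
    have "finite (dom P)"
      by (rule finite_imageD[OF finite_subset[OF dom]])
        (use bij_cell_code in \<open>auto simp: bij_def intro: inj_on_subset\<close>)
    moreover have "pattern_digit P i = d i" for i
    proof (cases "d i = 0")
      case False
      then have "d i - 1 \<in> range (letter_code :: 'a \<Rightarrow> nat)"
        using d(1)[of i] letter by (auto simp: bij_betw_def)
      then have "letter_code (inv letter_code (d i - 1) :: 'a) = d i - 1"
        by (rule f_inv_into_f)
      with False show ?thesis by (simp add: pattern_digit_def P_def code)
    qed (simp add: pattern_digit_def P_def code)
    ultimately show "n \<in> (pattern_code :: 'a pattern \<Rightarrow> nat) ` finite_patterns"
      using d(3) pattern_code_digits[OF dom] by (auto simp: finite_patterns_def intro!: image_eqI)
  qed
qed

definition Pi01_subshift :: "'a::finite config set \<Rightarrow> bool" where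
  "Pi01_subshift X \<longleftrightarrow> subshift X \<and> Pi01 (pattern_code ` language X)"


section \<open>Universal monadic second-order formulas\<close>

text \<open>Variables are referred to by their position in the quantifier prefix, counted from \<open>0\<close>
  and separately for coordinate variables and configuration variables.\<close>

datatype cterm =
    Var nat
  | North cterm
  | South cterm
  | East cterm
  | West cterm

text \<open>\<open>Letter a t\<close> is the atomic formula \<open>P_a(t)\<close>, and \<open>Symb i t b\<close> says that the \<open>i\<close>-th
  quantified configuration has the letter \<open>b\<close> at \<open>t\<close>.\<close>

datatype ('a, 'b) qfree =
    Eq cterm cterm
  | Letter 'a cterm
  | Symb nat cterm 'b
  | Neg "('a, 'b) qfree"
  | Conj "('a, 'b) qfree" "('a, 'b) qfree"
  | Disj "('a, 'b) qfree" "('a, 'b) qfree"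

datatype quantifier = Forall | Exists

text \<open>\<open>U_MSO [(Q\<^sub>1, X\<^sub>1), \<dots>, (Q\<^sub>m, X\<^sub>m)] l \<phi>\<close>, where \<open>l\<close> is the number of universally quantified
  coordinate variables.\<close>

datatype ('a, 'b) u_mso =
  U_MSO (quant_prefix: "(quantifier \<times> 'b config set) list") (num_coords: nat)
    (matrix: "('a, 'b) qfree")

fun cterm_val :: "cell list \<Rightarrow> cterm \<Rightarrow> cell" where
  "cterm_val vs (Var j) = vs ! j"
| "cterm_val vs (North t) = cterm_val vs t + (0, 1)"
| "cterm_val vs (South t) = cterm_val vs t - (0, 1)"
| "cterm_val vs (East t) = cterm_val vs t + (1, 0)"
| "cterm_val vs (West t) = cterm_val vs t - (1, 0)"

fun qfree_true :: "'a config \<Rightarrow> 'b config list \<Rightarrow> cell list \<Rightarrow> ('a, 'b) qfree \<Rightarrow> bool" where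
  "qfree_true x Xs vs (Eq s t) \<longleftrightarrow> cterm_val vs s = cterm_val vs t"
| "qfree_true x Xs vs (Letter a t) \<longleftrightarrow> x (cterm_val vs t) = a"
| "qfree_true x Xs vs (Symb i t b) \<longleftrightarrow> (Xs ! i) (cterm_val vs t) = b"
| "qfree_true x Xs vs (Neg p) \<longleftrightarrow> \<not> qfree_true x Xs vs p"
| "qfree_true x Xs vs (Conj p q) \<longleftrightarrow> qfree_true x Xs vs p \<and> qfree_true x Xs vs q"
| "qfree_true x Xs vs (Disj p q) \<longleftrightarrow> qfree_true x Xs vs p \<or> qfree_true x Xs vs q"

text \<open>In the following function, \<open>Xs\<close> lists the configurations chosen for the quantifiers that
  have already been processed.\<close>

fun prefix_true :: "'a config \<Rightarrow> 'b config list \<Rightarrow> (quantifier \<times> 'b config set) list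
    \<Rightarrow> nat \<Rightarrow> ('a, 'b) qfree \<Rightarrow> bool" where
  "prefix_true x Xs [] l p \<longleftrightarrow> (\<forall>vs. length vs = l \<longrightarrow> qfree_true x Xs vs p)"
| "prefix_true x Xs ((Forall, Y) # qs) l p \<longleftrightarrow> (\<forall>X \<in> Y. prefix_true x (Xs @ [X]) qs l p)"
| "prefix_true x Xs ((Exists, Y) # qs) l p \<longleftrightarrow> (\<exists>X \<in> Y. prefix_true x (Xs @ [X]) qs l p)"

definition models :: "('a, 'b) u_mso \<Rightarrow> 'a config set" where
  "models \<psi> = {x. prefix_true x [] (quant_prefix \<psi>) (num_coords \<psi>) (matrix \<psi>)}"

fun cterm_var :: "cterm \<Rightarrow> nat" where
  "cterm_var (Var j) = j"
| "cterm_var (North t) = cterm_var t"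
| "cterm_var (South t) = cterm_var t"
| "cterm_var (East t) = cterm_var t"
| "cterm_var (West t) = cterm_var t"

fun vars_below :: "nat \<Rightarrow> nat \<Rightarrow> ('a, 'b) qfree \<Rightarrow> bool" where
  "vars_below m l (Eq s t) \<longleftrightarrow> cterm_var s < l \<and> cterm_var t < l"
| "vars_below m l (Letter a t) \<longleftrightarrow> cterm_var t < l"
| "vars_below m l (Symb i t b) \<longleftrightarrow> i < m \<and> cterm_var t < l"
| "vars_below m l (Neg p) \<longleftrightarrow> vars_below m l p"
| "vars_below m l (Conj p q) \<longleftrightarrow> vars_below m l p \<and> vars_below m l q"
| "vars_below m l (Disj p q) \<longleftrightarrow> vars_below m l p \<and> vars_below m l q"

definition closed_formula :: "('a, 'b) u_mso \<Rightarrow> bool" where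
  "closed_formula \<psi> \<longleftrightarrow> vars_below (length (quant_prefix \<psi>)) (num_coords \<psi>) (matrix \<psi>)"

definition u_mso_over :: "'b config set set \<Rightarrow> ('a, 'b) u_mso \<Rightarrow> bool" where
  "u_mso_over C \<psi> \<longleftrightarrow> closed_formula \<psi> \<and> snd ` set (quant_prefix \<psi>) \<subseteq> C"

text \<open>The number of maximal blocks of equal quantifiers is the length of the prefix after merging
  adjacent equal quantifiers.\<close>

definition Pi_bar_formula :: "nat \<Rightarrow> 'b config set set \<Rightarrow> ('a, 'b) u_mso \<Rightarrow> bool" where
  "Pi_bar_formula k C \<psi> \<longleftrightarrow> u_mso_over C \<psi> \<and>
     length (remdups_adj (map fst (quant_prefix \<psi>))) = k \<and>
     (k \<ge> 1 \<longrightarrow> fst (hd (quant_prefix \<psi>)) = Forall)"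

definition binary_full_shift :: "bool config set" where
  "binary_full_shift = UNIV"

end

theory Submission
  imports Defs
begin

text \<open>
  The configurations satisfying a formula form a closed shift invariant set. By compactness, a
  formula holds in a configuration if and only if, for every \<open>N\<close>, a bounded version holds which
  only looks at the cells with codes below \<open>N\<close>. The bounded versions are decidable, so that the
  patterns outside the language can be enumerated.

  Conversely, let the patterns outside the language of \<open>X\<close> be recognized by a nondeterministic
  register machine. Then \<open>x \<notin> X\<close> means that there is an accepting run on the code of a pattern
  occurring in \<open>x\<close>. The universally quantified configurations propose such a run, drawn in a
  rectangle with time going upwards and registers written in unary. No locally checked drawing could
  carry all letters of the pattern through the boundary of the area that it occupies. Therefore the
  run only announces, in one row for each position, which letter is to be found at which
  coordinates, and the existentially quantified configurations refute the run in one of two ways: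
  they trace a local error of the drawing, or they select one announcing row and draw lines that
  meet at the announced cell, where the letter differs. In both cases the claim is a closed local
  condition, and it is well-founded in every rectangle that is drawn correctly.
\<close>

section \<open>Recursive functions\<close>

text \<open>By compactness, an existential block over configurations expresses only closed
  conditions. A finite object such as an accepting run must therefore be proposed by the universal
  block and rejected by local means. A claim handed from cell to cell can be deferred forever on an
  unbounded area; this does no harm, since such an area shows no finite run, whereas the left and
  bottom walls of a rectangle end the deferral. A tested cell is given by its column
  \<open>v\<close> and the sum \<open>w\<close> of its two offsets from the lower left corner: a
  vertical line and an antidiagonal rising from the bottom side can both be carried by rules between
  adjacent cells, and they meet at height \<open>w - v\<close>, wherever the announcing row lies. As
  only one announcement is challenged, one layer per letter, constant over the rectangle, brings the
  announced letter to that cell. Runs idle in the final state, so that the rectangle can be made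
  high enough to contain every tested cell. A configuration may show many rectangles, even
  overlapping ones; those with a common corner receive the same challenge.\<close>

lemma computes_Zero [simp]: "computes Zero xs y \<longleftrightarrow> y = 0"
  by (auto intro: computes.intros elim: computes.cases)

lemma computes_Succ: "computes Succ xs y \<longleftrightarrow> (\<exists>x. xs = [x] \<and> y = Suc x)"
  by (auto intro: computes.intros elim: computes.cases)

lemma computes_Proj: "computes (Proj i) xs y \<longleftrightarrow> i < length xs \<and> y = xs ! i"
  by (auto intro: computes.intros elim: computes.cases)

lemma computes_Comp:
  "computes (Comp f gs) xs z \<longleftrightarrow>
    (\<exists>ys. list_all2 (\<lambda>g y. computes g xs y) gs ys \<and> computes f ys z)"
  by (auto intro: computes.intros elim: computes.cases)

lemma computes_Prim_Nil [simp]: "\<not> computes (Prim f g) [] y"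
  by (auto elim: computes.cases)

lemma computes_Prim_0: "computes (Prim f g) (0 # xs) y \<longleftrightarrow> computes f xs y"
  by (auto intro: computes.intros elim: computes.cases)

lemma computes_Prim_Suc:
  "computes (Prim f g) (Suc k # xs) y \<longleftrightarrow>
    (\<exists>r. computes (Prim f g) (k # xs) r \<and> computes g (r # k # xs) y)"
  by (auto intro: computes.intros elim: computes.cases)

lemma computes_Mu:
  "computes (Mu f) xs k \<longleftrightarrow>
    computes f (k # xs) 0 \<and> (\<forall>j < k. \<exists>y > 0. computes f (j # xs) y)"
  by (subst computes.simps) auto

lemma list_all2_computes:
  assumes "\<And>i y. i < n \<Longrightarrow> computes (g i) xs y \<longleftrightarrow> y = G i"
  shows "list_all2 (\<lambda>g y. computes g xs y) (map g [0..<n]) ys \<longleftrightarrow> ys = map G [0..<n]"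
proof -
  have "list_all2 (\<lambda>g y. computes g xs y) (map g [0..<n]) ys \<longleftrightarrow> list_all2 (\<lambda>i y. y = G i) [0..<n] ys"
    unfolding list_all2_map1 by (rule list.rel_cong) (use assms in auto)
  also have "\<dots> \<longleftrightarrow> ys = map G [0..<n]"
    by (metis (mono_tags, lifting) list_all2_map1 list_all2_eq list_all2_mono)
  finally show ?thesis .
qed

text \<open>A function of an infinite environment counts as recursive if it depends on an initial
  segment only. Binders follow the de Bruijn convention: the bound variable is \<open>e 0\<close> and the
  outer variables are shifted up.\<close>

definition recursive :: "((nat \<Rightarrow> nat) \<Rightarrow> nat) \<Rightarrow> bool" where
  "recursive F \<longleftrightarrow> (\<exists>n f. \<forall>e y. computes f (map e [0..<n]) y \<longleftrightarrow> y = F e)"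

definition decidable :: "((nat \<Rightarrow> nat) \<Rightarrow> bool) \<Rightarrow> bool" where
  "decidable P \<longleftrightarrow> recursive (\<lambda>e. of_bool (P e))"

named_theorems recursive_intros

text \<open>Composition with projections makes a program ignore surplus arguments, so that functions
  of different arities can be brought to a common one.\<close>

lemma recursive_arity:
  assumes "recursive F"
  obtains n where "\<And>m. m \<ge> n \<Longrightarrow> \<exists>f. \<forall>e y. computes f (map e [0..<m]) y \<longleftrightarrow> y = F e"
proof -
  obtain n f where f: "\<And>e y. computes f (map e [0..<n]) y \<longleftrightarrow> y = F e"
    using assms by (auto simp: recursive_def)
  have "computes (Comp f (map Proj [0..<n])) (map e [0..<m]) y \<longleftrightarrow> y = F e" if "m \<ge> n" for m e y
  proof -
    have "list_all2 (\<lambda>g. computes g (map e [0..<m])) (map Proj [0..<n]) ys \<longleftrightarrow> ys = map e [0..<n]" for ys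
      using that by (intro list_all2_computes) (auto simp: computes_Proj)
    then show ?thesis using f by (simp add: computes_Comp)
  qed
  then show ?thesis using that by blast
qed

lemma recursive_var [recursive_intros]: "recursive (\<lambda>e. e i)"
  unfolding recursive_def
  by (intro exI[of _ "Suc i"] exI[of _ "Proj i"]) (auto simp: computes_Proj simp del: upt_Suc)

text \<open>Only the finitely many arguments that \<open>H\<close> reads have to be computed. Hence
  the maximum of their arities serves for all, although the family \<open>G\<close> is
  infinite.\<close>

lemma recursive_subst:
  assumes "recursive H" "\<And>i. recursive (G i)"
  shows "recursive (\<lambda>e. H (\<lambda>i. G i e))"
proof -
  obtain n h where h: "\<And>e y. computes h (map e [0..<n]) y \<longleftrightarrow> y = H e"
    using assms(1) by (auto simp: recursive_def)
  have "\<forall>i. \<exists>k. \<forall>m\<ge>k. \<exists>f. \<forall>e y. computes f (map e [0..<m]) y \<longleftrightarrow> y = G i e"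
    using recursive_arity[OF assms(2)] by (metis (no_types, lifting))
  then obtain k where k: "\<And>i m. m \<ge> k i \<Longrightarrow> \<exists>f. \<forall>e y. computes f (map e [0..<m]) y \<longleftrightarrow> y = G i e"
    by metis
  define m where "m = Max (k ` {..<n} \<union> {0})"
  have "k i \<le> m" if "i < n" for i
    unfolding m_def using that by (intro Max_ge) auto
  then have "\<forall>i. \<exists>f. i < n \<longrightarrow> (\<forall>e y. computes f (map e [0..<m]) y \<longleftrightarrow> y = G i e)"
    using k by blast
  then obtain g where g: "\<And>i e y. i < n \<Longrightarrow> computes (g i) (map e [0..<m]) y \<longleftrightarrow> y = G i e"
    by metis
  have "list_all2 (\<lambda>f. computes f (map e [0..<m])) (map g [0..<n]) ys
      \<longleftrightarrow> ys = map (\<lambda>i. G i e) [0..<n]" for ys e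
    using g by (intro list_all2_computes) auto
  then have "computes (Comp h (map g [0..<n])) (map e [0..<m]) y \<longleftrightarrow> y = H (\<lambda>i. G i e)" for e y
    using h by (simp add: computes_Comp)
  then show ?thesis unfolding recursive_def by blast
qed

lemma recursive_Suc_var: "recursive (\<lambda>e. Suc (e 0))"
  unfolding recursive_def
  by (intro exI[of _ 1] exI[of _ Succ]) (auto simp: computes_Succ)

lemma recursive_Suc [recursive_intros]: "recursive F \<Longrightarrow> recursive (\<lambda>e. Suc (F e))"
  using recursive_subst[OF recursive_Suc_var, of "\<lambda>_. F"] by simp

lemma recursive_const [recursive_intros]: "recursive (\<lambda>e. c)"
proof (induction c)
  case 0
  then show ?case unfolding recursive_def by (intro exI[of _ 0] exI[of _ Zero]) auto
qed (rule recursive_Suc)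

lemma recursive_subst1:
  assumes "recursive (\<lambda>e. H (e 0))" "recursive F"
  shows "recursive (\<lambda>e. H (F e))"
  using recursive_subst[OF assms(1), of "\<lambda>_. F"] assms(2) by simp

lemma recursive_subst2:
  assumes "recursive (\<lambda>e. H (e 0) (e 1))" "recursive F" "recursive G"
  shows "recursive (\<lambda>e. H (F e) (G e))"
  using recursive_subst[OF assms(1), of "\<lambda>i. if i = 0 then F else G"] assms(2,3) by simp

text \<open>The environment of the step function lists the previous value, the counter and then the
  outer variables, which is the order in which \<open>Prim\<close> passes its arguments.\<close>

lemma recursive_rec_nat:
  assumes "recursive F" "recursive (\<lambda>e. G (\<lambda>i. e (Suc (Suc i))) (e 1) (e 0))" "recursive B"
  shows "recursive (\<lambda>e. rec_nat (F e) (\<lambda>k r. G e k r) (B e))"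
proof -
  obtain n1 where n1: "\<And>m. m \<ge> n1 \<Longrightarrow> \<exists>f. \<forall>e y. computes f (map e [0..<m]) y \<longleftrightarrow> y = F e"
    using recursive_arity[OF assms(1)] by blast
  obtain n2 where n2: "\<And>m. m \<ge> n2 \<Longrightarrow> \<exists>f. \<forall>e y. computes f (map e [0..<m]) y
      \<longleftrightarrow> y = G (\<lambda>i. e (Suc (Suc i))) (e 1) (e 0)"
    using recursive_arity[OF assms(2)] by blast
  define m where "m = max n1 n2"
  obtain f where f: "\<And>e y. computes f (map e [0..<m]) y \<longleftrightarrow> y = F e"
    using n1[of m] m_def by auto
  obtain g where g: "\<And>e y. computes g (map e [0..<Suc (Suc m)]) y
      \<longleftrightarrow> y = G (\<lambda>i. e (Suc (Suc i))) (e 1) (e 0)"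
    using n2[of "Suc (Suc m)"] unfolding m_def by (metis le_SucI max.cobounded2)
  have g': "computes g (r # k # map e [0..<m]) y \<longleftrightarrow> y = G e k r" for e k r y
    using g[of "case_nat r (case_nat k e)"]
    by (simp add: upt_conv_Cons map_Suc_upt[symmetric] comp_def del: upt_Suc)
  have *: "computes (Prim f g) (b # map e [0..<m]) y \<longleftrightarrow> y = rec_nat (F e) (\<lambda>k r. G e k r) b" for e b y
    by (induction b arbitrary: y) (auto simp: computes_Prim_0 computes_Prim_Suc f g')
  have "recursive (\<lambda>e. rec_nat (F (\<lambda>i. e (Suc i))) (G (\<lambda>i. e (Suc i))) (e 0))"
    unfolding recursive_def
    by (intro exI[of _ "Suc m"] exI[of _ "Prim f g"] allI)
       (subst *[symmetric], simp add: upt_conv_Cons map_Suc_upt[symmetric] comp_def del: upt_Suc)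
  from recursive_subst[OF this, of "\<lambda>i. case i of 0 \<Rightarrow> B | Suc i \<Rightarrow> (\<lambda>e. e i)"]
  show ?thesis using assms(3) by (simp add: recursive_var split: nat.split)
qed

lemma recursive_add [recursive_intros]:
  assumes "recursive F" "recursive G"
  shows "recursive (\<lambda>e. F e + G e)"
proof (rule recursive_subst2[OF _ assms])
  have "rec_nat a (\<lambda>k r. Suc r) b = a + b" for a b by (induction b) auto
  moreover have "recursive (\<lambda>e. rec_nat (e 0) (\<lambda>k r. Suc r) (e 1))"
    by (intro recursive_rec_nat recursive_intros)
  ultimately show "recursive (\<lambda>e. e 0 + e 1)" by simp
qed

lemma recursive_diff [recursive_intros]:
  assumes "recursive F" "recursive G"
  shows "recursive (\<lambda>e. F e - G e)"
proof (rule recursive_subst2[OF _ assms])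
  \<comment> \<open>Recursion that discards the previous value gives the predecessor; iterating it
    gives truncated subtraction.\<close>
  have "rec_nat 0 (\<lambda>k r. k) b = b - Suc 0" for b by (cases b) auto
  moreover have "recursive (\<lambda>e. rec_nat 0 (\<lambda>k r. k) (F e))" if "recursive F" for F
    using that by (intro recursive_rec_nat recursive_intros)
  ultimately have pred: "recursive (\<lambda>e. F e - Suc 0)" if "recursive F" for F
    using that by simp
  have "rec_nat a (\<lambda>k r. r - Suc 0) b = a - b" for a b by (induction b) auto
  moreover have "recursive (\<lambda>e. rec_nat (e 0) (\<lambda>k r. r - Suc 0) (e 1))"
    by (intro recursive_rec_nat recursive_intros pred)
  ultimately show "recursive (\<lambda>e. e 0 - e 1)" by simp
qed

lemma recursive_sum [recursive_intros]:
  assumes "recursive (\<lambda>e. F (\<lambda>i. e (Suc i)) (e 0))" "recursive B"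
  shows "recursive (\<lambda>e. \<Sum>k<B e. F e k)"
proof -
  have "rec_nat 0 (\<lambda>k r. r + F e k) b = (\<Sum>k<b. F e k)" for e b by (induction b) auto
  moreover have "recursive (\<lambda>e. rec_nat 0 (\<lambda>k r. r + F e k) (B e))"
    using recursive_subst[OF assms(1) recursive_var, of Suc] assms(2)
    by (intro recursive_rec_nat recursive_intros) simp_all
  ultimately show ?thesis by simp
qed

lemma recursive_mult [recursive_intros]:
  assumes "recursive F" "recursive G"
  shows "recursive (\<lambda>e. F e * G e)"
proof (rule recursive_subst2[OF _ assms])
  have "recursive (\<lambda>e. \<Sum>k<e 1. e 0)" by (intro recursive_intros)
  then show "recursive (\<lambda>e. e 0 * e 1)" by (simp add: mult.commute)
qed

lemma recursive_power [recursive_intros]: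
  assumes "recursive F" "recursive G"
  shows "recursive (\<lambda>e. F e ^ G e)"
proof (rule recursive_subst2[OF _ assms])
  have "rec_nat 1 (\<lambda>k r. r * a) b = a ^ b" for a b :: nat by (induction b) auto
  moreover have "recursive (\<lambda>e. rec_nat 1 (\<lambda>k r. r * e 0) (e 1))"
    by (intro recursive_rec_nat recursive_intros)
  ultimately show "recursive (\<lambda>e. e 0 ^ e 1)" by simp
qed

lemma recursive_of_bool [recursive_intros]: "decidable P \<Longrightarrow> recursive (\<lambda>e. of_bool (P e))"
  by (simp add: decidable_def)

lemma decidable_not [recursive_intros]: "decidable P \<Longrightarrow> decidable (\<lambda>e. \<not> P e)"
proof -
  have "of_bool (\<not> P e) = 1 - (of_bool (P e) :: nat)" for e by simp
  moreover assume "decidable P"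
  then have "recursive (\<lambda>e. 1 - of_bool (P e))"
    unfolding decidable_def by (intro recursive_diff recursive_const)
  ultimately show ?thesis unfolding decidable_def by (simp only:)
qed

lemma decidable_conj [recursive_intros]:
  "decidable P \<Longrightarrow> decidable Q \<Longrightarrow> decidable (\<lambda>e. P e \<and> Q e)"
  using recursive_mult by (simp add: decidable_def of_bool_conj)

lemma decidable_disj [recursive_intros]:
  "decidable P \<Longrightarrow> decidable Q \<Longrightarrow> decidable (\<lambda>e. P e \<or> Q e)"
  using decidable_not[OF decidable_conj[OF decidable_not decidable_not], of P Q] by simp

lemma decidable_imp [recursive_intros]:
  "decidable P \<Longrightarrow> decidable Q \<Longrightarrow> decidable (\<lambda>e. P e \<longrightarrow> Q e)"
  using decidable_disj[OF decidable_not, of P Q] by (simp only: imp_conv_disj)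

lemma decidable_le [recursive_intros]:
  assumes "recursive F" "recursive G"
  shows "decidable (\<lambda>e. F e \<le> G e)"
proof -
  have "recursive (\<lambda>e. 1 - (F e - G e))" using assms by (intro recursive_intros)
  moreover have "(1 - (F e - G e)) = of_bool (F e \<le> G e)" for e by auto
  ultimately show ?thesis by (simp add: decidable_def)
qed

lemma decidable_less [recursive_intros]:
  "recursive F \<Longrightarrow> recursive G \<Longrightarrow> decidable (\<lambda>e. F e < G e)"
  using decidable_not[OF decidable_le, of G F] by (simp add: not_le)

lemma decidable_eq [recursive_intros]:
  "recursive F \<Longrightarrow> recursive G \<Longrightarrow> decidable (\<lambda>e. F e = G e)"
  using decidable_conj[OF decidable_le[of F G] decidable_le[of G F]] by (simp add: eq_iff)

lemma decidable_const [recursive_intros]: "decidable (\<lambda>e. b)"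
  unfolding decidable_def by (rule recursive_const)

lemma recursive_if [recursive_intros]:
  assumes "decidable P" "recursive F" "recursive G"
  shows "recursive (\<lambda>e. if P e then F e else G e)"
proof -
  have "recursive (\<lambda>e. of_bool (P e) * F e + of_bool (\<not> P e) * G e)"
    using assms by (intro recursive_intros)
  moreover have "(\<lambda>e. of_bool (P e) * F e + of_bool (\<not> P e) * G e) = (\<lambda>e. if P e then F e else G e)"
    by auto
  ultimately show ?thesis by simp
qed

lemma decidable_subst:
  "decidable P \<Longrightarrow> (\<And>i. recursive (G i)) \<Longrightarrow> decidable (\<lambda>e. P (\<lambda>i. G i e))"
  unfolding decidable_def by (rule recursive_subst)

lemma decidable_ex_less [recursive_intros]:
  assumes "decidable (\<lambda>e. P (\<lambda>i. e (Suc i)) (e 0))" "recursive B"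
  shows "decidable (\<lambda>e. \<exists>k<B e. P e k)"
proof -
  have "decidable (\<lambda>e. (0 :: nat) < (\<Sum>k<B e. of_bool (P e k)))"
    using assms by (intro recursive_intros)
  moreover have "0 < (\<Sum>k<B e. of_bool (P e k) :: nat) \<longleftrightarrow> (\<exists>k<B e. P e k)" for e
    by (auto simp: of_bool_def sum.If_cases card_gt_0_iff)
  ultimately show ?thesis by simp
qed

lemma decidable_all_less [recursive_intros]:
  assumes "decidable (\<lambda>e. P (\<lambda>i. e (Suc i)) (e 0))" "recursive B"
  shows "decidable (\<lambda>e. \<forall>k<B e. P e k)"
  using decidable_not[OF decidable_ex_less[OF decidable_not[OF assms(1)] assms(2)]] by simp

lemma recursive_upd:
  "recursive (\<lambda>e. ((\<lambda>i. e (Suc i))(v := e 0)) i)"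
  by (cases "i = v") (simp_all add: recursive_var)

lemma decidable_ex_upd:
  assumes "decidable P" "recursive B"
  shows "decidable (\<lambda>e. \<exists>k<B e. P (e(v := k)))"
  by (rule decidable_ex_less[OF decidable_subst[OF assms(1) recursive_upd] assms(2)])

lemma decidable_all_upd:
  assumes "decidable P" "recursive B"
  shows "decidable (\<lambda>e. \<forall>k<B e. P (e(v := k)))"
  by (rule decidable_all_less[OF decidable_subst[OF assms(1) recursive_upd] assms(2)])

text \<open>The quotient counts the positive multiples of the divisor that do not exceed the
  dividend. Division by zero has the value zero and is split off.\<close>

lemma recursive_div [recursive_intros]:
  assumes "recursive F" "recursive G"
  shows "recursive (\<lambda>e. F e div G e)"
proof (rule recursive_subst2[OF _ assms])
  have "recursive (\<lambda>e. if e 1 = 0 then 0 else \<Sum>q<e 0. of_bool (Suc q * e 1 \<le> e 0))"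
    by (intro recursive_intros)
  moreover have "(if b = 0 then 0 else \<Sum>q<a. of_bool (Suc q * b \<le> a)) = a div b" for a b :: nat
  proof (cases "b = 0")
    case False
    have "Suc q * b \<le> a \<longleftrightarrow> q < a div b" for q
      using False by (metis Suc_le_eq less_eq_div_iff_mult_less_eq not_gr_zero)
    moreover have "q < a" if "q < a div b" for q
      using that div_le_dividend[of a b] by linarith
    ultimately have eq: "{q. q < a \<and> Suc q * b \<le> a} = {..<a div b}"
      by blast
    have "(\<Sum>q<a. of_bool (Suc q * b \<le> a)) = card {q. q < a \<and> Suc q * b \<le> a}"
      unfolding of_bool_def by (subst sum.If_cases) (simp_all add: Int_def del: mult_Suc)
    with False show ?thesis by (simp only: eq card_lessThan if_False)
  qed simp
  ultimately show "recursive (\<lambda>e. e 0 div e 1)" by (simp only:)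
qed

lemma recursive_mod [recursive_intros]:
  assumes "recursive F" "recursive G"
  shows "recursive (\<lambda>e. F e mod G e)"
  unfolding minus_mult_div_eq_mod[symmetric] by (intro recursive_intros assms)

lemma recursive_prod_encode [recursive_intros]:
  "recursive F \<Longrightarrow> recursive G \<Longrightarrow> recursive (\<lambda>e. prod_encode (F e, G e))"
  unfolding prod_encode_def triangle_def by simp (intro recursive_intros)

text \<open>Both components of a pair are at most its code, so a bounded search finds the only
  nonvanishing term of the sum.\<close>

lemma recursive_fst_prod_decode [recursive_intros]:
  assumes "recursive F"
  shows "recursive (\<lambda>e. fst (prod_decode (F e)))"
proof (rule recursive_subst1[OF _ assms, of "\<lambda>p. fst (prod_decode p)"])
  have "fst (prod_decode p) = (\<Sum>i<Suc p. of_bool (\<exists>j<Suc p. prod_encode (i, j) = p) * i)" for p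
  proof -
    obtain a b where p: "p = prod_encode (a, b)" by (metis prod_decode_inverse surj_pair)
    have "(\<Sum>i<Suc p. of_bool (\<exists>j<Suc p. prod_encode (i, j) = p) * i)
        = (\<Sum>i<Suc p. if i = a then a else 0)"
      by (intro sum.cong refl) (auto simp: p less_Suc_eq_le le_prod_encode_2)
    then show ?thesis by (simp add: p less_Suc_eq_le le_prod_encode_1 del: sum.lessThan_Suc)
  qed
  moreover have "recursive (\<lambda>e. \<Sum>i<Suc (e 0). of_bool (\<exists>j<Suc (e 0). prod_encode (i, j) = e 0) * i)"
    by (intro recursive_intros)
  ultimately show "recursive (\<lambda>e. fst (prod_decode (e 0)))" by (simp only:)
qed

lemma recursive_snd_prod_decode [recursive_intros]:
  assumes "recursive F"
  shows "recursive (\<lambda>e. snd (prod_decode (F e)))"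
proof (rule recursive_subst1[OF _ assms, of "\<lambda>p. snd (prod_decode p)"])
  have "snd (prod_decode p) = (\<Sum>i<Suc p. of_bool (\<exists>j<Suc p. prod_encode (j, i) = p) * i)" for p
  proof -
    obtain a b where p: "p = prod_encode (a, b)" by (metis prod_decode_inverse surj_pair)
    have "(\<Sum>i<Suc p. of_bool (\<exists>j<Suc p. prod_encode (j, i) = p) * i)
        = (\<Sum>i<Suc p. if i = b then b else 0)"
      by (intro sum.cong refl) (auto simp: p less_Suc_eq_le le_prod_encode_1)
    then show ?thesis by (simp add: p less_Suc_eq_le le_prod_encode_2 del: sum.lessThan_Suc)
  qed
  moreover have "recursive (\<lambda>e. \<Sum>i<Suc (e 0). of_bool (\<exists>j<Suc (e 0). prod_encode (j, i) = e 0) * i)"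
    by (intro recursive_intros)
  ultimately show "recursive (\<lambda>e. snd (prod_decode (e 0)))" by (simp only:)
qed

lemma ex_computes_binary:
  assumes "recursive (\<lambda>e. H (e 0) (e 1))"
  obtains g where "\<And>a b y. computes g [a, b] y \<longleftrightarrow> y = H a b"
proof -
  obtain n where n: "\<And>m. m \<ge> n \<Longrightarrow> \<exists>f. \<forall>e y. computes f (map e [0..<m]) y \<longleftrightarrow> y = H (e 0) (e 1)"
    using recursive_arity[OF assms] by blast
  then obtain m f where m: "m \<ge> 2" and
    f: "\<And>e y. computes f (map e [0..<m]) y \<longleftrightarrow> y = H (e 0) (e 1)"
    by (meson max.cobounded1 max.cobounded2)
  define g where "g = Comp f (map (\<lambda>i. if i < 2 then Proj i else Zero) [0..<m])"
  have "computes g [a, b] y \<longleftrightarrow> y = H a b" for a b y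
  proof -
    define e where "e = case_nat a (case_nat b (\<lambda>_. 0))"
    have "list_all2 (\<lambda>g. computes g [a, b]) (map (\<lambda>i. if i < 2 then Proj i else Zero) [0..<m]) ys
      \<longleftrightarrow> ys = map e [0..<m]" for ys
      by (intro list_all2_computes) (auto simp: computes_Proj e_def less_2_cases_iff split: nat.split)
    then have "computes g [a, b] y \<longleftrightarrow> computes f (map e [0..<m]) y"
      by (simp add: g_def computes_Comp)
    then show ?thesis by (simp add: f e_def)
  qed
  then show ?thesis by (rule that)
qed

text \<open>\<open>Mu\<close> searches for a zero and is therefore applied to the characteristic
  function of the negation. That function is total, so the search succeeds as soon as a witness
  exists.\<close>

lemma recursively_enumerable_ex:
  assumes "decidable (\<lambda>e. P (e 0) (e 1))"
  shows "recursively_enumerable {k. \<exists>N. P N k}"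
proof -
  have "recursive (\<lambda>e. of_bool (\<not> P (e 0) (e 1)))"
    using assms by (intro recursive_intros)
  then obtain g where g: "\<And>N k y. computes g [N, k] y \<longleftrightarrow> y = of_bool (\<not> P N k)"
    by (rule ex_computes_binary[of "\<lambda>N k. of_bool (\<not> P N k)"]) blast
  have "(\<exists>N. computes (Mu g) [k] N) \<longleftrightarrow> (\<exists>N. P N k)" for k
  proof
    assume "\<exists>N. P N k"
    then have "P (LEAST N. P N k) k" by (metis LeastI)
    then have "computes (Mu g) [k] (LEAST N. P N k)"
      by (auto simp: computes_Mu g dest: not_less_Least)
    then show "\<exists>N. computes (Mu g) [k] N" by blast
  qed (auto simp: computes_Mu g)
  then show ?thesis unfolding recursively_enumerable_def by blast
qed

section \<open>Digits and cells\<close>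

text \<open>Unlike \<open>pattern_digit\<close>, which inspects the pattern, this reads a digit from
  the number itself and is visibly recursive.\<close>

definition digit :: "nat \<Rightarrow> nat \<Rightarrow> nat \<Rightarrow> nat" where
  "digit b n i = n div b ^ i mod b"

lemma recursive_digit [recursive_intros]:
  "recursive B \<Longrightarrow> recursive F \<Longrightarrow> recursive G \<Longrightarrow> recursive (\<lambda>e. digit (B e) (F e) (G e))"
  unfolding digit_def by (intro recursive_intros)

lemma sum_digits_Suc:
  "(\<Sum>i<Suc k. d i * b ^ i) = d 0 + b * (\<Sum>i<k. d (Suc i) * b ^ i)" for b :: nat
  by (subst sum.lessThan_Suc_shift) (simp add: sum_distrib_left algebra_simps)

lemma digit_sum:
  assumes "\<And>i. d i < b"
  shows "digit b (\<Sum>i<k. d i * b ^ i) i = (if i < k then d i else 0)"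
  using assms
proof (induction i arbitrary: d k)
  case 0
  then show ?case
    by (cases k) (simp_all add: digit_def sum_digits_Suc del: sum.lessThan_Suc)
next
  case (Suc i)
  show ?case
  proof (cases k)
    case (Suc k')
    have "b > 0" using Suc.prems[of 0] by simp
    then have "(\<Sum>i<k. d i * b ^ i) div b = (\<Sum>i<k'. d (Suc i) * b ^ i)"
      using Suc.prems[of 0] unfolding Suc sum_digits_Suc by simp
    then have "digit b (\<Sum>i<k. d i * b ^ i) (Suc i) = digit b (\<Sum>i<k'. d (Suc i) * b ^ i) i"
      by (simp add: digit_def div_mult2_eq)
    then show ?thesis using Suc.IH[of "\<lambda>i. d (Suc i)" k'] Suc.prems Suc by simp
  qed (simp add: digit_def)
qed

lemma sum_digits_less:
  fixes d :: "nat \<Rightarrow> nat"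
  assumes "\<And>i. d i < b"
  shows "(\<Sum>i<k. d i * b ^ i) < b ^ k"
proof (induction k)
  case (Suc k)
  have "d k * b ^ k + b ^ k \<le> b * b ^ k"
    using mult_le_mono1[of "Suc (d k)" b "b ^ k"] assms[of k] by (simp add: Suc_le_eq)
  with Suc show ?case by simp
qed simp

abbreviation cell_of :: "nat \<Rightarrow> cell" where
  "cell_of \<equiv> inv cell_code"

lemma cell_code_cell_of [simp]: "cell_code (cell_of p) = p"
  using bij_cell_code by (simp add: bij_is_surj surj_f_inv_f)

lemma cell_of_cell_code [simp]: "cell_of (cell_code v) = v"
  using bij_cell_code by (simp add: bij_is_inj)

lemma cell_of_eq: "cell_of p = (int_decode (fst (prod_decode p)), int_decode (snd (prod_decode p)))"
proof -
  have "cell_code (int_decode (fst (prod_decode p)), int_decode (snd (prod_decode p))) = p"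
    by (simp add: cell_code_def)
  then show ?thesis by (metis cell_of_cell_code)
qed

lemma int_decode_alt: "int_decode n = (if even n then int (n div 2) else - int (n div 2) - 1)"
  by (simp add: int_decode_def sum_decode_def)

lemma int_encode_alt: "int_encode i = (if i \<ge> 0 then 2 * nat i else Suc (2 * nat (- i - 1)))"
  by (simp add: int_encode_def sum_encode_def)

text \<open>Nonnegative integers have even codes and negative ones odd codes, so a unit step changes
  the code by two. At \<open>j = 1\<close>, the code of -1, truncated subtraction yields
  \<open>0\<close>, the code of zero.\<close>

lemma int_encode_add_1: "int_encode (int_decode j + 1) = (if j mod 2 = 0 then j + 2 else j - 2)"
proof (cases "even j")
  case True
  then obtain i where "j = 2 * i" by (elim evenE)
  then show ?thesis by (simp add: int_decode_alt int_encode_alt nat_add_distrib)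
next
  case False
  then obtain i where "j = 2 * i + 1" by (elim oddE)
  then show ?thesis by (cases i) (simp_all add: int_decode_alt int_encode_alt)
qed

lemma int_encode_diff_1:
  "int_encode (int_decode j - 1) = (if j = 0 then 1 else if j mod 2 = 0 then j - 2 else j + 2)"
proof (cases "even j")
  case True
  then obtain i where "j = 2 * i" by (elim evenE)
  then show ?thesis by (cases i) (simp_all add: int_decode_alt int_encode_alt)
next
  case False
  then obtain i where "j = 2 * i + 1" by (elim oddE)
  then show ?thesis by (simp add: int_decode_alt int_encode_alt nat_add_distrib)
qed

lemma recursive_cell_shift:
  assumes "recursive F"
  shows "recursive (\<lambda>e. cell_code (cell_of (F e) + (0, 1)))"
    and "recursive (\<lambda>e. cell_code (cell_of (F e) - (0, 1)))"
    and "recursive (\<lambda>e. cell_code (cell_of (F e) + (1, 0)))"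
    and "recursive (\<lambda>e. cell_code (cell_of (F e) - (1, 0)))"
  unfolding cell_of_eq cell_code_def fst_add snd_add fst_diff snd_diff fst_conv snd_conv
    add_0_right diff_0_right int_decode_inverse int_encode_add_1 int_encode_diff_1
  by (intro recursive_intros assms)+

section \<open>Compactness\<close>

text \<open>Koenig's lemma: a segment is kept extendable if, for every \<open>N\<close>, it starts
  some solution of \<open>Q N\<close>. If each next letter failed at some bound of its own, the
  largest of these finitely many bounds would contradict extendability.\<close>

lemma compactness_nat:
  fixes Q :: "nat \<Rightarrow> (nat \<Rightarrow> 'b::finite) \<Rightarrow> bool"
  assumes anti: "\<And>N f. Q (Suc N) f \<Longrightarrow> Q N f"
    and local: "\<And>N f g. (\<And>i. i < N \<Longrightarrow> f i = g i) \<Longrightarrow> Q N f \<Longrightarrow> Q N g"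
    and ex: "\<And>N. \<exists>f. Q N f"
  shows "\<exists>f. \<forall>N. Q N f"
proof -
  have anti': "Q N f" if "Q M f" "N \<le> M" for N M f
    using that(2,1) by (induction rule: dec_induct) (auto intro: anti)
  define ext where "ext h n \<longleftrightarrow> (\<forall>N. \<exists>f. Q N f \<and> (\<forall>i<n. f i = h i))" for h n
  have step: "\<exists>b. ext (h(n := b)) (Suc n)" if h: "ext h n" for h n
  proof (rule ccontr)
    assume "\<not> (\<exists>b. ext (h(n := b)) (Suc n))"
    then have "\<forall>b. \<exists>N. \<forall>f. \<not> (Q N f \<and> (\<forall>i<Suc n. f i = (h(n := b)) i))"
      by (simp add: ext_def)
    then obtain M where M: "\<And>b f. \<not> (Q (M b) f \<and> (\<forall>i<Suc n. f i = (h(n := b)) i))"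
      by metis
    obtain f where f: "Q (Max (range M)) f" "\<forall>i<n. f i = h i"
      using h unfolding ext_def by blast
    have "Q (M (f n)) f" using f(1) by (rule anti') simp
    moreover have "\<forall>i<Suc n. f i = (h(n := f n)) i" using f(2) by (simp add: less_Suc_eq)
    ultimately show False using M by blast
  qed
  define H where "H = rec_nat (\<lambda>_. undefined) (\<lambda>n h. h(n := SOME b. ext (h(n := b)) (Suc n)))"
  have H_Suc: "H (Suc n) = (H n)(n := SOME b. ext ((H n)(n := b)) (Suc n))" for n
    by (simp add: H_def)
  have H: "ext (H n) n" for n
  proof (induction n)
    case 0
    then show ?case using ex by (simp add: ext_def)
  next
    case (Suc n)
    show ?case unfolding H_Suc by (rule someI_ex) (rule step[OF Suc])
  qed
  have H_eq: "H n i = H (Suc i) i" if "i < n" for n i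
    using that by (induction n) (auto simp: less_Suc_eq H_Suc)
  have "Q N (\<lambda>i. H (Suc i) i)" for N
  proof -
    obtain f where f: "Q N f" "\<forall>i<N. f i = H N i" using H[of N] unfolding ext_def by blast
    show ?thesis
    proof (rule local[OF _ f(1)])
      show "f i = H (Suc i) i" if "i < N" for i using f(2) H_eq[OF that] that by simp
    qed
  qed
  then show ?thesis by blast
qed

definition agree :: "nat \<Rightarrow> 'b config \<Rightarrow> 'b config \<Rightarrow> bool" where
  "agree N x y \<longleftrightarrow> (\<forall>v. cell_code v < N \<longrightarrow> x v = y v)"

lemma agree_refl [simp]: "agree N x x"
  by (simp add: agree_def)

lemma agree_sym: "agree N x y \<Longrightarrow> agree N y x"
  by (simp add: agree_def)

lemma compactness:
  fixes Q :: "nat \<Rightarrow> 'b::finite config \<Rightarrow> bool"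
  assumes anti: "\<And>N x. Q (Suc N) x \<Longrightarrow> Q N x"
    and local: "\<And>N x y. agree N x y \<Longrightarrow> Q N x \<Longrightarrow> Q N y"
  shows "(\<exists>x. \<forall>N. Q N x) \<longleftrightarrow> (\<forall>N. \<exists>x. Q N x)"
proof
  assume ex: "\<forall>N. \<exists>x. Q N x"
  have "\<exists>f. \<forall>N. Q N (\<lambda>v. f (cell_code v))"
  proof (rule compactness_nat)
    show "\<exists>f. Q N (\<lambda>v. f (cell_code v))" for N
    proof -
      obtain x where "Q N x" using ex by blast
      then show ?thesis by (intro exI[of _ "\<lambda>i. x (cell_of i)"]) simp
    qed
    show "Q N (\<lambda>v. g (cell_code v))"
      if "\<And>i. i < N \<Longrightarrow> f i = g i" "Q N (\<lambda>v. f (cell_code v))" for N f g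
      using that(1) by (intro local[OF _ that(2)]) (simp add: agree_def)
  qed (rule anti)
  then show "\<exists>x. \<forall>N. Q N x" by blast
qed blast

section \<open>Finite approximations of formulas\<close>

fun atom_terms :: "('a, 'b) qfree \<Rightarrow> cterm set" where
  "atom_terms (Eq s t) = {s, t}"
| "atom_terms (Letter a t) = {t}"
| "atom_terms (Symb i t b) = {t}"
| "atom_terms (Neg p) = atom_terms p"
| "atom_terms (Conj p q) = atom_terms p \<union> atom_terms q"
| "atom_terms (Disj p q) = atom_terms p \<union> atom_terms q"

lemma finite_atom_terms: "finite (atom_terms p)"
  by (induction p) auto

text \<open>An instance with an atom outside the window counts as true. Enlarging the window thus
  only adds constraints, and the value depends on the cells inside alone.\<close>

definition window_true ::
    "nat \<Rightarrow> 'a config \<Rightarrow> 'b config list \<Rightarrow> ('a, 'b) qfree \<Rightarrow> cell list \<Rightarrow> bool" where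
  "window_true N x Xs p vs \<longleftrightarrow>
    ((\<forall>t \<in> atom_terms p. cell_code (cterm_val vs t) < N) \<longrightarrow> qfree_true x Xs vs p)"

text \<open>Quantified configurations are still infinite here; they are replaced by finite codes
  only when decidability is at stake.\<close>

fun approx_true :: "nat \<Rightarrow> 'a config \<Rightarrow> 'b config list \<Rightarrow> quantifier list
    \<Rightarrow> nat \<Rightarrow> ('a, 'b) qfree \<Rightarrow> bool" where
  "approx_true N x Xs [] l p \<longleftrightarrow>
     (\<forall>vs. length vs = l \<and> (\<forall>v \<in> set vs. cell_code v < N) \<longrightarrow> window_true N x Xs p vs)"
| "approx_true N x Xs (Forall # qs) l p \<longleftrightarrow> (\<forall>X. approx_true N x (Xs @ [X]) qs l p)"
| "approx_true N x Xs (Exists # qs) l p \<longleftrightarrow> (\<exists>X. approx_true N x (Xs @ [X]) qs l p)"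

lemma qfree_true_agree:
  assumes "agree N x x'" "list_all2 (agree N) Xs Xs'" "vars_below (length Xs) l p"
    "\<forall>t \<in> atom_terms p. cell_code (cterm_val vs t) < N"
  shows "qfree_true x Xs vs p \<longleftrightarrow> qfree_true x' Xs' vs p"
  using assms by (induction p) (auto simp: agree_def list_all2_conv_all_nth simp del: split_paired_All)

lemma list_all2_agree_snoc: "agree N X Y \<Longrightarrow> list_all2 (agree N) (Xs @ [X]) (Xs @ [Y])"
  by (simp add: list_all2_appendI list.rel_refl)

lemma approx_true_agree:
  assumes "agree N x x'" "list_all2 (agree N) Xs Xs'" "vars_below (length Xs + length qs) l p"
    "approx_true N x Xs qs l p"
  shows "approx_true N x' Xs' qs l p"
  using assms(2-)
proof (induction qs arbitrary: Xs Xs')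
  case Nil
  have "qfree_true x Xs vs p \<longleftrightarrow> qfree_true x' Xs' vs p"
    if "\<forall>t\<in>atom_terms p. cell_code (cterm_val vs t) < N" for vs
    using qfree_true_agree[OF assms(1) Nil(1) _ that, of l] Nil(2) by simp
  then show ?case using Nil(3) by (simp add: window_true_def)
next
  case (Cons q qs)
  have ext: "list_all2 (agree N) (Xs @ [X]) (Xs' @ [X])" for X
    using Cons.prems(1) by (auto intro: list_all2_appendI)
  have "approx_true N x' (Xs' @ [X]) qs l p" if "approx_true N x (Xs @ [X]) qs l p" for X
    using Cons.IH[OF ext _ that] Cons.prems(2) by simp
  then show ?case using Cons.prems(3) by (cases q) auto
qed

lemma approx_true_Suc: "approx_true (Suc N) x Xs qs l p \<Longrightarrow> approx_true N x Xs qs l p"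
proof (induction qs arbitrary: Xs)
  case Nil
  then show ?case by (auto simp: window_true_def less_Suc_eq)
next
  case (Cons q qs)
  then show ?case by (cases q) auto
qed

text \<open>Universal quantifiers commute with the quantifier over \<open>N\<close>. Existential
  ones do so by compactness, where finiteness of the alphabet and locality of the approximations
  enter.\<close>

lemma prefix_true_iff_approx:
  fixes Xs :: "'b::finite config list"
  assumes "vars_below (length Xs + length qs) l p" "snd ` set qs \<subseteq> {UNIV}"
  shows "prefix_true x Xs qs l p \<longleftrightarrow> (\<forall>N. approx_true N x Xs (map fst qs) l p)"
  using assms
proof (induction qs arbitrary: Xs)
  case Nil
  show ?case
  proof (simp add: window_true_def, intro iffI allI impI)
    fix vs :: "cell list"
    assume *: "\<forall>N vs. length vs = l \<and> (\<forall>v\<in>set vs. cell_code v < N) \<longrightarrow>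
      (\<forall>t\<in>atom_terms p. cell_code (cterm_val vs t) < N) \<longrightarrow> qfree_true x Xs vs p" and "length vs = l"
    have "finite (cell_code ` set vs \<union> (\<lambda>t. cell_code (cterm_val vs t)) ` atom_terms p)"
      by (simp add: finite_atom_terms)
    then obtain N where "\<forall>k \<in> cell_code ` set vs \<union> (\<lambda>t. cell_code (cterm_val vs t)) ` atom_terms p. k < N"
      using finite_nat_set_iff_bounded by meson
    with * \<open>length vs = l\<close> show "qfree_true x Xs vs p" by blast
  qed auto
next
  case (Cons qY qs)
  obtain q where qY: "qY = (q, UNIV)" using Cons.prems(2) by (cases qY) auto
  have IH: "prefix_true x (Xs @ [X]) qs l p \<longleftrightarrow> (\<forall>N. approx_true N x (Xs @ [X]) (map fst qs) l p)" for X
    using Cons.prems by (intro Cons.IH) auto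
  show ?case
  proof (cases q)
    case Forall
    then show ?thesis by (auto simp: qY IH)
  next
    case Exists
    have "(\<exists>X. \<forall>N. approx_true N x (Xs @ [X]) (map fst qs) l p)
      \<longleftrightarrow> (\<forall>N. \<exists>X. approx_true N x (Xs @ [X]) (map fst qs) l p)"
    proof (rule compactness)
      show "approx_true N x (Xs @ [Y]) (map fst qs) l p"
        if "agree N X Y" "approx_true N x (Xs @ [X]) (map fst qs) l p" for N X Y
        using that Cons.prems(1)
        by (intro approx_true_agree[OF agree_refl _ _ that(2)])
           (auto intro: list_all2_agree_snoc)
    qed (rule approx_true_Suc)
    then show ?thesis by (simp add: qY Exists IH)
  qed
qed

lemma models_iff_approx:
  fixes \<psi> :: "('a, 'b::finite) u_mso"
  assumes "u_mso_over {UNIV} \<psi>"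
  shows "x \<in> models \<psi> \<longleftrightarrow>
    (\<forall>N. approx_true N x [] (map fst (quant_prefix \<psi>)) (num_coords \<psi>) (matrix \<psi>))"
  unfolding models_def mem_Collect_eq using assms
  by (intro prefix_true_iff_approx) (auto simp: u_mso_over_def closed_formula_def)

section \<open>Shift invariance\<close>

lemma cterm_val_shift:
  "cterm_var t < length vs \<Longrightarrow> cterm_val (map ((+) d) vs) t = d + cterm_val vs t"
  by (induction t) (auto simp: algebra_simps)

lemma qfree_true_shift:
  assumes "vars_below (length Xs) (length vs) p"
  shows "qfree_true (\<lambda>v. x (d + v)) (map (\<lambda>X v. X (d + v)) Xs) vs p
    \<longleftrightarrow> qfree_true x Xs (map ((+) d) vs) p"
  using assms by (induction p) (auto simp: cterm_val_shift)

lemma prefix_true_shift: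
  assumes "vars_below (length Xs + length qs) l p" "snd ` set qs \<subseteq> {UNIV}" "prefix_true x Xs qs l p"
  shows "prefix_true (\<lambda>v. x (d + v)) (map (\<lambda>X v. X (d + v)) Xs) qs l p"
  using assms
proof (induction qs arbitrary: Xs)
  case Nil
  then show ?case using qfree_true_shift[of Xs _ p x d] by auto
next
  case (Cons qY qs)
  obtain q where qY: "qY = (q, UNIV)" using Cons.prems(2) by (cases qY) auto
  have IH: "prefix_true (\<lambda>v. x (d + v)) (map (\<lambda>X v. X (d + v)) Xs @ [\<lambda>v. X (d + v)]) qs l p"
    if "prefix_true x (Xs @ [X]) qs l p" for X
    using Cons.IH[OF _ _ that] Cons.prems by simp
  show ?case
  proof (cases q)
    case Forall
    have "prefix_true (\<lambda>v. x (d + v)) (map (\<lambda>X v. X (d + v)) Xs @ [X]) qs l p" for X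
      \<comment> \<open>In the universal case \<open>X\<close> has to be presented as a shifted
        configuration, so the hypothesis is used at its backward shift, which again belongs to the
        full shift.\<close>
      using IH[of "\<lambda>v. X (v - d)"] Cons.prems(3) by (simp add: qY Forall)
    then show ?thesis by (simp add: qY Forall)
  next
    case Exists
    then show ?thesis using Cons.prems(3) IH by (auto simp: qY)
  qed
qed

lemma models_shift:
  assumes "u_mso_over {UNIV} \<psi>" "x \<in> models \<psi>"
  shows "(\<lambda>v. x (d + v)) \<in> models \<psi>"
  using prefix_true_shift[of "[]" "quant_prefix \<psi>" "num_coords \<psi>" "matrix \<psi>" x d] assms
  by (simp add: models_def u_mso_over_def closed_formula_def)

definition extends :: "'a config \<Rightarrow> 'a pattern \<Rightarrow> bool" where
  "extends x P \<longleftrightarrow> (\<forall>v \<in> dom P. P v = Some (x v))"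

lemma occurs_in_config: "occurs_in P (Some \<circ> x) \<longleftrightarrow> (\<exists>d. extends (\<lambda>v. x (d + v)) P)"
  unfolding occurs_in_def extends_def by (metis (no_types, lifting) UNIV_I comp_apply dom_def
    mem_Collect_eq option.distinct(1))

lemma language_models:
  assumes "u_mso_over {UNIV} \<psi>"
  shows "P \<in> language (models \<psi>) \<longleftrightarrow> P \<in> finite_patterns \<and> (\<exists>x \<in> models \<psi>. extends x P)"
proof -
  have "(\<exists>x \<in> models \<psi>. occurs_in P (Some \<circ> x)) \<longleftrightarrow> (\<exists>x \<in> models \<psi>. extends x P)"
  proof
    assume "\<exists>x \<in> models \<psi>. occurs_in P (Some \<circ> x)"
    then show "\<exists>x \<in> models \<psi>. extends x P"
      unfolding occurs_in_config using models_shift[OF assms] by blast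
  next
    assume "\<exists>x \<in> models \<psi>. extends x P"
    then obtain x where "x \<in> models \<psi>" "extends (\<lambda>v. x (0 + v)) P" by auto
    then show "\<exists>x \<in> models \<psi>. occurs_in P (Some \<circ> x)"
      unfolding occurs_in_config by blast
  qed
  then show ?thesis by (simp add: language_def)
qed

text \<open>A configuration avoiding all patterns outside the language agrees with some model on
  each window, and the approximation for that window sees nothing else.\<close>

lemma subshift_models:
  fixes \<psi> :: "('a::finite, 'b::finite) u_mso"
  assumes "u_mso_over {UNIV} \<psi>"
  shows "subshift (models \<psi>)"
  unfolding subshift_def
proof (intro exI conjI)
  let ?F = "finite_patterns - language (models \<psi>)"
  show "models \<psi> = avoiding ?F"
  proof (intro equalityI subsetI)
    fix x assume x: "x \<in> avoiding ?F"
    show "x \<in> models \<psi>"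
      unfolding models_iff_approx[OF assms]
    proof
      fix N
      define P where "P = (\<lambda>v. if cell_code v < N then Some (x v) else None)"
      have "dom P = cell_of ` {..<N}"
        by (auto simp: P_def dom_def image_def split: if_splits) (metis cell_of_cell_code lessThan_iff)
      then have P: "P \<in> finite_patterns" by (simp add: finite_patterns_def)
      have "occurs_in P (Some \<circ> x)"
        unfolding occurs_in_config by (intro exI[of _ 0]) (auto simp: extends_def P_def split: if_splits)
      with x P have "P \<in> language (models \<psi>)" by (auto simp: avoiding_def)
      then obtain y where y: "y \<in> models \<psi>" "extends y P" using language_models[OF assms] by blast
      have "agree N y x" using y(2) by (auto simp: extends_def P_def agree_def dom_def split: if_splits)
      with y(1) show "approx_true N x [] (map fst (quant_prefix \<psi>)) (num_coords \<psi>) (matrix \<psi>)"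
        using assms unfolding models_iff_approx[OF assms]
        by (intro approx_true_agree[OF \<open>agree N y x\<close> list.rel_intros(1)]) (simp_all add: u_mso_over_def closed_formula_def)
    qed
  qed (auto simp: avoiding_def language_def)
qed auto

section \<open>Arithmetization\<close>

text \<open>Every number denotes a configuration, because a remainder modulo the alphabet size is
  always a letter code; digits above the leading one give the letter with code
  \<open>0\<close>.\<close>

definition decode_config :: "nat \<Rightarrow> 'b::finite config" where
  "decode_config w = (\<lambda>v. inv letter_code (digit CARD('b) w (cell_code v)))"

lemma letter_code_less: "letter_code (a :: 'b::finite) < CARD('b)"
  using bij_letter_code[where 'a='b] by (auto simp: bij_betw_def)

lemma inj_letter_code: "inj (letter_code :: 'b::finite \<Rightarrow> nat)"
  using bij_letter_code[where 'a='b] by (auto simp: bij_betw_def)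

lemma inv_letter_code_eq:
  assumes "k < CARD('b::finite)"
  shows "inv letter_code k = (b :: 'b) \<longleftrightarrow> k = letter_code b"
proof -
  have "k \<in> range (letter_code :: 'b \<Rightarrow> nat)"
    using bij_letter_code[where 'a='b] assms by (auto simp: bij_betw_def)
  then show ?thesis using inj_letter_code[where 'b='b] by (auto simp: inv_f_f)
qed

lemma decode_config_eq:
  "decode_config w v = (b :: 'b::finite) \<longleftrightarrow> digit CARD('b) w (cell_code v) = letter_code b"
  unfolding decode_config_def by (rule inv_letter_code_eq) (simp add: digit_def)

lemma ex_decode_config:
  fixes x :: "'b::finite config"
  obtains w where "w < CARD('b) ^ N" "agree N x (decode_config w)"
proof
  let ?w = "\<Sum>i<N. letter_code (x (cell_of i)) * CARD('b) ^ i"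
  show "?w < CARD('b) ^ N" by (rule sum_digits_less) (rule letter_code_less)
  have "digit CARD('b) ?w (cell_code v) = letter_code (x v)" if "cell_code v < N" for v
    using that digit_sum[of "\<lambda>i. letter_code (x (cell_of i))" "CARD('b)" N "cell_code v"]
    by (simp add: letter_code_less)
  then show "agree N x (decode_config ?w)"
    unfolding agree_def by (intro allI impI) (rule decode_config_eq[THEN iffD2, symmetric])
qed

lemma ex_config_iff_decode:
  fixes Q :: "'b::finite config \<Rightarrow> bool"
  assumes "\<And>x y. agree N x y \<Longrightarrow> Q x \<Longrightarrow> Q y"
  shows "(\<exists>x. Q x) \<longleftrightarrow> (\<exists>w < CARD('b) ^ N. Q (decode_config w))"
  using assms ex_decode_config by metis

text \<open>The list is stored in the variables from \<open>b\<close> on, which the last assumption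
  keeps free, and is eliminated entry by entry. Variable \<open>0\<close> holds the bound, hence
  \<open>b > 0\<close>.\<close>

lemma decidable_all_lists:
  assumes "decidable (\<lambda>e. Q e (map e [b..<b + l]))" "b > 0"
    and "\<And>e i k ks. i \<ge> b \<Longrightarrow> Q (e(i := k)) ks \<longleftrightarrow> Q e ks"
  shows "decidable (\<lambda>e. \<forall>ks. length ks = l \<and> (\<forall>k \<in> set ks. k < e 0) \<longrightarrow> Q e ks)"
  using assms
proof (induction l arbitrary: b Q)
  case 0
  then show ?case by simp
next
  case (Suc l)
  have "decidable (\<lambda>e. \<forall>ks. length ks = l \<and> (\<forall>k \<in> set ks. k < e 0) \<longrightarrow> Q e (e b # ks))"
  proof (rule Suc.IH[of "\<lambda>e ks. Q e (e b # ks)" "Suc b"])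
    show "decidable (\<lambda>e. Q e (e b # map e [Suc b..<Suc b + l]))"
      using Suc.prems(1) by (simp add: upt_conv_Cons del: upt_Suc)
  qed (use Suc.prems(3) in auto)
  from decidable_all_upd[OF this, of "\<lambda>e. e 0" b]
  have "decidable (\<lambda>e. \<forall>k<e 0. \<forall>ks. length ks = l \<and> (\<forall>k \<in> set ks. k < e 0) \<longrightarrow> Q e (k # ks))"
    using Suc.prems(2,3) by (simp add: recursive_var)
  moreover have "(\<forall>k<e 0. \<forall>ks. length ks = l \<and> (\<forall>k \<in> set ks. k < e 0) \<longrightarrow> Q e (k # ks))
    \<longleftrightarrow> (\<forall>ks. length ks = Suc l \<and> (\<forall>k \<in> set ks. k < e 0) \<longrightarrow> Q e ks)" for e
    by (auto simp: length_Suc_conv)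
  ultimately show ?case by (simp only:)
qed

lemma recursive_cterm_val:
  assumes "cterm_var t < l"
  shows "recursive (\<lambda>e. cell_code (cterm_val (map cell_of (map e [b..<b + l])) t))"
  using assms
proof (induction t)
  case (Var j)
  then show ?case by (simp add: recursive_var)
qed (use recursive_cell_shift in \<open>force dest: recursive_cell_shift\<close>)+

lemma decidable_decode_config:
  assumes "recursive F" "recursive (\<lambda>e. cell_code (v e))"
  shows "decidable (\<lambda>e. decode_config (F e) (v e) = b)"
  unfolding decode_config_eq by (intro recursive_intros assms)

text \<open>Layout of the environment throughout: variable \<open>0\<close> is the window size,
  \<open>1\<close> the pattern code, \<open>2\<close> codes the configuration \<open>x\<close>, the
  next \<open>m\<close> variables code the quantified configurations, and the values of the
  coordinate variables start at \<open>b\<close>.\<close>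

lemma decidable_qfree_true:
  fixes p :: "('a::finite, 'b::finite) qfree"
  assumes "vars_below m l p"
  shows "decidable (\<lambda>e. qfree_true (decode_config (e 2)) (map (\<lambda>i. decode_config (e (3 + i))) [0..<m])
    (map cell_of (map e [b..<b + l])) p)"
  using assms
proof (induction p)
  case (Eq s t)
  have "cterm_val vs s = cterm_val vs t \<longleftrightarrow> cell_code (cterm_val vs s) = cell_code (cterm_val vs t)" for vs
    by (metis cell_of_cell_code)
  then show ?case
    using Eq recursive_cterm_val[of _ l b] by (auto intro!: recursive_intros simp del: map_map)
next
  case (Letter a t)
  then show ?case
    using recursive_cterm_val[of _ l b] by (auto intro!: decidable_decode_config recursive_intros simp del: map_map)
next
  case (Symb i t c)
  then show ?case
    using recursive_cterm_val[of _ l b] by (auto intro!: decidable_decode_config recursive_intros simp del: map_map)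
qed (auto intro!: recursive_intros simp del: map_map)

lemma decidable_ball:
  "finite A \<Longrightarrow> (\<And>a. a \<in> A \<Longrightarrow> decidable (P a)) \<Longrightarrow> decidable (\<lambda>e. \<forall>a \<in> A. P a e)"
  by (induction A rule: finite_induct) (auto intro!: recursive_intros)

lemma vars_below_atom_terms: "vars_below m l p \<Longrightarrow> t \<in> atom_terms p \<Longrightarrow> cterm_var t < l"
  by (induction p) auto

text \<open>By locality, a quantified configuration may be replaced by a code below
  \<open>CARD('b) ^ e 0\<close>. Each second-order quantifier becomes a bounded one over the next
  free variable \<open>3 + m\<close>.\<close>

lemma decidable_approx_true:
  fixes p :: "('a::finite, 'b::finite) qfree"
  assumes "vars_below (m + length qs) l p"
  shows "decidable (\<lambda>e. approx_true (e 0) (decode_config (e 2))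
    (map (\<lambda>i. decode_config (e (3 + i))) [0..<m]) qs l p)"
  using assms
proof (induction qs arbitrary: m)
  case Nil
  then have vb: "vars_below m l p" by simp
  define Q where "Q e ks \<longleftrightarrow> window_true (e 0) (decode_config (e 2))
    (map (\<lambda>i. decode_config (e (3 + i))) [0..<m]) p (map cell_of ks)" for e :: "nat \<Rightarrow> nat" and ks
  have "decidable (\<lambda>e. Q e (map e [3 + m..<3 + m + l]))"
    unfolding Q_def window_true_def
    by (intro recursive_intros decidable_ball finite_atom_terms decidable_qfree_true[OF vb]
        recursive_cterm_val vars_below_atom_terms[OF vb])
  moreover have "Q (e(i := k)) ks \<longleftrightarrow> Q e ks" if "i \<ge> 3 + m" for e i k ks
  proof -
    have "map (\<lambda>j. decode_config ((e(i := k)) (3 + j)) :: 'b config) [0..<m]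
      = map (\<lambda>j. decode_config (e (3 + j))) [0..<m]"
      using that by (intro map_cong) auto
    moreover have "(e(i := k)) 0 = e 0" "(e(i := k)) 2 = e 2" using that by auto
    ultimately show ?thesis by (simp only: Q_def)
  qed
  ultimately have "decidable (\<lambda>e. \<forall>ks. length ks = l \<and> (\<forall>k \<in> set ks. k < e 0) \<longrightarrow> Q e ks)"
    by (intro decidable_all_lists) auto
  moreover have "approx_true (e 0) (decode_config (e 2)) (map (\<lambda>i. decode_config (e (3 + i))) [0..<m]) [] l p
    \<longleftrightarrow> (\<forall>ks. length ks = l \<and> (\<forall>k \<in> set ks. k < e 0) \<longrightarrow> Q e ks)" for e :: "nat \<Rightarrow> nat"
  proof (simp add: Q_def, intro iffI allI impI, goal_cases)
    case (1 ks)
    then show ?case by (auto simp: comp_def)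
  next
    case (2 vs)
    then have "window_true (e 0) (decode_config (e 2)) (map (\<lambda>i. decode_config (e (3 + i))) [0..<m]) p
      (map cell_of (map cell_code vs))"
      by (intro 2(1)[rule_format]) auto
    then show ?case by (simp add: comp_def)
  qed
  ultimately show ?case by (simp only:)
next
  case (Cons q qs)
  define R where "R e \<longleftrightarrow> approx_true (e 0) (decode_config (e 2))
    (map (\<lambda>i. decode_config (e (3 + i))) [0..<Suc m]) qs l p" for e :: "nat \<Rightarrow> nat"
  have R: "decidable R" unfolding R_def by (rule Cons.IH) (use Cons.prems in simp)
  have upd: "R (e(3 + m := k)) \<longleftrightarrow> approx_true (e 0) (decode_config (e 2))
    (map (\<lambda>i. decode_config (e (3 + i))) [0..<m] @ [decode_config k]) qs l p" for e k
  proof -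
    have "map (\<lambda>i. decode_config ((e(3 + m := k)) (3 + i)) :: 'b config) [0..<m]
      = map (\<lambda>i. decode_config (e (3 + i))) [0..<m]"
      by (intro map_cong) auto
    moreover have "(e(3 + m := k)) 0 = e 0" "(e(3 + m := k)) 2 = e 2" "(e(3 + m := k)) (3 + m) = k"
      by auto
    ultimately show ?thesis by (simp only: R_def upt_Suc_append[OF le0] map_append list.map)
  qed
  have bound: "recursive (\<lambda>e. CARD('b) ^ e 0)" by (intro recursive_intros)
  have agree: "approx_true N x (Xs @ [Y]) qs l p"
    if "agree N X Y" "approx_true N x (Xs @ [X]) qs l p" "length Xs = m" for N x X Y Xs
    using that Cons.prems by (intro approx_true_agree[OF agree_refl _ _ that(2)])
      (auto intro: list_all2_agree_snoc)
  show ?case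
  proof (cases q)
    case Forall
    have "(\<forall>X. approx_true (e 0) (decode_config (e 2)) (map (\<lambda>i. decode_config (e (3 + i))) [0..<m] @ [X]) qs l p)
      \<longleftrightarrow> (\<forall>k<CARD('b) ^ e 0. R (e(3 + m := k)))" for e
      using ex_config_iff_decode[of "e 0" "\<lambda>X. \<not> approx_true (e 0) (decode_config (e 2))
        (map (\<lambda>i. decode_config (e (3 + i))) [0..<m] @ [X]) qs l p"] agree agree_sym
      unfolding upd by (metis (no_types, lifting) diff_zero length_map length_upt)
    then show ?thesis using decidable_all_upd[OF R bound] by (simp add: Forall)
  next
    case Exists
    have "(\<exists>X. approx_true (e 0) (decode_config (e 2)) (map (\<lambda>i. decode_config (e (3 + i))) [0..<m] @ [X]) qs l p)
      \<longleftrightarrow> (\<exists>k<CARD('b) ^ e 0. R (e(3 + m := k)))" for e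
      unfolding upd by (rule ex_config_iff_decode) (rule agree, auto)
    then show ?thesis using decidable_ex_upd[OF R bound] by (simp add: Exists)
  qed
qed

lemma pattern_digit_eq:
  fixes P :: "'a::finite pattern"
  assumes "P \<in> finite_patterns"
  shows "pattern_digit P i = digit (Suc CARD('a)) (pattern_code P) i"
proof -
  have "finite (insert i (cell_code ` dom P))"
    using assms by (simp add: finite_patterns_def)
  then obtain k where "\<forall>j \<in> insert i (cell_code ` dom P). j < k"
    using finite_nat_set_iff_bounded by meson
  then have k: "i < k" "cell_code ` dom P \<subseteq> {..<k}" by auto
  show ?thesis
    unfolding pattern_code_digits[OF k(2)] using k(1) by (simp add: digit_sum pattern_digit_less)
qed

lemma pattern_code_in_language_iff:
  fixes P :: "'a::finite pattern"
  assumes "P \<in> finite_patterns"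
  shows "pattern_code P \<in> pattern_code ` language X \<longleftrightarrow> P \<in> language X"
  by (rule inj_on_image_mem_iff[OF bij_betw_imp_inj_on[OF bij_pattern_code] assms])
    (auto simp: language_def)

lemma ex_pattern_code:
  obtains P :: "'a::finite pattern" where "P \<in> finite_patterns" "k = pattern_code P"
  using bij_pattern_code[where 'a='a] by (metis UNIV_I bij_betw_imp_surj_on imageE)

lemma pattern_digit_cell_code:
  "pattern_digit P (cell_code v) = (case P v of None \<Rightarrow> 0 | Some a \<Rightarrow> Suc (letter_code a))"
  by (simp add: pattern_digit_def)

lemma Pi01_language_models:
  fixes \<psi> :: "('a::finite, 'b::finite) u_mso"
  assumes "u_mso_over {UNIV} \<psi>"
  shows "Pi01 (pattern_code ` language (models \<psi>))"
proof -
  define T where "T N x \<longleftrightarrow> approx_true N x [] (map fst (quant_prefix \<psi>)) (num_coords \<psi>) (matrix \<psi>)"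
    for N x
  have vb: "vars_below (0 + length (map fst (quant_prefix \<psi>))) (num_coords \<psi>) (matrix \<psi>)"
    using assms by (simp add: u_mso_over_def closed_formula_def)
  have T_agree: "T N y" if "agree N x y" "T N x" for N x y
    unfolding T_def by (rule approx_true_agree[OF that(1) _ _ that(2)[unfolded T_def]]) (use vb in auto)
  \<comment> \<open>A pattern digit \<open>0\<close> marks a cell outside the domain, and any other
    digit exceeds the letter code by one. This explains the two bases and the successor.\<close>
  define M where "M N k w \<longleftrightarrow> (\<forall>i<N. digit (Suc CARD('a)) k i = 0
    \<or> digit (Suc CARD('a)) k i = Suc (digit CARD('a) w i))" for N k w
  have lang: "P \<in> language (models \<psi>) \<longleftrightarrow>
      (\<forall>N. \<exists>w<CARD('a) ^ N. M N (pattern_code P) w \<and> T N (decode_config w))"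
    if P: "P \<in> finite_patterns" for P
  proof -
    define E where "E N x \<longleftrightarrow> (\<forall>v \<in> dom P. cell_code v < N \<longrightarrow> P v = Some (x v))" for N x
    have "P \<in> language (models \<psi>) \<longleftrightarrow> (\<exists>x. \<forall>N. E N x \<and> T N x)"
      unfolding language_models[OF assms] models_iff_approx[OF assms] Bex_def extends_def E_def T_def
      using P by blast
    \<comment> \<open>One configuration must both extend \<open>P\<close> and be a model, so
      compactness is applied to the conjunction.\<close>
    also have "\<dots> \<longleftrightarrow> (\<forall>N. \<exists>x. E N x \<and> T N x)"
    proof (rule compactness)
      show "E N x \<and> T N x" if "E (Suc N) x \<and> T (Suc N) x" for N x
        using that approx_true_Suc by (auto simp: E_def T_def)
      show "E N y \<and> T N y" if "agree N x y" "E N x \<and> T N x" for N x y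
        using that T_agree by (auto simp: E_def agree_def)
    qed
    also have "\<dots> \<longleftrightarrow> (\<forall>N. \<exists>w<CARD('a) ^ N. E N (decode_config w) \<and> T N (decode_config w))"
      by (intro all_cong1 ex_config_iff_decode) (auto simp: E_def agree_def intro: T_agree)
    also have "\<dots> \<longleftrightarrow> (\<forall>N. \<exists>w<CARD('a) ^ N. M N (pattern_code P) w \<and> T N (decode_config w))"
    proof -
      have "E N (decode_config w) \<longleftrightarrow> M N (pattern_code P) w" for N w
      proof -
        have "M N (pattern_code P) w \<longleftrightarrow> (\<forall>v. cell_code v < N \<longrightarrow> pattern_digit P (cell_code v) = 0
          \<or> pattern_digit P (cell_code v) = Suc (digit CARD('a) w (cell_code v)))"
          unfolding M_def pattern_digit_eq[OF P] by (metis cell_code_cell_of)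
        also have "\<dots> \<longleftrightarrow> E N (decode_config w)"
        proof -
          have digit: "digit CARD('a) w (cell_code v) = letter_code (decode_config w v :: 'a)" for v
            by (rule decode_config_eq[THEN iffD1, OF refl])
          show ?thesis
            unfolding pattern_digit_cell_code E_def digit
            by (auto split: option.splits simp: dom_def inj_eq[OF inj_letter_code] simp del: split_paired_All)
        qed
        finally show ?thesis by blast
      qed
      then show ?thesis by simp
    qed
    finally show ?thesis .
  qed
  \<comment> \<open>The witness \<open>w\<close> is put into variable \<open>2\<close>, where
    \<open>decidable_approx_true\<close> expects the code of the configuration.\<close>
  have "decidable (\<lambda>e. \<not> (\<exists>w<CARD('a) ^ e 0. M ((e(2 := w)) 0) ((e(2 := w)) 1) ((e(2 := w)) 2) \<and>
      T ((e(2 := w)) 0) (decode_config ((e(2 := w)) 2))))"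
  proof (rule decidable_not, rule decidable_ex_upd)
    show "decidable (\<lambda>e. M (e 0) (e 1) (e 2) \<and> T (e 0) (decode_config (e 2)))"
      unfolding M_def T_def using decidable_approx_true[OF vb]
      by (intro decidable_conj) (intro recursive_intros, simp)
  qed (intro recursive_intros)
  then have "decidable (\<lambda>e. \<not> (\<exists>w<CARD('a) ^ e 0. M (e 0) (e 1) w \<and> T (e 0) (decode_config w)))"
    by simp
  from recursively_enumerable_ex[of "\<lambda>N k. \<not> (\<exists>w<CARD('a) ^ N. M N k w \<and> T N (decode_config w))", OF this]
  have "recursively_enumerable {k. \<not> (\<forall>N. \<exists>w<CARD('a) ^ N. M N k w \<and> T N (decode_config w))}"
    by simp
  moreover have "{k. \<not> (\<forall>N. \<exists>w<CARD('a) ^ N. M N k w \<and> T N (decode_config w))}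
    = - pattern_code ` language (models \<psi>)"
  proof (intro set_eqI)
    fix k
    obtain P :: "'a pattern" where P: "P \<in> finite_patterns" "k = pattern_code P"
      by (rule ex_pattern_code)
    then show "k \<in> {k. \<not> (\<forall>N. \<exists>w<CARD('a) ^ N. M N k w \<and> T N (decode_config w))}
      \<longleftrightarrow> k \<in> - pattern_code ` language (models \<psi>)"
      using lang[OF P(1)] pattern_code_in_language_iff[OF P(1)] P(2) by simp
  qed
  ultimately show ?thesis by (simp add: Pi01_def)
qed

section \<open>Regular programs over registers\<close>

datatype 'a instr =
    Clear nat
  | Move nat nat
  | Incr nat nat
  | IsZero nat
  | NonZero nat
  | Same nat nat
  | Mark 'a

text \<open>\<open>Mark a\<close> is an external test, whose meaning is the parameter \<open>chk a\<close>.\<close>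

fun instr_step :: "('a \<Rightarrow> (nat \<Rightarrow> nat) \<Rightarrow> bool) \<Rightarrow> 'a instr \<Rightarrow> (nat \<Rightarrow> nat) \<Rightarrow> (nat \<Rightarrow> nat) \<Rightarrow> bool" where
  "instr_step chk (Clear r) s s' \<longleftrightarrow> s' = s(r := 0)"
| "instr_step chk (Move r q) s s' \<longleftrightarrow> s' = s(r := s q)"
| "instr_step chk (Incr r q) s s' \<longleftrightarrow> s' = s(r := Suc (s q))"
| "instr_step chk (IsZero r) s s' \<longleftrightarrow> s r = 0 \<and> s' = s"
| "instr_step chk (NonZero r) s s' \<longleftrightarrow> s r \<noteq> 0 \<and> s' = s"
| "instr_step chk (Same r q) s s' \<longleftrightarrow> s r = s q \<and> s' = s"
| "instr_step chk (Mark a) s s' \<longleftrightarrow> chk a s \<and> s' = s"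

text \<open>The only source of nondeterminism is the number of iterations of \<open>Star\<close>; a
  test placed after a loop rejects wrong guesses.\<close>

datatype 'a prog = Do "'a instr" | Seq "'a prog" "'a prog" (infixr ";;" 60) | Star "'a prog"

fun sem :: "('a \<Rightarrow> (nat \<Rightarrow> nat) \<Rightarrow> bool) \<Rightarrow> 'a prog \<Rightarrow> ((nat \<Rightarrow> nat) \<times> (nat \<Rightarrow> nat)) set" where
  "sem chk (Do a) = {(s, s'). instr_step chk a s s'}"
| "sem chk (p ;; q) = sem chk p O sem chk q"
| "sem chk (Star p) = (sem chk p)\<^sup>*"

text \<open>Registers below \<open>m\<close> belong to the caller; the others are scratch space with
  arbitrary initial contents. The frame condition in the first half covers the runs provided by the
  second half. Quantifying over \<open>chk\<close> makes the behaviour independent of external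
  tests.\<close>

definition implements :: "'a prog \<Rightarrow> nat \<Rightarrow> nat list \<Rightarrow> nat \<Rightarrow> (nat list \<Rightarrow> nat \<Rightarrow> bool) \<Rightarrow> bool" where
  "implements p m ins out R \<longleftrightarrow>
    (\<forall>chk s s'. (s, s') \<in> sem chk p \<longrightarrow> R (map s ins) (s' out) \<and> (\<forall>r<m. r \<noteq> out \<longrightarrow> s' r = s r)) \<and>
    (\<forall>chk s y. R (map s ins) y \<longrightarrow> (\<exists>s'. (s, s') \<in> sem chk p \<and> s' out = y))"

lemma implementsD:
  assumes "implements p m ins out R" "(s, s') \<in> sem chk p"
  shows "R (map s ins) (s' out)" "\<And>r. r < m \<Longrightarrow> r \<noteq> out \<Longrightarrow> s' r = s r"
  using assms unfolding implements_def by blast+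

lemma implementsE:
  assumes "implements p m ins out R" "R (map s ins) y"
  obtains s' where "(s, s') \<in> sem chk p" "s' out = y" "\<And>r. r < m \<Longrightarrow> r \<noteq> out \<Longrightarrow> s' r = s r"
  using assms unfolding implements_def by blast

text \<open>Covers argument lists of a wrong length: testing for a nonzero value just after clearing
  the register never succeeds.\<close>

lemma implements_empty:
  assumes "\<And>xs y. length xs = length ins \<Longrightarrow> \<not> R xs y"
  shows "\<exists>p. implements p m ins out R"
proof -
  have "implements (Do (Clear m) ;; Do (NonZero m)) m ins out R"
    using assms by (auto simp: implements_def)
  then show ?thesis by blast
qed

text \<open>Each evaluation gets the frame bound just above its own output register, which protects
  the inputs and the results already stored.\<close>

lemma implements_list:
  assumes "\<And>g m ins out. g \<in> set gs \<Longrightarrow> \<forall>i\<in>set ins. i < m \<Longrightarrow> out < m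
      \<Longrightarrow> \<exists>p :: 'a prog. implements p m ins out (computes g)"
    and "\<forall>i\<in>set ins. i < m" "m \<le> b"
  shows "\<exists>p :: 'a prog.
    (\<forall>chk s s'. (s, s') \<in> sem chk p \<longrightarrow>
      list_all2 (\<lambda>g y. computes g (map s ins) y) gs (map s' [b..<b + length gs]) \<and> (\<forall>r<b. s' r = s r)) \<and>
    (\<forall>chk s ys. list_all2 (\<lambda>g y. computes g (map s ins) y) gs ys \<longrightarrow>
      (\<exists>s'. (s, s') \<in> sem chk p \<and> map s' [b..<b + length gs] = ys))"
  using assms
proof (induction gs arbitrary: b)
  case Nil
  show ?case by (intro exI[of _ "Do (Move 0 0)"]) auto
next
  case (Cons g gs)
  have "\<forall>i\<in>set ins. i < Suc b" using Cons.prems(2,3) by auto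
  then obtain p :: "'a prog" where p: "implements p (Suc b) ins b (computes g)"
    using Cons.prems(1)[of g ins "Suc b" b] by auto
  obtain q :: "'a prog" where q:
    "\<And>chk s s'. (s, s') \<in> sem chk q \<Longrightarrow>
      list_all2 (\<lambda>g y. computes g (map s ins) y) gs (map s' [Suc b..<Suc b + length gs]) \<and> (\<forall>r<Suc b. s' r = s r)"
    "\<And>chk s ys. list_all2 (\<lambda>g y. computes g (map s ins) y) gs ys \<Longrightarrow>
      \<exists>s'. (s, s') \<in> sem chk q \<and> map s' [Suc b..<Suc b + length gs] = ys"
    using Cons.IH[of "Suc b"] Cons.prems by (auto simp del: upt_Suc)
  have eq: "map s' ins = map s ins" if "\<And>r. r < b \<Longrightarrow> s' r = s r" for s s'
    using Cons.prems(2,3) that by (intro map_cong) auto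
  have upt: "[b..<b + length (g # gs)] = b # [Suc b..<Suc b + length gs]"
    using upt_conv_Cons[of b "b + length (g # gs)"] by (simp del: upt_Suc)
  show ?case unfolding upt
  proof (intro exI[of _ "p ;; q"] conjI allI impI)
    fix chk s s'
    assume "(s, s') \<in> sem chk (p ;; q)"
    then obtain t where t: "(s, t) \<in> sem chk p" "(t, s') \<in> sem chk q" by auto
    note 1 = implementsD[OF p t(1)] and 2 = q(1)[OF t(2)]
    have "map t ins = map s ins" by (rule eq) (use 1(2) in auto)
    with 1 2 show "list_all2 (\<lambda>g y. computes g (map s ins) y) (g # gs) (map s' (b # [Suc b..<Suc b + length gs]))"
      by simp
    show "s' r = s r" if "r < b" for r using 1(2)[of r] 2 that by simp
  next
    fix chk s ys
    assume "list_all2 (\<lambda>g y. computes g (map s ins) y) (g # gs) ys"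
    then obtain y ys' where ys: "ys = y # ys'" "computes g (map s ins) y"
      "list_all2 (\<lambda>g y. computes g (map s ins) y) gs ys'" by (auto simp: list_all2_Cons1)
    obtain t where t: "(s, t) \<in> sem chk p" "t b = y" "\<And>r. r < Suc b \<Longrightarrow> r \<noteq> b \<Longrightarrow> t r = s r"
      using implementsE[OF p ys(2)] by metis
    have "map t ins = map s ins" by (rule eq) (use t(3) in auto)
    then obtain s' where s': "(t, s') \<in> sem chk q" "map s' [Suc b..<Suc b + length gs] = ys'"
      using q(2)[of t ys' chk] ys(3) by (auto simp del: map_eq_conv upt_Suc)
    moreover have "s' b = y" using q(1)[OF s'(1)] t(2) by simp
    ultimately show "\<exists>s'. (s, s') \<in> sem chk (p ;; q) \<and> map s' (b # [Suc b..<Suc b + length gs]) = ys"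
      using t(1) ys(1) by (intro exI[of _ s']) auto
  qed
qed

text \<open>Register \<open>m\<close> accumulates the value, \<open>Suc m\<close> counts the rounds
  and \<open>m + 2\<close> receives the next value. The number of rounds is guessed, and the final
  \<open>Same\<close> compares it with the recursion argument in \<open>k\<close>.\<close>

lemma implements_Prim:
  fixes pf pg :: "'a prog"
  assumes pf: "implements pf (m + 3) ins m (computes f)"
    and pg: "implements pg (m + 3) (m # Suc m # ins) (m + 2) (computes g)"
    and less: "\<forall>i\<in>set ins. i < m" "k < m" "out < m"
  shows "\<exists>p :: 'a prog. implements p m (k # ins) out (computes (Prim f g))"
proof -
  define body where "body = pg ;; Do (Move m (m + 2)) ;; Do (Incr (Suc m) (Suc m))"
  define p where "p = pf ;; Do (Clear (Suc m)) ;; Star body ;; Do (Same (Suc m) k) ;; Do (Move out m)"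
  have eq: "map s' ins = map s ins" if "\<And>r. r < m \<Longrightarrow> s' r = s r" for s s'
    using less that by (intro map_cong) auto
  have body: "computes g (s m # s (Suc m) # map s ins) (s' m) \<and> s' (Suc m) = Suc (s (Suc m)) \<and> (\<forall>r<m. s' r = s r)"
    if run: "(s, s') \<in> sem chk body" for chk s s'
  proof -
    obtain t where t: "(s, t) \<in> sem chk pg" "s' = t(m := t (m + 2), Suc m := Suc (t (Suc m)))"
    proof -
      obtain t where "(s, t) \<in> sem chk pg" "(t, s') \<in> sem chk (Do (Move m (m + 2)) ;; Do (Incr (Suc m) (Suc m)))"
        using run unfolding body_def sem.simps(2)[of chk pg] by blast
      then show ?thesis by (intro that) auto
    qed
    show ?thesis using implementsD[OF pg t(1)] by (simp add: t(2))
  qed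
  have body': "\<exists>s'. (s, s') \<in> sem chk body \<and> s' m = y" if "computes g (s m # s (Suc m) # map s ins) y" for chk s y
  proof -
    have "computes g (map s (m # Suc m # ins)) y" using that by simp
    then obtain t where t: "(s, t) \<in> sem chk pg" "t (m + 2) = y" using implementsE[OF pg] by metis
    then show ?thesis
      by (intro exI[of _ "t(m := t (m + 2), Suc m := Suc (t (Suc m)))"]) (auto simp: body_def intro!: relcompI)
  qed
  have star: "computes (Prim f g) (s' (Suc m) # map s' ins) (s' m) \<and> (\<forall>r<m. s' r = s r)"
    if "(s, s') \<in> (sem chk body)\<^sup>*" "computes (Prim f g) (s (Suc m) # map s ins) (s m)" for chk s s'
    using that
  proof (induction rule: rtrancl_induct)
    case (step t u)
    then have *: "computes (Prim f g) (t (Suc m) # map t ins) (t m)" "\<forall>r<m. t r = s r" by auto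
    note b = body[OF step(2)]
    have "map u ins = map t ins" by (rule eq) (use b in auto)
    then show ?case using b * by (auto simp: computes_Prim_Suc simp del: map_eq_conv)
  qed simp
  \<comment> \<open>\<open>computes f\<close> enters only as a relation, so the start value
    \<open>z\<close> of the accumulator is read off the given derivation; hence \<open>z\<close> is
    chosen before the start registers \<open>s\<close>.\<close>
  have star': "\<exists>z. computes f xs z \<and> (\<forall>s. map s ins = xs \<and> s (Suc m) = 0 \<and> s m = z \<longrightarrow>
      (\<exists>s'. (s, s') \<in> (sem chk body)\<^sup>* \<and> s' (Suc m) = j \<and> s' m = y \<and> (\<forall>r<m. s' r = s r)))"
    if "computes (Prim f g) (j # xs) y" for chk xs j y
    using that
  proof (induction j arbitrary: y)
    case 0
    then show ?case by (intro exI[of _ y]) (auto simp: computes_Prim_0)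
  next
    case (Suc j)
    then obtain r where r: "computes (Prim f g) (j # xs) r" "computes g (r # j # xs) y"
      by (auto simp: computes_Prim_Suc)
    obtain z where z: "computes f xs z" and IH: "\<And>s. map s ins = xs \<Longrightarrow> s (Suc m) = 0 \<Longrightarrow> s m = z \<Longrightarrow>
        \<exists>s'. (s, s') \<in> (sem chk body)\<^sup>* \<and> s' (Suc m) = j \<and> s' m = r \<and> (\<forall>r<m. s' r = s r)"
      using Suc.IH[OF r(1)] by blast
    have "\<exists>s'. (s, s') \<in> (sem chk body)\<^sup>* \<and> s' (Suc m) = Suc j \<and> s' m = y \<and> (\<forall>r<m. s' r = s r)"
      if s: "map s ins = xs" "s (Suc m) = 0" "s m = z" for s
    proof -
      obtain t where t: "(s, t) \<in> (sem chk body)\<^sup>*" "t (Suc m) = j" "t m = r" "\<forall>r<m. t r = s r"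
        using IH[OF s] by blast
      have "map t ins = map s ins" by (rule eq) (use t in auto)
      then obtain u where u: "(t, u) \<in> sem chk body" "u m = y" using body'[of t y chk] r(2) t(2,3) s(1) by (auto simp del: map_eq_conv)
      show ?thesis using body[OF u(1)] u t by (intro exI[of _ u]) (auto intro: rtrancl_into_rtrancl)
    qed
    with z show ?case by blast
  qed
  have "implements p m (k # ins) out (computes (Prim f g))"
    unfolding implements_def
  proof (intro conjI allI impI)
    fix chk s s'
    assume "(s, s') \<in> sem chk p"
    then obtain t u where t: "(s, t) \<in> sem chk pf" "(t(Suc m := 0), u) \<in> (sem chk body)\<^sup>*"
      "u (Suc m) = u k" "s' = u(out := u m)"
      by (auto simp: p_def)
    note 1 = implementsD[OF pf t(1)]
    let ?t = "t(Suc m := 0)"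
    have t_eq: "map ?t ins = map s ins" by (rule eq) (use 1(2) in auto)
    have u: "computes (Prim f g) (u (Suc m) # map u ins) (u m) \<and> (\<forall>r<m. u r = ?t r)"
      by (rule star[OF t(2)]) (unfold t_eq, use 1(1) in \<open>simp add: computes_Prim_0\<close>)
    then have u_eq: "u r = s r" if "r < m" for r using that 1(2)[of r] by auto
    then have "map u ins = map s ins" by (rule eq)
    then show "computes (Prim f g) (map s (k # ins)) (s' out)"
      using u t(3,4) u_eq[OF less(2)] by (auto simp del: map_eq_conv)
    show "s' r = s r" if "r < m" "r \<noteq> out" for r using that u_eq[of r] t(4) by auto
  next
    fix chk s y
    assume "computes (Prim f g) (map s (k # ins)) y"
    from star'[of "s k" "map s ins" y chk] this
    obtain z where z: "computes f (map s ins) z" and star: "\<And>t. map t ins = map s ins \<Longrightarrow> t (Suc m) = 0 \<Longrightarrow> t m = z \<Longrightarrow>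
        \<exists>s'. (t, s') \<in> (sem chk body)\<^sup>* \<and> s' (Suc m) = s k \<and> s' m = y \<and> (\<forall>r<m. s' r = t r)"
      by auto
    obtain t where t: "(s, t) \<in> sem chk pf" "t m = z" "\<And>r. r < m + 3 \<Longrightarrow> r \<noteq> m \<Longrightarrow> t r = s r"
      using implementsE[OF pf z] by metis
    let ?t = "t(Suc m := 0)"
    have t_eq: "map ?t ins = map s ins" by (rule eq) (use t(3) in auto)
    obtain u where u: "(?t, u) \<in> (sem chk body)\<^sup>*" "u (Suc m) = s k" "u m = y" "\<forall>r<m. u r = ?t r"
      using star[OF t_eq] t(2) by auto
    have "u k = s k" using u(4) t(3)[of k] less(2) by auto
    then show "\<exists>s'. (s, s') \<in> sem chk p \<and> s' out = y"
      using t(1) u(1-3) by (intro exI[of _ "u(out := u m)"]) (auto simp: p_def intro!: relcompI)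
  qed
  then show ?thesis by blast
qed

text \<open>Register \<open>m\<close> holds the candidate and \<open>Suc m\<close> the value of
  \<open>f\<close> there. A round is passed only if that value is nonzero; after the guessed exit
  \<open>f\<close> is evaluated once more and must vanish.\<close>

lemma implements_Mu:
  fixes pf :: "'a prog"
  assumes pf: "implements pf (m + 2) (m # ins) (Suc m) (computes f)"
    and less: "\<forall>i\<in>set ins. i < m" "out < m"
  shows "\<exists>p :: 'a prog. implements p m ins out (computes (Mu f))"
proof -
  define body where "body = pf ;; Do (NonZero (Suc m)) ;; Do (Incr m m)"
  define p where "p = Do (Clear m) ;; Star body ;; pf ;; Do (IsZero (Suc m)) ;; Do (Move out m)"
  have eq: "map s' ins = map s ins" if "\<And>r. r < m \<Longrightarrow> s' r = s r" for s s'
    using less that by (intro map_cong) auto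
  have pf1: "computes f (s m # map s ins) (s' (Suc m)) \<and> s' m = s m \<and> (\<forall>r<m. s' r = s r)"
    if "(s, s') \<in> sem chk pf" for chk s s'
    using implementsD[OF pf that] by simp
  have pf2: "\<exists>s'. (s, s') \<in> sem chk pf \<and> s' (Suc m) = y"
    if "computes f (s m # map s ins) y" for chk s y
    using pf that by (auto simp: implements_def)
  define found where "found j xs \<longleftrightarrow> (\<forall>i<j. \<exists>y>0. computes f (i # xs) y)" for j xs
  have star: "found (s' m) (map s ins) \<and> (\<forall>r<m. s' r = s r)"
    if "(s, s') \<in> (sem chk body)\<^sup>*" "s m = 0" for chk s s'
    using that
  proof (induction rule: rtrancl_induct)
    case (step t u)
    then obtain v where v: "(t, v) \<in> sem chk pf" "v (Suc m) > 0" "u = v(m := Suc (v m))"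
      by (auto simp: body_def)
    have t: "found (t m) (map s ins)" "\<forall>r<m. t r = s r" using step by auto
    then have "map t ins = map s ins" by (intro eq) auto
    with pf1[OF v(1)] have "computes f (t m # map s ins) (v (Suc m))" "v m = t m" "\<forall>r<m. v r = t r"
      by (auto simp only:)
    then show ?case using v(2,3) t by (auto simp: found_def less_Suc_eq)
  qed (simp add: found_def)
  have star': "\<exists>s'. (s, s') \<in> (sem chk body)\<^sup>* \<and> s' m = j \<and> (\<forall>r<m. s' r = s r)"
    if "found j (map s ins)" "s m = 0" for chk s j
    using that(1)
  proof (induction j)
    case 0
    then show ?case using that(2) by blast
  next
    case (Suc j)
    then obtain t where t: "(s, t) \<in> (sem chk body)\<^sup>*" "t m = j" "\<forall>r<m. t r = s r"
      by (auto simp: found_def less_Suc_eq)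
    obtain y where y: "y > 0" "computes f (j # map s ins) y" using Suc.prems by (auto simp: found_def)
    have "map t ins = map s ins" by (rule eq) (use t in auto)
    then obtain v where v: "(t, v) \<in> sem chk pf" "v (Suc m) = y" using pf2[of t y chk] y t(2) by (auto simp del: map_eq_conv)
    then have "(t, v(m := Suc (v m))) \<in> sem chk body" using y by (auto simp: body_def intro!: relcompI)
    then show ?case
      using t pf1[OF v(1)] by (intro exI[of _ "v(m := Suc (v m))"]) (auto intro: rtrancl_into_rtrancl simp del: fun_upd_apply, simp_all)
  qed
  have "implements p m ins out (computes (Mu f))"
    unfolding implements_def
  proof (intro conjI allI impI)
    fix chk s s'
    assume "(s, s') \<in> sem chk p"
    then obtain t u where t: "(s(m := 0), t) \<in> (sem chk body)\<^sup>*" "(t, u) \<in> sem chk pf"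
      "u (Suc m) = 0" "s' = u(out := u m)"
      by (auto simp: p_def)
    have s: "map (s(m := 0)) ins = map s ins" by (rule eq) auto
    have 1: "found (t m) (map s ins)" "\<forall>r<m. t r = s r" using star[OF t(1)] by (simp_all add: s)
    then have "map t ins = map s ins" by (intro eq) auto
    then show "computes (Mu f) (map s ins) (s' out)"
      using 1 pf1[OF t(2)] t(3,4) by (simp add: computes_Mu found_def del: map_eq_conv)
    show "s' r = s r" if "r < m" "r \<noteq> out" for r using that 1 pf1[OF t(2)] t(4) by auto
  next
    fix chk s y
    assume y: "computes (Mu f) (map s ins) y"
    have s: "map (s(m := 0)) ins = map s ins" by (rule eq) auto
    have "found y (map s ins)" using y by (auto simp: computes_Mu found_def)
    then obtain t where t: "(s(m := 0), t) \<in> (sem chk body)\<^sup>*" "t m = y" "\<forall>r<m. t r = s r"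
      using star'[of y "s(m := 0)" chk] unfolding s by auto
    have "map t ins = map s ins" by (rule eq) (use t in auto)
    then obtain u where u: "(t, u) \<in> sem chk pf" "u (Suc m) = 0"
      using pf2[of t 0 chk] y t(2) by (auto simp: computes_Mu simp del: map_eq_conv)
    then show "\<exists>s'. (s, s') \<in> sem chk p \<and> s' out = y"
      using t pf1[OF u(1)] by (intro exI[of _ "u(out := u m)"]) (auto simp: p_def intro!: relcompI)
  qed
  then show ?thesis by blast
qed

lemma ex_implements:
  "\<forall>i\<in>set ins. i < m \<Longrightarrow> out < m \<Longrightarrow> \<exists>p :: 'a prog. implements p m ins out (computes f)"
proof (induction f arbitrary: m ins out)
  case Zero
  show ?case by (intro exI[of _ "Do (Clear out)"]) (auto simp: implements_def)
next
  case Succ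
  show ?case
  proof (cases "length ins = 1")
    case True
    then obtain i where "ins = [i]" by (auto simp: length_Suc_conv)
    then show ?thesis by (intro exI[of _ "Do (Incr out i)"]) (auto simp: implements_def computes_Succ)
  next
    case False
    then show ?thesis by (intro implements_empty) (auto simp: computes_Succ)
  qed
next
  case (Proj i)
  show ?case
  proof (cases "i < length ins")
    case True
    then show ?thesis
      by (intro exI[of _ "Do (Move out (ins ! i))"]) (auto simp: implements_def computes_Proj)
  next
    case False
    then show ?thesis by (intro implements_empty) (auto simp: computes_Proj)
  qed
next
  case (Comp f gs)
  let ?R = "[m..<m + length gs]"
  obtain p :: "'a prog" where p:
    "\<And>chk s s'. (s, s') \<in> sem chk p \<Longrightarrow>
      list_all2 (\<lambda>g y. computes g (map s ins) y) gs (map s' ?R) \<and> (\<forall>r<m. s' r = s r)"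
    "\<And>chk s ys. list_all2 (\<lambda>g y. computes g (map s ins) y) gs ys \<Longrightarrow>
      \<exists>s'. (s, s') \<in> sem chk p \<and> map s' ?R = ys"
    using implements_list[of gs ins m m] Comp.IH(2) Comp.prems by blast
  obtain q :: "'a prog" where q: "implements q (m + length gs) ?R out (computes f)"
    using Comp.IH(1)[of ?R "m + length gs" out] Comp.prems by auto
  have "implements (p ;; q) m ins out (computes (Comp f gs))"
    unfolding implements_def
  proof (intro conjI allI impI)
    fix chk s s'
    assume "(s, s') \<in> sem chk (p ;; q)"
    then obtain t where t: "(s, t) \<in> sem chk p" "(t, s') \<in> sem chk q" by auto
    note 1 = p(1)[OF t(1)] and 2 = implementsD[OF q t(2)]
    show "computes (Comp f gs) (map s ins) (s' out)" using 1 2(1) by (auto simp: computes_Comp)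
    show "s' r = s r" if "r < m" "r \<noteq> out" for r using that 1 2(2)[of r] by simp
  next
    fix chk s y
    assume "computes (Comp f gs) (map s ins) y"
    then obtain ys where ys: "list_all2 (\<lambda>g y. computes g (map s ins) y) gs ys" "computes f ys y"
      by (auto simp: computes_Comp)
    obtain t where t: "(s, t) \<in> sem chk p" "map t ?R = ys" using p(2)[OF ys(1)] by blast
    then obtain s' where "(t, s') \<in> sem chk q" "s' out = y"
      using implementsE[OF q, of t y chk] ys(2) by metis
    with t(1) show "\<exists>s'. (s, s') \<in> sem chk (p ;; q) \<and> s' out = y" by auto
  qed
  then show ?case by blast
next
  case (Prim f g)
  show ?case
  proof (cases ins)
    case Nil
    then show ?thesis by (intro implements_empty) auto
  next
    case (Cons k ins')
    then have less: "\<forall>i\<in>set ins'. i < m" "k < m" using Prim.prems(1) by auto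
    then have "\<forall>i\<in>set ins'. i < m + 3" "\<forall>i\<in>set (m # Suc m # ins'). i < m + 3" by auto
    then obtain pf pg :: "'a prog" where "implements pf (m + 3) ins' m (computes f)"
      "implements pg (m + 3) (m # Suc m # ins') (m + 2) (computes g)"
      using Prim.IH(1)[of ins' "m + 3" m] Prim.IH(2)[of "m # Suc m # ins'" "m + 3" "m + 2"] by auto
    then show ?thesis unfolding Cons using less Prim.prems(2) by (rule implements_Prim)
  qed
next
  case (Mu f)
  then have "\<forall>i\<in>set (m # ins). i < m + 2" by auto
  then obtain pf :: "'a prog" where "implements pf (m + 2) (m # ins) (Suc m) (computes f)"
    using Mu.IH[of "m # ins" "m + 2" "Suc m"] by auto
  then show ?case using Mu.prems by (rule implements_Mu)
qed

section \<open>Programs as automata\<close>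

text \<open>A program started at state \<open>i\<close> occupies the states from \<open>i\<close> to
  \<open>i + prog_size p\<close>; a loop adds an entry and an exit state of its own.\<close>

fun prog_size :: "'a prog \<Rightarrow> nat" where
  "prog_size (Do a) = 1"
| "prog_size (p ;; q) = prog_size p + prog_size q"
| "prog_size (Star p) = prog_size p + 2"

type_synonym 'a transition = "nat \<times> 'a instr \<times> nat"

text \<open>\<open>Move 0 0\<close> changes nothing and serves as the silent transition. In a loop,
  \<open>i\<close> is the head, to which the end of the body returns.\<close>

fun transitions :: "'a prog \<Rightarrow> nat \<Rightarrow> 'a transition list" where
  "transitions (Do a) i = [(i, a, Suc i)]"
| "transitions (p ;; q) i = transitions p i @ transitions q (i + prog_size p)"
| "transitions (Star p) i =
     (i, Move 0 0, Suc i) # (Suc i + prog_size p, Move 0 0, i) #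
     (i, Move 0 0, i + prog_size p + 2) # transitions p (Suc i)"

inductive automaton_run :: "('a \<Rightarrow> (nat \<Rightarrow> nat) \<Rightarrow> bool) \<Rightarrow> 'a transition set
    \<Rightarrow> nat \<Rightarrow> (nat \<Rightarrow> nat) \<Rightarrow> nat \<Rightarrow> (nat \<Rightarrow> nat) \<Rightarrow> bool" for chk T where
  halt: "automaton_run chk T i s i s"
| step: "(i, a, j) \<in> T \<Longrightarrow> instr_step chk a s t \<Longrightarrow> automaton_run chk T j t k u
    \<Longrightarrow> automaton_run chk T i s k u"

lemma automaton_run_trans:
  "automaton_run chk T i s j t \<Longrightarrow> automaton_run chk T j t k u \<Longrightarrow> automaton_run chk T i s k u"
  by (induction rule: automaton_run.induct) (auto intro: automaton_run.intros)

lemma automaton_run_mono: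
  "automaton_run chk T i s j t \<Longrightarrow> T \<subseteq> T' \<Longrightarrow> automaton_run chk T' i s j t"
  by (induction rule: automaton_run.induct) (auto intro: automaton_run.intros)

lemma automaton_run_one:
  "(i, a, j) \<in> T \<Longrightarrow> instr_step chk a s t \<Longrightarrow> automaton_run chk T i s j t"
  by (auto intro: automaton_run.intros)

lemma automaton_run_skip: "(i, Move 0 0, j) \<in> T \<Longrightarrow> automaton_run chk T i s j s"
  by (rule automaton_run_one) auto

lemma automaton_run_complete:
  "(s, s') \<in> sem chk p \<Longrightarrow> automaton_run chk (set (transitions p i)) i s (i + prog_size p) s'"
proof (induction p arbitrary: i s s')
  case (Do a)
  then show ?case by (auto intro: automaton_run_one)
next
  case (Seq p q)
  then obtain t where "(s, t) \<in> sem chk p" "(t, s') \<in> sem chk q" by auto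
  from automaton_run_mono[OF Seq.IH(1)[OF this(1), of i], of "set (transitions (p ;; q) i)"]
    automaton_run_mono[OF Seq.IH(2)[OF this(2), of "i + prog_size p"], of "set (transitions (p ;; q) i)"]
  show ?case using automaton_run_trans by (fastforce simp: add.assoc)
next
  case (Star p)
  let ?T = "set (transitions (Star p) i)"
  have "(s, s') \<in> (sem chk p)\<^sup>*" using Star.prems by simp
  then have "automaton_run chk ?T i s i s'"
  proof (induction rule: rtrancl_induct)
    case (step t u)
    have "automaton_run chk ?T i t (Suc i) t" "automaton_run chk ?T (Suc i + prog_size p) u i u"
      by (rule automaton_run_skip, simp)+
    moreover have "automaton_run chk ?T (Suc i) t (Suc i + prog_size p) u"
      by (rule automaton_run_mono[OF Star.IH[OF step(2)]]) auto
    ultimately show ?case using step(3) automaton_run_trans by metis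
  qed (rule automaton_run.halt)
  moreover have "automaton_run chk ?T i s' (i + prog_size (Star p)) s'"
    by (rule automaton_run_skip) simp
  ultimately show ?case by (rule automaton_run_trans)
qed

text \<open>The relation between the registers at an intermediate state and at the final state. States
  are counted from the initial state.\<close>

fun rest :: "('a \<Rightarrow> (nat \<Rightarrow> nat) \<Rightarrow> bool) \<Rightarrow> 'a prog \<Rightarrow> nat \<Rightarrow> ((nat \<Rightarrow> nat) \<times> (nat \<Rightarrow> nat)) set" where
  "rest chk (Do a) j = (if j = 0 then sem chk (Do a) else Id)"
| "rest chk (p ;; q) j = (if j < prog_size p then rest chk p j O sem chk q else rest chk q (j - prog_size p))"
| "rest chk (Star p) j =
    (if j = 0 then (sem chk p)\<^sup>* else if j \<le> Suc (prog_size p) then rest chk p (j - 1) O (sem chk p)\<^sup>* else Id)"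

lemma prog_size_pos: "prog_size p > 0"
  by (induction p) auto

lemma rest_ends: "rest chk p 0 = sem chk p" "rest chk p (prog_size p) = Id"
  by (induction p) (auto simp: prog_size_pos)

lemma transitions_range:
  "(j, a, k) \<in> set (transitions p i) \<Longrightarrow> i \<le> j \<and> j < i + prog_size p \<and> i \<le> k \<and> k \<le> i + prog_size p"
  by (induction p arbitrary: i) (fastforce simp: prog_size_pos)+

text \<open>The invariant behind soundness, propagated backwards along a run. The delicate cases are
  the borders, where the exit of one part is the entry of the next.\<close>

lemma rest_step:
  "(j, a, k) \<in> set (transitions p i) \<Longrightarrow> instr_step chk a s t \<Longrightarrow> (t, u) \<in> rest chk p (k - i)
    \<Longrightarrow> (s, u) \<in> rest chk p (j - i)"
proof (induction p arbitrary: i u)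
  case (Do a)
  then show ?case by auto
next
  case (Seq p q)
  from Seq.prems(1) consider "(j, a, k) \<in> set (transitions p i)"
    | "(j, a, k) \<in> set (transitions q (i + prog_size p))" by auto
  then show ?case
  proof cases
    case 1
    note r = transitions_range[OF 1]
    have "(t, u) \<in> rest chk p (k - i) O sem chk q"
    proof (cases "k - i < prog_size p")
      case False
      then have "k - i = prog_size p" using r by auto
      then show ?thesis using Seq.prems(3) by (simp add: rest_ends)
    qed (use Seq.prems(3) in simp)
    then obtain v where "(t, v) \<in> rest chk p (k - i)" "(v, u) \<in> sem chk q" by auto
    moreover have "(s, v) \<in> rest chk p (j - i)"
      using Seq.IH(1)[OF 1 Seq.prems(2)] calculation(1) by blast
    ultimately show ?thesis using r by auto
  next
    case 2
    note r = transitions_range[OF 2]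
    have "\<not> k - i < prog_size p" using r by linarith
    then have "(t, u) \<in> rest chk q (k - (i + prog_size p))" using Seq.prems(3) by simp
    then have "(s, u) \<in> rest chk q (j - (i + prog_size p))"
      using Seq.IH(2)[OF 2 Seq.prems(2)] by blast
    then show ?thesis using r by auto
  qed
next
  case (Star p)
  show ?case
  proof (cases "(j, a, k) \<in> set (transitions p (Suc i))")
    case True
    note r = transitions_range[OF True]
    have "(t, u) \<in> rest chk p (k - Suc i) O (sem chk p)\<^sup>*"
      using Star.prems(3) r by (auto simp: Suc_le_eq split: if_splits)
    then obtain v where "(t, v) \<in> rest chk p (k - Suc i)" "(v, u) \<in> (sem chk p)\<^sup>*" by auto
    moreover have "(s, v) \<in> rest chk p (j - Suc i)"
      using Star.IH[OF True Star.prems(2)] calculation(1) by blast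
    ultimately show ?thesis using r by auto
  next
    case False
    have loop: "sem chk p O (sem chk p)\<^sup>* \<subseteq> (sem chk p)\<^sup>*" by auto
    show ?thesis
      using False Star.prems rest_ends[of chk p] loop by auto
  qed
qed

lemma automaton_run_sound:
  assumes "automaton_run chk (set (transitions p i)) j s (i + prog_size p) s'" "i \<le> j"
  shows "(s, s') \<in> rest chk p (j - i)"
  using assms
proof (induction j s "i + prog_size p" s' rule: automaton_run.induct)
  case (step j a k s t u)
  then show ?case using rest_step transitions_range by metis
qed (simp add: rest_ends)

theorem automaton_run_iff_sem:
  "automaton_run chk (set (transitions p i)) i s (i + prog_size p) s' \<longleftrightarrow> (s, s') \<in> sem chk p"
  using automaton_run_complete automaton_run_sound[of chk p i i s s'] by (auto simp: rest_ends)

text \<open>Recasts a run as sequences indexed by time, which become the rows of the tableau; the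
  registers at both ends are left free.\<close>

lemma automaton_run_imp_sequence:
  assumes "automaton_run chk T i s k u"
  shows "\<exists>n q S \<tau>. q 0 = i \<and> q n = k \<and>
    (\<forall>r<n. (q r, \<tau> r, q (Suc r)) \<in> T \<and> instr_step chk (\<tau> r) (S r) (S (Suc r)))"
proof -
  have "\<exists>n q S \<tau>. q 0 = i \<and> S 0 = s \<and> q n = k \<and>
    (\<forall>r<n. (q r, \<tau> r, q (Suc r)) \<in> T \<and> instr_step chk (\<tau> r) (S r) (S (Suc r)))"
    using assms
  proof (induction rule: automaton_run.induct)
    case (halt i s)
    show ?case by (intro exI[of _ 0] exI[of _ "\<lambda>_. i"] exI[of _ "\<lambda>_. s"]) auto
  next
    case (step i a j s t k u)
    then obtain n q S \<tau> where *: "q 0 = j" "S 0 = t" "q n = k"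
      "\<forall>r<n. (q r, \<tau> r, q (Suc r)) \<in> T \<and> instr_step chk (\<tau> r) (S r) (S (Suc r))" by blast
    show ?case
      using * step(1,2)
      by (intro exI[of _ "Suc n"] exI[of _ "case_nat i q"] exI[of _ "case_nat s S"] exI[of _ "case_nat a \<tau>"])
        (auto split: nat.split)
  qed
  then show ?thesis by blast
qed

lemma automaton_run_sequence:
  assumes "\<And>r. r < n \<Longrightarrow> (q r, \<tau> r, q (Suc r)) \<in> T \<and> instr_step chk (\<tau> r) (S r) (S (Suc r))"
  shows "automaton_run chk T (q 0) (S 0) (q n) (S n)"
  using assms
  by (induction n) (auto intro: automaton_run.halt automaton_run_trans automaton_run_one)

section \<open>Definable properties\<close>

definition west :: "cell \<Rightarrow> cell" where "west c = c - (1, 0)"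
definition south :: "cell \<Rightarrow> cell" where "south c = c - (0, 1)"

definition term_map :: "(cell \<Rightarrow> cell) \<Rightarrow> bool" where
  "term_map u \<longleftrightarrow> (\<exists>t. cterm_var t = 0 \<and> (\<forall>c. cterm_val [c] t = u c))"

text \<open>A local rule needs a single coordinate variable; neighbouring cells are reached by terms
  over it.\<close>

definition definable :: "nat \<Rightarrow> ('a config \<Rightarrow> 'b config list \<Rightarrow> cell \<Rightarrow> bool) \<Rightarrow> bool" where
  "definable k P \<longleftrightarrow> (\<exists>\<phi>. vars_below k 1 \<phi> \<and>
     (\<forall>x Xs c. k \<le> length Xs \<longrightarrow> (qfree_true x Xs [c] \<phi> \<longleftrightarrow> P x Xs c)))"

named_theorems definable_intros

lemma term_map_id [definable_intros]: "term_map (\<lambda>c. c)"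
  unfolding term_map_def by (intro exI[of _ "Var 0"]) simp

lemma term_map_west [definable_intros]: "term_map u \<Longrightarrow> term_map (\<lambda>c. west (u c))"
  unfolding term_map_def west_def by (metis cterm_val.simps(5) cterm_var.simps(5))

lemma term_map_south [definable_intros]: "term_map u \<Longrightarrow> term_map (\<lambda>c. south (u c))"
  unfolding term_map_def south_def by (metis cterm_val.simps(3) cterm_var.simps(3))

lemma definable_letter [definable_intros]:
  assumes "term_map u"
  shows "definable k (\<lambda>x Xs c. x (u c) = a)"
proof -
  obtain t where "cterm_var t = 0" "\<And>c. cterm_val [c] t = u c"
    using assms unfolding term_map_def by blast
  then show ?thesis
    unfolding definable_def by (intro exI[of _ "Letter a t"]) simp
qed

lemma definable_symb [definable_intros]:
  fixes u :: "cell \<Rightarrow> cell"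
  assumes "i < k" "term_map u"
  shows "definable k (\<lambda>x (Xs :: bool config list) c. (Xs ! i) (u c))"
proof -
  obtain t where "cterm_var t = 0" "\<And>c. cterm_val [c] t = u c"
    using assms(2) unfolding term_map_def by blast
  then show ?thesis
    unfolding definable_def using assms(1) by (intro exI[of _ "Symb i t True"]) simp
qed

lemma definable_not [definable_intros]:
  assumes "definable k P"
  shows "definable k (\<lambda>x Xs c. \<not> P x Xs c)"
proof -
  obtain \<phi> where "vars_below k 1 \<phi>" "\<And>x Xs c. k \<le> length Xs \<Longrightarrow> qfree_true x Xs [c] \<phi> \<longleftrightarrow> P x Xs c"
    using assms unfolding definable_def by blast
  then show ?thesis unfolding definable_def by (intro exI[of _ "Neg \<phi>"]) simp
qed

lemma definable_conj [definable_intros]: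
  assumes "definable k P" "definable k Q"
  shows "definable k (\<lambda>x Xs c. P x Xs c \<and> Q x Xs c)"
proof -
  obtain \<phi> where \<phi>: "vars_below k 1 \<phi>" "\<And>x Xs c. k \<le> length Xs \<Longrightarrow> qfree_true x Xs [c] \<phi> \<longleftrightarrow> P x Xs c"
    using assms(1) unfolding definable_def by blast
  obtain \<chi> where \<chi>: "vars_below k 1 \<chi>" "\<And>x Xs c. k \<le> length Xs \<Longrightarrow> qfree_true x Xs [c] \<chi> \<longleftrightarrow> Q x Xs c"
    using assms(2) unfolding definable_def by blast
  show ?thesis unfolding definable_def using \<phi> \<chi> by (intro exI[of _ "Conj \<phi> \<chi>"]) simp
qed

lemma definable_disj [definable_intros]:
  assumes "definable k P" "definable k Q"
  shows "definable k (\<lambda>x Xs c. P x Xs c \<or> Q x Xs c)"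
  using definable_not[OF definable_conj[OF assms[THEN definable_not]]] by simp

lemma definable_imp [definable_intros]:
  assumes "definable k P" "definable k Q"
  shows "definable k (\<lambda>x Xs c. P x Xs c \<longrightarrow> Q x Xs c)"
  using definable_disj[OF definable_not[OF assms(1)] assms(2)] by (simp only: imp_conv_disj)

lemma definable_iff [definable_intros]:
  assumes "definable k P" "definable k Q"
  shows "definable k (\<lambda>x Xs c. P x Xs c \<longleftrightarrow> Q x Xs c)"
  unfolding iff_conv_conj_imp by (intro definable_conj definable_imp assms)

lemma definable_const [definable_intros]: "definable k (\<lambda>x Xs c. b)"
  unfolding definable_def
  by (cases b) (intro exI[of _ "Eq (Var 0) (Var 0)"] exI[of _ "Neg (Eq (Var 0) (Var 0))"], simp)+

lemma definable_ball [definable_intros]: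
  assumes "finite S" "\<And>s. s \<in> S \<Longrightarrow> definable k (P s)"
  shows "definable k (\<lambda>x Xs c. \<forall>s \<in> S. P s x Xs c)"
  using assms by (induction S rule: finite_induct) (auto intro!: definable_intros)

lemma definable_bex [definable_intros]:
  assumes "finite S" "\<And>s. s \<in> S \<Longrightarrow> definable k (P s)"
  shows "definable k (\<lambda>x Xs c. \<exists>s \<in> S. P s x Xs c)"
  using definable_not[OF definable_ball[OF assms(1) definable_not[OF assms(2)]]] by simp

lemma definable_all_less [definable_intros]:
  "(\<And>i. i < n \<Longrightarrow> definable k (P i)) \<Longrightarrow> definable k (\<lambda>x Xs c. \<forall>i<n. P i x Xs c)" for n :: nat
  using definable_ball[of "{..<n}" k P] by (simp add: Ball_def)

lemma definable_ex_less [definable_intros]: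
  "(\<And>i. i < n \<Longrightarrow> definable k (P i)) \<Longrightarrow> definable k (\<lambda>x Xs c. \<exists>i<n. P i x Xs c)" for n :: nat
  using definable_bex[of "{..<n}" k P] by (simp add: Bex_def)

lemma definable_all [definable_intros]:
  "(\<And>a. definable k (P a)) \<Longrightarrow> definable k (\<lambda>x Xs c. \<forall>a :: 'c::finite. P a x Xs c)"
  using definable_ball[of UNIV k P] by simp

lemma definable_ex [definable_intros]:
  "(\<And>a. definable k (P a)) \<Longrightarrow> definable k (\<lambda>x Xs c. \<exists>a :: 'c::finite. P a x Xs c)"
  using definable_bex[of UNIV k P] by simp

lemma vars_below_mono: "vars_below k l p \<Longrightarrow> k \<le> k' \<Longrightarrow> vars_below k' l p"
  by (induction p) auto

lemma qfree_true_append: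
  "vars_below (length Xs) l p \<Longrightarrow> qfree_true x (Xs @ Ds) vs p \<longleftrightarrow> qfree_true x Xs vs p"
  by (induction p) (auto simp: nth_append)

section \<open>Prefixes with a prescribed number of quantifier blocks\<close>

fun alternating :: "nat \<Rightarrow> quantifier \<Rightarrow> quantifier list" where
  "alternating 0 q = []"
| "alternating (Suc n) q = q # alternating n (if q = Forall then Exists else Forall)"

lemma length_remdups_adj_alternating: "length (remdups_adj (alternating n q)) = n"
proof (induction n q rule: alternating.induct)
  case (2 n q)
  then show ?case by (cases n; cases q) auto
qed simp

lemma remdups_adj_replicate_append:
  "k \<ge> 1 \<Longrightarrow> ys = [] \<or> hd ys \<noteq> x \<Longrightarrow> remdups_adj (replicate k x @ ys) = x # remdups_adj ys"
proof (induction k)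
  case (Suc k)
  then show ?case by (cases k; cases ys) auto
qed simp

abbreviation full_prefix :: "quantifier list \<Rightarrow> (quantifier \<times> bool config set) list" where
  "full_prefix qs \<equiv> map (\<lambda>q. (q, binary_full_shift)) qs"

lemma prefix_true_replicate_Forall:
  "prefix_true x Xs (full_prefix (replicate k Forall @ qs)) l p \<longleftrightarrow>
    (\<forall>Ys. length Ys = k \<longrightarrow> prefix_true x (Xs @ Ys) (full_prefix qs) l p)"
proof (induction k arbitrary: Xs)
  case (Suc k)
  have "(\<forall>Ys. length Ys = Suc k \<longrightarrow> Q Ys) \<longleftrightarrow> (\<forall>X Ys. length Ys = k \<longrightarrow> Q (X # Ys))"
    for Q :: "bool config list \<Rightarrow> bool"
    by (auto simp: length_Suc_conv)
  then show ?case using Suc by (simp add: binary_full_shift_def)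
qed simp

lemma prefix_true_replicate_Exists:
  "prefix_true x Xs (full_prefix (replicate k Exists @ qs)) l p \<longleftrightarrow>
    (\<exists>Ys. length Ys = k \<and> prefix_true x (Xs @ Ys) (full_prefix qs) l p)"
proof (induction k arbitrary: Xs)
  case (Suc k)
  have "(\<exists>Ys. length Ys = Suc k \<and> Q Ys) \<longleftrightarrow> (\<exists>X Ys. length Ys = k \<and> Q (X # Ys))"
    for Q :: "bool config list \<Rightarrow> bool"
    by (auto simp: length_Suc_conv)
  then show ?case using Suc by (simp add: binary_full_shift_def)
qed simp

text \<open>The full shift is nonempty, so quantifying over layers that the matrix does not mention
  changes nothing.\<close>

lemma prefix_true_dummy:
  "vars_below (length Xs) 1 p \<Longrightarrow>
    prefix_true x Xs (full_prefix qs) 1 p \<longleftrightarrow> (\<forall>c. qfree_true x Xs [c] p)"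
proof (induction qs arbitrary: Xs)
  case Nil
  have "(\<forall>vs. length vs = Suc 0 \<longrightarrow> qfree_true x Xs vs p) \<longleftrightarrow> (\<forall>c. qfree_true x Xs [c] p)"
    by (metis length_0_conv length_Suc_conv)
  then show ?case by simp
next
  case (Cons q qs)
  have "prefix_true x (Xs @ [X]) (full_prefix qs) 1 p \<longleftrightarrow> (\<forall>c. qfree_true x Xs [c] p)" for X
    using Cons.IH[of "Xs @ [X]"] Cons.prems vars_below_mono[OF Cons.prems, of "Suc (length Xs)"]
      qfree_true_append[OF Cons.prems] by simp
  then show ?case by (cases q) (auto simp: binary_full_shift_def)
qed

text \<open>The first two blocks express the property; the other \<open>n - 2\<close> blocks are
  dummies continuing the alternation with a universal one.\<close>

lemma ex_Pi_bar_formula: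
  fixes P :: "'a config \<Rightarrow> bool config list \<Rightarrow> cell \<Rightarrow> bool"
  assumes "definable (k + l) P" "k \<ge> 1" "l \<ge> 1" "n \<ge> 2"
  shows "\<exists>\<psi> :: ('a, bool) u_mso. Pi_bar_formula n {binary_full_shift} \<psi> \<and>
    models \<psi> = {x. \<forall>Ys. length Ys = k \<longrightarrow> (\<exists>Zs. length Zs = l \<and> (\<forall>c. P x (Ys @ Zs) c))}"
proof -
  obtain \<phi> where \<phi>: "vars_below (k + l) 1 \<phi>"
    "\<And>x Xs c. k + l \<le> length Xs \<Longrightarrow> qfree_true x Xs [c] \<phi> \<longleftrightarrow> P x Xs c"
    using assms(1) unfolding definable_def by blast
  define qs where "qs = replicate k Forall @ replicate l Exists @ alternating (n - 2) Forall"
  define \<psi> where "\<psi> = U_MSO (full_prefix qs) 1 \<phi>"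
  have "vars_below (length qs) 1 \<phi>"
    by (rule vars_below_mono[OF \<phi>(1)]) (simp add: qs_def)
  then have "u_mso_over {binary_full_shift} \<psi>"
    by (auto simp: u_mso_over_def closed_formula_def \<psi>_def)
  moreover have "map fst (quant_prefix \<psi>) = qs"
    by (simp add: \<psi>_def comp_def)
  moreover have "length (remdups_adj qs) = n"
  proof -
    have "alternating (n - 2) Forall = [] \<or> hd (alternating (n - 2) Forall) \<noteq> Exists"
      by (cases "n - 2") auto
    moreover have "hd (replicate l Exists @ alternating (n - 2) Forall) \<noteq> Forall"
      using assms(3) by (cases l) auto
    ultimately show ?thesis
      using assms by (simp add: qs_def remdups_adj_replicate_append length_remdups_adj_alternating)
  qed
  moreover have "fst (hd (quant_prefix \<psi>)) = Forall"
    using assms(2) by (cases k) (auto simp: \<psi>_def qs_def)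
  ultimately have "Pi_bar_formula n {binary_full_shift} \<psi>"
    by (simp add: Pi_bar_formula_def)
  moreover have dummy: "prefix_true x (Ys @ Zs) (full_prefix (alternating (n - 2) Forall)) 1 \<phi>
      \<longleftrightarrow> (\<forall>c. P x (Ys @ Zs) c)" if "length Ys = k" "length Zs = l" for x Ys Zs
    using prefix_true_dummy[of "Ys @ Zs" \<phi>] \<phi> that by simp
  then have "models \<psi> = {x. \<forall>Ys. length Ys = k \<longrightarrow> (\<exists>Zs. length Zs = l \<and> (\<forall>c. P x (Ys @ Zs) c))}"
    unfolding models_def \<psi>_def qs_def u_mso.sel prefix_true_replicate_Forall
      prefix_true_replicate_Exists append_Nil
    by (intro Collect_cong all_cong1 imp_cong refl ex_cong1 conj_cong dummy) simp_all
  ultimately show ?thesis by blast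
qed

section \<open>Tableaux\<close>

text \<open>Register \<open>1\<close> holds the sum of both offsets instead of the vertical one: it
  is the column in which the antidiagonal through the tested cell reaches the bottom side.\<close>

definition cell_check :: "'a config \<Rightarrow> cell \<Rightarrow> 'a \<Rightarrow> (nat \<Rightarrow> nat) \<Rightarrow> bool" where
  "cell_check x u a s \<longleftrightarrow> s 0 \<le> s 1 \<and> x (u + (int (s 0), int (s 1) - int (s 0))) = a"

fun instr_regs :: "'a instr \<Rightarrow> nat set" where
  "instr_regs (Clear r) = {r}"
| "instr_regs (Move r q) = {r, q}"
| "instr_regs (Incr r q) = {r, q}"
| "instr_regs (IsZero r) = {r}"
| "instr_regs (NonZero r) = {r}"
| "instr_regs (Same r q) = {r, q}"
| "instr_regs (Mark a) = {}"

definition at :: "cell \<Rightarrow> nat \<Rightarrow> nat \<Rightarrow> cell" where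
  "at u i j = u + (int i, int j)"

lemma west_at [simp]: "west (at u (Suc i) j) = at u i j"
  by (simp add: west_def at_def)

lemma south_at [simp]: "south (at u i (Suc j)) = at u i j"
  by (simp add: south_def at_def)

lemma at_eq [simp]: "at u i j = at u i' j' \<longleftrightarrow> i = i' \<and> j = j'"
  by (auto simp: at_def)

lemma at_0 [simp]: "at u 0 0 = u"
  by (cases u) (simp add: at_def)

lemma at_west: "west c = at u i j \<longleftrightarrow> c = at u (Suc i) j"
  by (cases c; cases u) (auto simp: west_def at_def)

lemma at_south: "south c = at u i j \<longleftrightarrow> c = at u i (Suc j)"
  by (cases c; cases u) (auto simp: south_def at_def)

text \<open>The idle transition at \<open>final\<close> lets an accepting run be prolonged at will.
  The bound on \<open>m\<close> provides the registers \<open>0\<close> and \<open>1\<close> that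
  \<open>cell_check\<close> reads.\<close>

locale tableau =
  fixes T :: "'a::finite transition list" and final m :: nat
  assumes regs: "\<And>i a j r. (i, a, j) \<in> set T \<Longrightarrow> r \<in> instr_regs a \<Longrightarrow> r < m"
    and m: "m \<ge> 2"
    and final: "(final, Move 0 0, final) \<in> set T"
begin

abbreviation "ntrans \<equiv> length T"
abbreviation "source j \<equiv> fst (T ! j)"
abbreviation "instr j \<equiv> fst (snd (T ! j))"
abbreviation "target j \<equiv> snd (snd (T ! j))"

text \<open>The layers of the universally quantified configurations: the left, bottom and right sides
  of a rectangle, the registers in unary, and the transition that is taken in a row.\<close>

abbreviation lft :: "(nat \<Rightarrow> bool config) \<Rightarrow> cell \<Rightarrow> bool" where "lft Y \<equiv> Y 0"
abbreviation bot :: "(nat \<Rightarrow> bool config) \<Rightarrow> cell \<Rightarrow> bool" where "bot Y \<equiv> Y (Suc 0)"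
abbreviation rgt :: "(nat \<Rightarrow> bool config) \<Rightarrow> cell \<Rightarrow> bool" where "rgt Y \<equiv> Y 2"
abbreviation reg :: "(nat \<Rightarrow> bool config) \<Rightarrow> nat \<Rightarrow> cell \<Rightarrow> bool" where "reg Y i \<equiv> Y (3 + i)"
abbreviation trn :: "(nat \<Rightarrow> bool config) \<Rightarrow> nat \<Rightarrow> cell \<Rightarrow> bool" where "trn Y j \<equiv> Y (3 + m + j)"

text \<open>The transition drawn in a row is executed on the way to the row above, so
  \<open>c\<close> is the upper cell and the registers are read at \<open>south c\<close>. A unary
  register is nonzero iff its leftmost bit is set, which is why \<open>NonZero\<close> looks at the
  left side only.\<close>

fun guard :: "(nat \<Rightarrow> bool config) \<Rightarrow> 'a instr \<Rightarrow> cell \<Rightarrow> bool" where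
  "guard Y (IsZero r) c \<longleftrightarrow> \<not> reg Y r (south c)"
| "guard Y (NonZero r) c \<longleftrightarrow> (lft Y c \<longrightarrow> reg Y r (south c))"
| "guard Y (Same r q) c \<longleftrightarrow> (reg Y r (south c) \<longleftrightarrow> reg Y q (south c))"
| "guard Y _ c \<longleftrightarrow> True"

text \<open>In unary, incrementing shifts the word one cell to the east and sets the bit at the left
  side.\<close>

fun next_bit :: "(nat \<Rightarrow> bool config) \<Rightarrow> 'a instr \<Rightarrow> nat \<Rightarrow> cell \<Rightarrow> bool" where
  "next_bit Y (Clear r) i c \<longleftrightarrow> i \<noteq> r \<and> reg Y i (south c)"
| "next_bit Y (Move r q) i c \<longleftrightarrow> reg Y (if i = r then q else i) (south c)"
| "next_bit Y (Incr r q) i c \<longleftrightarrow>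
     (i = r \<and> (lft Y c \<or> reg Y q (west (south c)))) \<or> (i \<noteq> r \<and> reg Y i (south c))"
| "next_bit Y _ i c \<longleftrightarrow> reg Y i (south c)"

definition ok_west :: "(nat \<Rightarrow> bool config) \<Rightarrow> cell \<Rightarrow> bool" where
  "ok_west Y c \<longleftrightarrow> (bot Y c \<longleftrightarrow> bot Y (west c)) \<and> \<not> rgt Y (west c) \<and>
     (\<forall>j<ntrans. trn Y j c \<longleftrightarrow> trn Y j (west c)) \<and> (\<forall>i<m. reg Y i c \<longrightarrow> reg Y i (west c))"

definition ok_south :: "(nat \<Rightarrow> bool config) \<Rightarrow> cell \<Rightarrow> bool" where
  "ok_south Y c \<longleftrightarrow> (lft Y c \<longleftrightarrow> lft Y (south c)) \<and> (rgt Y c \<longleftrightarrow> rgt Y (south c)) \<and>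
     (\<forall>j<ntrans. trn Y j (south c) \<longrightarrow> guard Y (instr j) c \<and>
       (\<forall>i<m. reg Y i c \<longleftrightarrow> next_bit Y (instr j) i c) \<and>
       (\<forall>k<ntrans. trn Y k c \<longrightarrow> source k = target j))"

text \<open>On the bottom side only the state is prescribed, as acceptance leaves the initial
  registers free. Empty registers at the right side ensure that every value fits into the width and
  no bit is lost.\<close>

definition ok :: "(nat \<Rightarrow> bool config) \<Rightarrow> cell \<Rightarrow> bool" where
  "ok Y c \<longleftrightarrow> (\<not> lft Y c \<longrightarrow> ok_west Y c) \<and> (\<not> bot Y c \<longrightarrow> ok_south Y c) \<and>
     (\<exists>j<ntrans. trn Y j c) \<and> (\<forall>j<ntrans. bot Y c \<and> trn Y j c \<longrightarrow> source j = 0) \<and>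
     (rgt Y c \<longrightarrow> (\<forall>i<m. \<not> reg Y i c))"

definition accepting :: "(nat \<Rightarrow> bool config) \<Rightarrow> cell \<Rightarrow> bool" where
  "accepting Y c \<longleftrightarrow> rgt Y c \<and> (\<exists>j<ntrans. trn Y j c \<and> source j = final)"

text \<open>The layers of the existentially quantified configurations, which refute the tableau:
  \<open>err\<close> claims an error in the rectangle below and to the left, \<open>chl\<close> is the region of a challenged
  tableau, \<open>row\<close> is the challenged row, in which a letter \<open>a\<close> is tested, \<open>blw\<close> says that \<open>row\<close> can
  be found below, and the lines \<open>col\<close> and \<open>adg\<close> meet at the tested cell. The line \<open>adg\<close> is the
  antidiagonal whose lowest cell is in the column \<open>sid\<close>.\<close>

abbreviation err :: "(nat \<Rightarrow> bool config) \<Rightarrow> cell \<Rightarrow> bool" where "err Z \<equiv> Z 0"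
abbreviation chl :: "(nat \<Rightarrow> bool config) \<Rightarrow> cell \<Rightarrow> bool" where "chl Z \<equiv> Z 1"
abbreviation blw :: "(nat \<Rightarrow> bool config) \<Rightarrow> cell \<Rightarrow> bool" where "blw Z \<equiv> Z 2"
abbreviation row :: "(nat \<Rightarrow> bool config) \<Rightarrow> cell \<Rightarrow> bool" where "row Z \<equiv> Z 3"
abbreviation col :: "(nat \<Rightarrow> bool config) \<Rightarrow> cell \<Rightarrow> bool" where "col Z \<equiv> Z 4"
abbreviation sid :: "(nat \<Rightarrow> bool config) \<Rightarrow> cell \<Rightarrow> bool" where "sid Z \<equiv> Z 5"
abbreviation adg :: "(nat \<Rightarrow> bool config) \<Rightarrow> cell \<Rightarrow> bool" where "adg Z \<equiv> Z 6"
abbreviation ltr :: "(nat \<Rightarrow> bool config) \<Rightarrow> 'a \<Rightarrow> cell \<Rightarrow> bool" where "ltr Z a \<equiv> Z (7 + letter_code a)"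

definition chl_west :: "(nat \<Rightarrow> bool config) \<Rightarrow> cell \<Rightarrow> bool" where
  "chl_west Z c \<longleftrightarrow> chl Z (west c) \<and> (row Z c \<longleftrightarrow> row Z (west c)) \<and>
     (\<forall>a. ltr Z a c \<longleftrightarrow> ltr Z a (west c))"

definition chl_south :: "(nat \<Rightarrow> bool config) \<Rightarrow> cell \<Rightarrow> bool" where
  "chl_south Z c \<longleftrightarrow> chl Z (south c) \<and> (col Z c \<longleftrightarrow> col Z (south c)) \<and>
     (sid Z c \<longleftrightarrow> sid Z (south c)) \<and> (\<forall>a. ltr Z a c \<longleftrightarrow> ltr Z a (south c))"

text \<open>The value of a register is marked by the first cell outside its unary word, which is the
  cell at the left side if the word is empty.\<close>

definition chl_row :: "(nat \<Rightarrow> bool config) \<Rightarrow> (nat \<Rightarrow> bool config) \<Rightarrow> cell \<Rightarrow> bool" where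
  "chl_row Y Z c \<longleftrightarrow> (\<exists>j<ntrans. \<exists>a. instr j = Mark a \<and> trn Y j c \<and> ltr Z a c) \<and>
     (col Z c \<longleftrightarrow> \<not> reg Y 0 c \<and> (lft Y c \<or> reg Y 0 (west c))) \<and>
     (sid Z c \<longleftrightarrow> \<not> reg Y 1 c \<and> (lft Y c \<or> reg Y 1 (west c)))"

text \<open>An accepting cell forces one of the two kinds of refutation. The claims
  \<open>err\<close> and \<open>blw\<close> are justified at the cell itself or passed on, but never
  through a wall. The rule for \<open>adg\<close> links the western and southern neighbours because
  these lie on a common antidiagonal.\<close>

definition refutes :: "'a config \<Rightarrow> (nat \<Rightarrow> bool config) \<Rightarrow> (nat \<Rightarrow> bool config) \<Rightarrow> cell \<Rightarrow> bool" where
  "refutes x Y Z c \<longleftrightarrow>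
     (accepting Y c \<longrightarrow> err Z c \<or> chl Z c \<and> blw Z c) \<and>
     (err Z c \<longrightarrow> \<not> ok Y c \<or> \<not> lft Y c \<and> err Z (west c) \<or> \<not> bot Y c \<and> err Z (south c)) \<and>
     (chl Z c \<longrightarrow>
       (\<not> lft Y c \<longrightarrow> chl_west Z c) \<and> (\<not> bot Y c \<longrightarrow> chl_south Z c) \<and>
       (blw Z c \<longrightarrow> row Z c \<or> \<not> bot Y c \<and> blw Z (south c)) \<and>
       (row Z c \<longrightarrow> chl_row Y Z c) \<and>
       (bot Y c \<longrightarrow> (adg Z c \<longleftrightarrow> sid Z c)) \<and>
       (\<not> lft Y c \<and> \<not> bot Y c \<longrightarrow> (adg Z (west c) \<longleftrightarrow> adg Z (south c))) \<and>
       (\<forall>a. col Z c \<and> adg Z c \<and> ltr Z a c \<longrightarrow> x c \<noteq> a))"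

abbreviation "nY \<equiv> 3 + m + ntrans"

lemma instr_regs_less: "j < ntrans \<Longrightarrow> \<forall>r \<in> instr_regs (instr j). r < m"
  using regs[of "source j" "instr j" "target j"] by simp

lemma definable_guard:
  assumes "j < ntrans"
  shows "definable (nY + (7 + CARD('a))) (\<lambda>(x :: 'a config) Xs c. guard (\<lambda>i. Xs ! i) (instr j) c)"
  using instr_regs_less[OF assms] m by (cases "instr j") (auto intro!: definable_intros)

lemma definable_next_bit:
  assumes "j < ntrans" "i < m"
  shows "definable (nY + (7 + CARD('a))) (\<lambda>(x :: 'a config) Xs c. next_bit (\<lambda>i. Xs ! i) (instr j) i c)"
  using instr_regs_less[OF assms(1)] assms(2) m by (cases "instr j") (auto intro!: definable_intros)

lemma definable_refutes:
  "definable (nY + (7 + CARD('a))) (\<lambda>x Xs c. refutes x (\<lambda>i. Xs ! i) (\<lambda>i. Xs ! (nY + i)) c)"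
proof -
  have "letter_code a < CARD('a)" for a :: 'a by (rule letter_code_less)
  then show ?thesis
    unfolding refutes_def chl_west_def chl_south_def chl_row_def ok_def ok_west_def ok_south_def accepting_def
    using m by (intro definable_intros definable_guard definable_next_bit) auto
qed

subsection \<open>Correct tableaux have no refutation\<close>

text \<open>A genuine run is drawn with lower left corner \<open>u\<close>. Following any purported
  refutation through the rectangle leads to the tested cell, whose letter is right.\<close>

lemma no_refutation:
  assumes "automaton_run (cell_check x u) (set T) 0 s final s'"
  shows "\<exists>Y. \<forall>Z. \<exists>c. \<not> refutes x Y Z c"
proof -
  obtain n q0 S0 \<tau>0 where run0: "q0 0 = 0" "q0 n = final"
    "\<And>r. r < n \<Longrightarrow> (q0 r, \<tau>0 r, q0 (Suc r)) \<in> set T \<and> instr_step (cell_check x u) (\<tau>0 r) (S0 r) (S0 (Suc r))"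
    using automaton_run_imp_sequence[OF assms] by blast
  \<comment> \<open>The run is prolonged by idling in the final state, because the rectangle may
    have to be higher than the run is long.\<close>
  define q where "q r = (if r < n then q0 r else final)" for r
  define S where "S r = (if r < n then S0 r else S0 n)" for r
  define \<tau> where "\<tau> r = (if r < n then \<tau>0 r else Move 0 0)" for r
  have q0: "q 0 = 0" using run0(1,2) by (auto simp: q_def)
  have "(q r, \<tau> r, q (Suc r)) \<in> set T" for r
    using run0(2) run0(3)[of r] final by (cases "Suc r = n") (auto simp: q_def \<tau>_def)
  then have "\<exists>j<ntrans. T ! j = (q r, \<tau> r, q (Suc r))" for r
    by (simp add: in_set_conv_nth)
  then obtain J where J: "\<And>r. J r < ntrans" "\<And>r. T ! J r = (q r, \<tau> r, q (Suc r))" by metis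
  have step: "instr_step (cell_check x u) (\<tau> r) (S r) (S (Suc r))" for r
    using run0(3)[of r] by (cases "Suc r = n") (auto simp: S_def \<tau>_def)
  have regs': "k < m" if "k \<in> instr_regs (\<tau> r)" for k r
    using instr_regs_less[OF J(1)[of r]] J(2)[of r] that by simp
  \<comment> \<open>The height has to reach the final state and every tested cell; the latter has
    height \<open>S t 1 - S t 0\<close>, which is at most \<open>S t 1\<close>.\<close>
  define H where "H = n + (\<Sum>r\<le>n. S r 1)"
  have S1: "S r 1 \<le> H" for r
  proof -
    have "S r 1 = S (min r n) 1" by (simp add: S_def min_def)
    also have "\<dots> \<le> (\<Sum>r\<le>n. S r 1)" by (rule member_le_sum) auto
    finally show ?thesis by (simp add: H_def)
  qed
  \<comment> \<open>The width bounds all register values up to row \<open>H\<close>, so that the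
    registers are empty at the right side.\<close>
  define N where "N = (\<Sum>r\<le>H. \<Sum>i<m. S r i)"
  have N: "S r i \<le> N" if "r \<le> H" "i < m" for r i
  proof -
    have "S r i \<le> (\<Sum>i<m. S r i)" by (rule member_le_sum) (use that in auto)
    also have "\<dots> \<le> N" unfolding N_def by (rule member_le_sum) (use that in auto)
    finally show ?thesis .
  qed
  define Y where "Y i c = (let a = fst c - fst u; b = snd c - snd u; r = nat b in
    if i = 0 then a = 0 else if i = 1 then b = 0 else if i = 2 then a = int N
    else if i < 3 + m then a < int (S r (i - 3)) else J r = i - 3 - m)" for i c
  have Y: "lft Y (at u j r) \<longleftrightarrow> j = 0" "bot Y (at u j r) \<longleftrightarrow> r = 0" "rgt Y (at u j r) \<longleftrightarrow> j = N"
    "i < m \<Longrightarrow> reg Y i (at u j r) \<longleftrightarrow> j < S r i" "trn Y i (at u j r) \<longleftrightarrow> J r = i" for i j r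
    by (auto simp: Y_def at_def Let_def)
  have ok: "ok Y (at u j r)" if "j \<le> N" "r \<le> H" for j r
  proof -
    have "ok_west Y (at u j r)" if "j \<noteq> 0"
      using that \<open>j \<le> N\<close> by (cases j) (auto simp: ok_west_def Y)
    moreover have "ok_south Y (at u j r)" if r0: "r \<noteq> 0"
    proof -
      obtain r' where r: "r = Suc r'" using r0 by (cases r) auto
      have "guard Y (\<tau> r') (at u j r)"
        using step[of r'] regs'[of _ r'] by (cases "\<tau> r'") (auto simp: Y r)
      moreover have "reg Y i (at u j r) \<longleftrightarrow> next_bit Y (\<tau> r') i (at u j r)" if "i < m" for i
        using step[of r'] regs'[of _ r'] that by (cases "\<tau> r'"; cases j) (auto simp: Y r)
      ultimately show ?thesis by (auto simp: ok_south_def Y r J(2))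
    qed
    moreover have "\<not> S r i > N" if "i < m" for i using N[OF \<open>r \<le> H\<close> that] by simp
    ultimately show ?thesis
      using J q0 by (auto simp: ok_def Y)
  qed
  show ?thesis
  proof (intro exI[of _ Y] allI, rule ccontr)
    fix Z
    assume "\<nexists>c. \<not> refutes x Y Z c"
    then have Z: "refutes x Y Z c" for c by blast
    \<comment> \<open>In a correct rectangle an error claim can only point west or south, so
      induction on the distance to the corner excludes it.\<close>
    have no_err: "\<not> err Z (at u j r)" if "j \<le> N" "r \<le> H" for j r
      using that
    proof (induction "j + r" arbitrary: j r rule: less_induct)
      case less
      have "\<not> err Z (west (at u j r))" if "j \<noteq> 0" using that less by (cases j) auto
      moreover have "\<not> err Z (south (at u j r))" if "r \<noteq> 0" using that less by (cases r) auto
      ultimately show ?case using Z[of "at u j r"] ok[OF less(2,3)] by (auto simp: refutes_def Y)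
    qed
    have "q H = final" by (simp add: q_def H_def)
    then have "accepting Y (at u N H)" using J[of H] by (auto simp: accepting_def Y)
    then have NH: "chl Z (at u N H)" "blw Z (at u N H)"
      using Z[of "at u N H"] no_err[of N H] by (auto simp: refutes_def)
    have chl_w: "chl_west Z (at u j r)" if "chl Z (at u j r)" "j \<noteq> 0" for j r
      using Z[of "at u j r"] that by (auto simp: refutes_def Y)
    have chl_s: "chl_south Z (at u j r)" if "chl Z (at u j r)" "r \<noteq> 0" for j r
      using Z[of "at u j r"] that by (auto simp: refutes_def Y)
    \<comment> \<open>The challenge is known at the top right corner only; it spreads down the right
      side and from there westward along every row.\<close>
    have chl_N: "chl Z (at u N r)" if "r \<le> H" for r
      using that
    proof (induction rule: inc_induct)
      case (step r)
      then show ?case using chl_s[of N "Suc r"] by (simp add: chl_south_def)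
    qed (rule NH)
    have chl: "chl Z (at u j r)" if "j \<le> N" "r \<le> H" for j r
      using that(1)
    proof (induction rule: inc_induct)
      case (step j)
      then show ?case using chl_w[of "Suc j" r] by (simp add: chl_west_def)
    qed (rule chl_N[OF that(2)])
    \<comment> \<open>Descending the right side, \<open>blw\<close> can be passed on only until the
      bottom, where a challenged row is due at the latest.\<close>
    have "\<exists>t\<le>r. row Z (at u N t)" if "blw Z (at u N r)" "r \<le> H" for r
      using that
    proof (induction r)
      case 0
      then show ?case using Z[of "at u N 0"] chl[of N 0] by (auto simp: refutes_def Y)
    next
      case (Suc r)
      then show ?case using Z[of "at u N (Suc r)"] chl[of N "Suc r"] by (auto simp: refutes_def Y le_Suc_eq)
    qed
    then obtain t where t: "t \<le> H" "row Z (at u N t)" using NH(2) by blast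
    have row: "row Z (at u j t)" if "j \<le> N" for j
      using that
    proof (induction rule: inc_induct)
      case (step j)
      then show ?case using chl_w[of "Suc j" t] chl[of "Suc j" t] t(1) by (simp add: chl_west_def)
    qed (rule t(2))
    have chl_row: "chl_row Y Z (at u j t)" if "j \<le> N" for j
      using Z[of "at u j t"] chl[OF that t(1)] row[OF that] by (simp add: refutes_def)
    \<comment> \<open>This tableau shows exactly one transition per row, so the challenged row
      really executes \<open>Mark a\<close>.\<close>
    obtain a where a: "\<tau> t = Mark a" "ltr Z a (at u 0 t)"
      using chl_row[of 0] by (auto simp: chl_row_def Y J(2))
    have a_const: "ltr Z a (at u j r)" if "j \<le> N" "r \<le> H" for j r
    proof -
      have left: "ltr Z a (at u 0 r) \<longleftrightarrow> ltr Z a (at u 0 0)" if "r \<le> H" for r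
        using that
      proof (induction r)
        case (Suc r)
        then show ?case using chl_s[of 0 "Suc r"] chl[of 0 "Suc r"] by (simp add: chl_south_def)
      qed simp
      have "ltr Z a (at u j r) \<longleftrightarrow> ltr Z a (at u 0 r)"
        using that(1)
      proof (induction j)
        case (Suc j)
        then show ?case using chl_w[of "Suc j" r] chl[of "Suc j" r] that(2) by (simp add: chl_west_def)
      qed simp
      then show ?thesis using left[OF that(2)] left[OF t(1)] a(2) by simp
    qed
    define v where "v = S t 0"
    define w where "w = S t 1"
    have vw: "v \<le> w" "x (u + (int v, int w - int v)) = a" "v \<le> N" "w \<le> N" "w \<le> H"
      using step[of t] a(1) N[OF t(1)] m S1[of t] by (auto simp: cell_check_def v_def w_def)
    have Y01: "Y 3 (at u j r) \<longleftrightarrow> j < S r 0" "Y 4 (at u j r) \<longleftrightarrow> j < S r (Suc 0)" for j r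
      using Y(4)[of 0] Y(4)[of 1] m by auto
    \<comment> \<open>At distance \<open>v\<close> from the left side the unary word of register
      \<open>0\<close> has just ended; \<open>v \<le> N\<close> keeps this cell inside the
      rectangle.\<close>
    have col_t: "col Z (at u v t)"
      using chl_row[OF vw(3)] m by (cases v) (auto simp: chl_row_def Y Y01 v_def)
    have sid_t: "sid Z (at u w t)"
      using chl_row[OF vw(4)] m by (cases w) (auto simp: chl_row_def Y Y01 w_def)
    have column: "(col Z (at u j r) \<longleftrightarrow> col Z (at u j 0)) \<and> (sid Z (at u j r) \<longleftrightarrow> sid Z (at u j 0))"
      if "j \<le> N" "r \<le> H" for j r
      using that(2)
    proof (induction r)
      case (Suc r)
      then show ?case using chl_s[of j "Suc r"] chl[of j "Suc r"] that(1) by (simp add: chl_south_def)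
    qed simp
    have "sid Z (at u w 0)" using column[OF vw(4) t(1)] sid_t by simp
    then have adg_0: "adg Z (at u w 0)"
      using Z[of "at u w 0"] chl[of w 0] vw(4) by (simp add: refutes_def Y)
    \<comment> \<open>The antidiagonal is climbed from its foot in column \<open>w\<close>: each
      step passes from the southern neighbour of a cell to the western one.\<close>
    have "adg Z (at u (w - k) k)" if "k \<le> w" for k
      using that
    proof (induction k)
      case (Suc k)
      let ?c = "at u (w - k) (Suc k)"
      have wk: "w - k = Suc (w - Suc k)" using Suc.prems by simp
      have "chl Z ?c" using Suc.prems vw by (intro chl) auto
      then have "adg Z (west ?c) \<longleftrightarrow> adg Z (south ?c)"
        using Z[of ?c] Suc.prems by (auto simp: refutes_def Y)
      then show ?case using Suc by (simp add: wk)
    qed (use adg_0 in simp)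
    from this[of "w - v"] have "adg Z (at u v (w - v))" using vw(1) by simp
    moreover have le: "w - v \<le> H" using vw by simp
    moreover have "col Z (at u v (w - v))" using column[OF vw(3) le] column[OF vw(3) t(1)] col_t by simp
    ultimately have "x (at u v (w - v)) \<noteq> a"
      using Z[of "at u v (w - v)"] chl[OF vw(3) le] a_const[OF vw(3) le] by (auto simp: refutes_def)
    moreover have "at u v (w - v) = u + (int v, int w - int v)" using vw(1) by (simp add: at_def of_nat_diff)
    ultimately show False using vw(2) by simp
  qed
qed

subsection \<open>Incorrect tableaux have a refutation\<close>

text \<open>The complement of the largest consistent error claim: all paths to the west and south
  meet only correct cells and end at the sides. The refuter claims an error exactly at the remaining
  cells.\<close>

inductive good :: "(nat \<Rightarrow> bool config) \<Rightarrow> cell \<Rightarrow> bool" for Y where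
  "ok Y c \<Longrightarrow> (\<not> lft Y c \<Longrightarrow> good Y (west c)) \<Longrightarrow> (\<not> bot Y c \<Longrightarrow> good Y (south c)) \<Longrightarrow> good Y c"

definition rect :: "(nat \<Rightarrow> bool config) \<Rightarrow> cell \<Rightarrow> nat \<Rightarrow> nat \<Rightarrow> bool" where
  "rect Y u i j \<longleftrightarrow> (\<forall>a\<le>i. \<forall>b\<le>j. ok Y (at u a b) \<and>
     (lft Y (at u a b) \<longleftrightarrow> a = 0) \<and> (bot Y (at u a b) \<longleftrightarrow> b = 0))"

lemma rect_mono: "rect Y u i j \<Longrightarrow> i' \<le> i \<Longrightarrow> j' \<le> j \<Longrightarrow> rect Y u i' j'"
  by (auto simp: rect_def)

text \<open>If the corners differed, the left or bottom side of one rectangle would meet the other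
  rectangle away from its own side.\<close>

lemma rect_unique:
  assumes "rect Y u i j" "rect Y u' i' j'" "at u i j = at u' i' j'"
  shows "u = u' \<and> i = i' \<and> j = j'"
proof -
  have le: "i' \<le> i \<and> j' \<le> j"
    if "rect Y u i j" "rect Y u' i' j'" "at u i j = at u' i' j'" for u u' i j i' j'
  proof (rule ccontr)
    assume "\<not> (i' \<le> i \<and> j' \<le> j)"
    then consider "i < i'" | "j < j'" by linarith
    then show False
    proof cases
      case 1
      then have "at u 0 j = at u' (i' - i) j'" using that(3) by (auto simp: at_def prod_eq_iff)
      moreover have "lft Y (at u 0 j)" using that(1) by (auto simp: rect_def)
      moreover have "\<not> lft Y (at u' (i' - i) j')" using that(2) 1 by (auto simp: rect_def)
      ultimately show False by simp
    next
      case 2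
      then have "at u i 0 = at u' i' (j' - j)" using that(3) by (auto simp: at_def prod_eq_iff)
      moreover have "bot Y (at u i 0)" using that(1) by (auto simp: rect_def)
      moreover have "\<not> bot Y (at u' i' (j' - j))" using that(2) 2 by (auto simp: rect_def)
      ultimately show False by simp
    qed
  qed
  have "i = i'" "j = j'" using le[OF assms] le[OF assms(2,1) assms(3)[symmetric]] by auto
  with assms(3) show ?thesis by (simp add: at_def)
qed

lemma ok_westD: "ok Y c \<Longrightarrow> \<not> lft Y c \<Longrightarrow> ok_west Y c"
  by (simp add: ok_def)

lemma ok_southD: "ok Y c \<Longrightarrow> \<not> bot Y c \<Longrightarrow> ok_south Y c"
  by (simp add: ok_def)

lemma rect_row:
  assumes "rect Y u i j" "west c = at u i j" "ok Y c" "\<not> lft Y c" "bot Y c"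
  shows "rect Y u (Suc i) 0 \<and> c = at u (Suc i) 0"
proof -
  have c: "c = at u (Suc i) j" using assms(2) by (simp add: at_west)
  have "bot Y (at u i j)" using ok_westD[OF assms(3,4)] assms(5) by (simp add: ok_west_def c)
  then have "j = 0" using assms(1) by (auto simp: rect_def)
  then show ?thesis using assms c by (auto simp: rect_def le_Suc_eq)
qed

lemma rect_column:
  assumes "rect Y u i j" "south c = at u i j" "ok Y c" "lft Y c" "\<not> bot Y c"
  shows "rect Y u 0 (Suc j) \<and> c = at u 0 (Suc j)"
proof -
  have c: "c = at u i (Suc j)" using assms(2) by (simp add: at_south)
  have "lft Y (at u i j)" using ok_southD[OF assms(3,5)] assms(4) by (simp add: ok_south_def c)
  then have "i = 0" using assms(1) by (auto simp: rect_def)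
  then show ?thesis using assms c by (auto simp: rect_def le_Suc_eq)
qed

text \<open>The rectangles ending at the western and southern neighbours share the southwestern
  cell. By uniqueness they have the same corner, so together with \<open>c\<close> they fill the
  enlarged rectangle.\<close>

lemma rect_inner:
  assumes "rect Y u i j" "west c = at u i j" "rect Y u' i' j'" "south c = at u' i' j'"
    and "ok Y c" "\<not> lft Y c" "\<not> bot Y c"
  shows "rect Y u (Suc i) j \<and> c = at u (Suc i) j"
proof -
  have c: "c = at u (Suc i) j" "c = at u' i' (Suc j')" using assms(2,4) by (simp_all add: at_west at_south)
  have "\<not> bot Y (at u i j)" using ok_westD[OF assms(5,6)] assms(7) by (simp add: ok_west_def c(1))
  then obtain j0 where j: "j = Suc j0" using assms(1) by (cases j) (auto simp: rect_def)
  have "\<not> lft Y (at u' i' j')" using ok_southD[OF assms(5,7)] assms(6) by (simp add: ok_south_def c(2))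
  then obtain i0 where i: "i' = Suc i0" using assms(3) by (cases i') (auto simp: rect_def)
  have "at u i j0 = at u' i0 j'"
    using c unfolding i j by (auto simp: at_def prod_eq_iff)
  moreover have "rect Y u i j0" "rect Y u' i0 j'"
    using assms(1,3) unfolding i j by (auto intro: rect_mono)
  ultimately have "u = u'" "i = i0" "j0 = j'" using rect_unique by blast+
  then have "rect Y u (Suc i) j0" using assms(3) i by simp
  then have "ok Y (at u a b) \<and> (lft Y (at u a b) \<longleftrightarrow> a = 0) \<and> (bot Y (at u a b) \<longleftrightarrow> b = 0)"
    if ab: "a \<le> Suc i" "b \<le> j" for a b
  proof (cases "a = Suc i \<and> b = j")
    case True
    then show ?thesis using assms(5-7) c(1) j by simp
  next
    case False
    then consider "a \<le> i" | "b \<le> j0" using ab j by linarith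
    then show ?thesis
      using assms(1) \<open>rect Y u (Suc i) j0\<close> ab by cases (simp_all add: rect_def)
  qed
  then show ?thesis using c(1) by (simp add: rect_def)
qed

lemma good_imp_rect: "good Y c \<Longrightarrow> \<exists>u i j. c = at u i j \<and> rect Y u i j"
proof (induction rule: good.induct)
  case (1 c)
  show ?case
  proof (cases "lft Y c")
    case True
    show ?thesis
    proof (cases "bot Y c")
      case bot: True
      then have "rect Y c 0 0" using "1.hyps"(1) True by (simp add: rect_def)
      then show ?thesis by (intro exI[of _ c] exI[of _ 0]) simp
    next
      case False
      then show ?thesis using "1.IH"(2) rect_column[OF _ _ "1.hyps"(1) True] by blast
    qed
  next
    case False
    show ?thesis
    proof (cases "bot Y c")
      case True
      then show ?thesis using "1.IH"(1) False rect_row[OF _ _ "1.hyps"(1) False] by blast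
    next
      case bot: False
      obtain u i j where w: "west c = at u i j" "rect Y u i j" using "1.IH"(1)[OF False] by blast
      obtain u' i' j' where s: "south c = at u' i' j'" "rect Y u' i' j'" using "1.IH"(2)[OF bot] by blast
      show ?thesis using rect_inner[OF w(2,1) s(2,1) "1.hyps"(1) False bot] by blast
    qed
  qed
qed

text \<open>Uniqueness makes the corner a function of the cell, so the refuter can define the layers
  cell by cell even if a configuration shows several rectangles.\<close>

definition origin :: "(nat \<Rightarrow> bool config) \<Rightarrow> cell \<Rightarrow> cell" where
  "origin Y c = (SOME u. \<exists>i j. c = at u i j \<and> rect Y u i j)"

lemma origin_at: "rect Y u i j \<Longrightarrow> origin Y (at u i j) = u"
  unfolding origin_def by (rule some_equality) (blast, use rect_unique in metis)

section \<open>Register contents and runs read off a rectangle\<close>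

definition reg_val :: "(nat \<Rightarrow> bool config) \<Rightarrow> cell \<Rightarrow> nat \<Rightarrow> nat \<Rightarrow> nat" where
  "reg_val Y u r i = (LEAST a. \<not> reg Y i (at u a r))"

text \<open>Depends on the corner and the row but not on the extent of the rectangle, so that one
  challenge fits all rectangles with this corner.\<close>

definition mismatch :: "'a config \<Rightarrow> (nat \<Rightarrow> bool config) \<Rightarrow> cell \<Rightarrow> nat \<Rightarrow> 'a \<Rightarrow> bool" where
  "mismatch x Y u r a \<longleftrightarrow> (\<exists>j<ntrans. instr j = Mark a \<and> trn Y j (at u 0 r)) \<and>
     \<not> cell_check x u a (reg_val Y u r)"

lemma trn_row:
  assumes "rect Y u i j" "k < ntrans" "a \<le> i" "b \<le> j"
  shows "trn Y k (at u a b) \<longleftrightarrow> trn Y k (at u 0 b)"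
  using assms(3)
proof (induction a)
  case (Suc a)
  then have "ok_west Y (at u (Suc a) b)" using assms(1,4) by (intro ok_westD) (auto simp: rect_def)
  then show ?case using Suc assms(2) by (simp add: ok_west_def)
qed simp

text \<open>The right side continues down to row \<open>b\<close>, and the register is empty there,
  so the minimum in \<open>reg_val\<close> exists; bits decreasing along the row give the
  rest.\<close>

lemma reg_iff_less_reg_val:
  assumes "rect Y u i j" "rgt Y (at u i j)" "k < m" "b \<le> j"
  shows "a \<le> i \<Longrightarrow> reg Y k (at u a b) \<longleftrightarrow> a < reg_val Y u b k" and "reg_val Y u b k \<le> i"
proof -
  have "rgt Y (at u i b)"
    using assms(4)
  proof (induction rule: inc_induct)
    case (step b)
    then have "ok_south Y (at u i (Suc b))" using assms(1) by (intro ok_southD) (auto simp: rect_def)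
    then show ?case using step by (simp add: ok_south_def)
  qed (rule assms(2))
  moreover have "ok Y (at u i b)" using assms(1,4) by (simp add: rect_def)
  ultimately have i: "\<not> reg Y k (at u i b)" using assms(3) by (simp add: ok_def)
  then show le: "reg_val Y u b k \<le> i" unfolding reg_val_def by (rule Least_le)
  have val: "\<not> reg Y k (at u (reg_val Y u b k) b)" unfolding reg_val_def using i by (rule LeastI)
  have "\<not> reg Y k (at u a b)" if "reg_val Y u b k \<le> a" "a \<le> i" for a
    using that
  proof (induction a rule: dec_induct)
    case (step a)
    then have "ok_west Y (at u (Suc a) b)" using assms(1,4) by (intro ok_westD) (auto simp: rect_def)
    then show ?case using step assms(3) by (auto simp: ok_west_def)
  qed (rule val)
  moreover have "reg Y k (at u a b)" if "a < reg_val Y u b k" for a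
    using not_less_Least[of a "\<lambda>a. \<not> reg Y k (at u a b)"] that by (auto simp: reg_val_def)
  ultimately show "a \<le> i \<Longrightarrow> reg Y k (at u a b) \<longleftrightarrow> a < reg_val Y u b k"
    using not_le_imp_less by blast
qed

text \<open>Different values are separated at the smaller of the two, which is at most
  \<open>i\<close> even if \<open>w\<close> is larger than \<open>i\<close>.\<close>

lemma nat_eq_of_initial_segments: "(\<And>a. a \<le> i \<Longrightarrow> a < v \<longleftrightarrow> a < w) \<Longrightarrow> v \<le> i \<Longrightarrow> v = w" for v w i :: nat
  by (metis le_trans less_or_eq_imp_le linorder_neqE_nat nat_less_le order_less_irrefl)

text \<open>If all announcements up to the accepting row were true, the rows would form an accepting
  run on \<open>x\<close>.\<close>

lemma ex_mismatch:
  assumes no_run: "\<And>s s'. \<not> automaton_run (cell_check x u) (set T) 0 s final s'"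
    and rect: "rect Y u i j" and acc: "accepting Y (at u i j)"
  shows "\<exists>r\<le>j. \<exists>a. mismatch x Y u r a"
proof (rule ccontr)
  assume no_mismatch: "\<not> (\<exists>r\<le>j. \<exists>a. mismatch x Y u r a)"
  have rgt: "rgt Y (at u i j)" using acc by (simp add: accepting_def)
  define S where "S r k = (if k < m then reg_val Y u r k else 0)" for r k
  have reg: "reg Y k (at u a r) \<longleftrightarrow> a < S r k" if "k < m" "a \<le> i" "r \<le> j" for k a r
    using reg_iff_less_reg_val(1)[OF rect rgt that(1,3,2)] that(1) by (simp add: S_def)
  have S_le: "S r k \<le> i" if "r \<le> j" for k r
    using reg_iff_less_reg_val(2)[OF rect rgt _ that] by (simp add: S_def)
  have ok: "ok Y (at u a b)" "lft Y (at u a b) \<longleftrightarrow> a = 0" "bot Y (at u a b) \<longleftrightarrow> b = 0"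
    if "a \<le> i" "b \<le> j" for a b
    using rect that by (auto simp: rect_def)
  \<comment> \<open>A row may show several transitions. One is selected per row, in the top row one
    that starts at \<open>final\<close>; \<open>ok_south\<close> makes all selections
    compatible.\<close>
  have "\<exists>k<ntrans. trn Y k (at u 0 r) \<and> (r = j \<longrightarrow> source k = final)" if "r \<le> j" for r
  proof (cases "r = j")
    case True
    obtain k where "k < ntrans" "trn Y k (at u i j)" "source k = final"
      using acc by (auto simp: accepting_def)
    then show ?thesis using trn_row[OF rect, of k i j] True by auto
  next
    case False
    then show ?thesis using ok(1)[of 0 r] that by (auto simp: ok_def)
  qed
  then obtain J where J: "\<And>r. r \<le> j \<Longrightarrow> J r < ntrans" "\<And>r. r \<le> j \<Longrightarrow> trn Y (J r) (at u 0 r)"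
    "source (J j) = final" by (metis le_refl)
  have trn: "trn Y (J r) (at u a r)" if "a \<le> i" "r \<le> j" for a r
    using trn_row[OF rect J(1)[OF that(2)] that] J(2)[OF that(2)] by simp
  have J0: "source (J 0) = 0" using ok[of 0 0] J(1,2)[of 0] by (auto simp: ok_def)
  have step: "(source (J r), instr (J r), source (J (Suc r))) \<in> set T \<and>
      instr_step (cell_check x u) (instr (J r)) (S r) (S (Suc r))" if "r < j" for r
  proof -
    have r: "r \<le> j" "Suc r \<le> j" using that by auto
    have S: "ok_south Y (at u a (Suc r))" if "a \<le> i" for a
      using ok[OF that r(2)] by (simp add: ok_southD)
    have src: "source (J (Suc r)) = target (J r)"
      using S[of 0] J(1,2)[OF r(1)] J(1,2)[OF r(2)] by (auto simp: ok_south_def)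
    then have "(source (J r), instr (J r), source (J (Suc r))) = T ! J r" by simp
    moreover have "T ! J r \<in> set T" using J(1)[OF r(1)] by simp
    ultimately have mem: "(source (J r), instr (J r), source (J (Suc r))) \<in> set T" by (simp only:)
    have guard: "guard Y (instr (J r)) (at u a (Suc r))" if "a \<le> i" for a
      using S[OF that] J(1)[OF r(1)] trn[OF that r(1)] by (auto simp: ok_south_def)
    have bits: "a < S (Suc r) k \<longleftrightarrow> next_bit Y (instr (J r)) k (at u a (Suc r))" if "a \<le> i" "k < m" for a k
      using S[OF that(1)] J(1)[OF r(1)] trn[OF that(1) r(1)] reg[OF that(2,1) r(2)] that(2)
      by (auto simp: ok_south_def)
    \<comment> \<open>Agreement of the bits within the width suffices, because the new value is
      known to fit.\<close>
    have eqI: "S (Suc r) k = v"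
      if "k < m" "\<And>a. a \<le> i \<Longrightarrow> next_bit Y (instr (J r)) k (at u a (Suc r)) \<longleftrightarrow> a < v" for k v
      by (rule nat_eq_of_initial_segments[of i]) (use bits that S_le[OF r(2)] in auto)
    have out: "S r' k = 0" if "\<not> k < m" for r' k using that by (simp add: S_def)
    note less = instr_regs_less[OF J(1)[OF r(1)]]
    have same: "S (Suc r) = S r"
      if "\<And>k a. k < m \<Longrightarrow> next_bit Y (instr (J r)) k (at u a (Suc r)) \<longleftrightarrow> reg Y k (at u a r)"
    proof
      fix k
      show "S (Suc r) k = S r k"
        using eqI[of k "S r k"] that reg[OF _ _ r(1)] out by (cases "k < m") auto
    qed
    have "instr_step (cell_check x u) (instr (J r)) (S r) (S (Suc r))"
    proof (cases "instr (J r)")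
      case (Clear q)
      have "S (Suc r) k = ((S r)(q := 0)) k" for k
        using eqI[of k "((S r)(q := 0)) k"] reg[OF _ _ r(1)] out less by (cases "k < m") (auto simp: Clear)
      then show ?thesis by (auto simp: Clear)
    next
      case (Move q p)
      have "S (Suc r) k = ((S r)(q := S r p)) k" for k
        using eqI[of k "((S r)(q := S r p)) k"] reg[OF _ _ r(1)] out less by (cases "k < m") (auto simp: Move)
      then show ?thesis by (auto simp: Move)
    next
      case (Incr q p)
      have "S (Suc r) k = ((S r)(q := Suc (S r p))) k" for k
      proof (cases "k < m")
        case True
        show ?thesis
        proof (rule eqI[OF True])
          \<comment> \<open>Splitting on \<open>a\<close> separates the left side, where the new bit
            appears, from the cells that copy their southwestern neighbour.\<close>
          fix a assume "a \<le> i"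
          then show "next_bit Y (instr (J r)) k (at u a (Suc r)) \<longleftrightarrow> a < ((S r)(q := Suc (S r p))) k"
            using reg[OF _ _ r(1)] less True ok(2)[of a "Suc r"] r(2) by (cases a) (auto simp: Incr)
        qed
      next
        case False
        then show ?thesis using out less by (auto simp: Incr)
      qed
      then show ?thesis by (auto simp: Incr)
    next
      case (IsZero q)
      have "\<not> reg Y q (at u 0 r)" using guard[of 0] by (simp add: IsZero)
      then show ?thesis using reg[OF _ _ r(1), of q 0] less same by (simp add: IsZero)
    next
      case (NonZero q)
      have "reg Y q (at u 0 r)" using guard[of 0] ok(2)[of 0 "Suc r"] r(2) by (simp add: NonZero)
      then show ?thesis using reg[OF _ _ r(1), of q 0] less same by (simp add: NonZero)
    next
      case (Same q p)
      have "S r q = S r p"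
        by (rule nat_eq_of_initial_segments[of i])
          (use guard reg[OF _ _ r(1)] less S_le[OF r(1)] in \<open>auto simp: Same\<close>)
      then show ?thesis using same by (simp add: Same)
    next
      case (Mark a)
      have "cell_check x u a (reg_val Y u r)"
        using no_mismatch r(1) J(1,2)[OF r(1)] Mark by (auto simp: mismatch_def)
      then have "cell_check x u a (S r)" using m by (simp add: cell_check_def S_def)
      then show ?thesis using same by (simp add: Mark)
    qed
    with mem show ?thesis by blast
  qed
  have "automaton_run (cell_check x u) (set T) (source (J 0)) (S 0) (source (J j)) (S j)"
    by (rule automaton_run_sequence[of j _ "\<lambda>r. instr (J r)"]) (rule step)
  then show False using no_run J0 J(3) by simp
qed

text \<open>A good accepting cell spans a rectangle with a false announcement, which is challenged;
  any other accepting cell is refuted by an error claim.\<close>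

lemma ex_refutation:
  assumes no_run: "\<And>u s s'. \<not> automaton_run (cell_check x u) (set T) 0 s final s'"
  shows "\<exists>Z. \<forall>c. refutes x Y Z c"
proof -
  \<comment> \<open>Row and letter of the challenge are functions of the corner alone, so rectangles
    with one corner and different accepting cells do not conflict.\<close>
  define t where "t u = (LEAST r. \<exists>a. mismatch x Y u r a)" for u
  define l where "l u = (SOME a. mismatch x Y u (t u) a)" for u
  define area where "area c \<longleftrightarrow> (\<exists>u i j a b. c = at u a b \<and> a \<le> i \<and> b \<le> j \<and> rect Y u i j \<and> accepting Y (at u i j))" for c
  \<comment> \<open>The layers are computed from the corner of the rectangle ending at
    \<open>c\<close>; where there is none, \<open>origin\<close> is an arbitrary cell.\<close>
  define Z where "Z k c = (let u = origin Y c; v = reg_val Y u (t u) in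
    if k = 0 then \<not> good Y c else if k = 1 then area c
    else if k = 2 then snd u + int (t u) \<le> snd c else if k = 3 then snd c = snd u + int (t u)
    else if k = 4 then fst c = fst u + int (v 0) else if k = 5 then fst c = fst u + int (v 1)
    else if k = 6 then (fst c - fst u) + (snd c - snd u) = int (v 1)
    else k = 7 + letter_code (l u))" for k c
  have Z_err: "err Z c \<longleftrightarrow> \<not> good Y c" and Z_chl: "chl Z c \<longleftrightarrow> area c" for c
    by (simp_all add: Z_def)
  have Z_at: "blw Z (at u a b) \<longleftrightarrow> t u \<le> b" "row Z (at u a b) \<longleftrightarrow> b = t u"
    "col Z (at u a b) \<longleftrightarrow> a = reg_val Y u (t u) 0" "sid Z (at u a b) \<longleftrightarrow> a = reg_val Y u (t u) 1"
    "adg Z (at u a b) \<longleftrightarrow> a + b = reg_val Y u (t u) 1" "ltr Z k (at u a b) \<longleftrightarrow> k = l u"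
    if "rect Y u a b" for u a b k
    using origin_at[OF that]
    by (auto simp: Z_def Let_def at_def inj_eq[OF inj_letter_code])
  have t: "t u \<le> j" "mismatch x Y u (t u) (l u)" if uij: "rect Y u i j" "accepting Y (at u i j)" for u i j
  proof -
    obtain r where r: "r \<le> j" "\<exists>a. mismatch x Y u r a" using ex_mismatch[OF no_run uij] by blast
    then have "\<exists>a. mismatch x Y u (t u) a" unfolding t_def by (intro LeastI)
    then show "mismatch x Y u (t u) (l u)" unfolding l_def by (rule someI_ex)
    have "t u \<le> r" unfolding t_def using r(2) by (rule Least_le)
    with r(1) show "t u \<le> j" by simp
  qed
  have "refutes x Y Z c" for c
    unfolding refutes_def Z_err Z_chl
  proof (intro conjI impI)
    assume acc: "accepting Y c"
    show "\<not> good Y c \<or> area c \<and> blw Z c"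
    proof (cases "good Y c")
      case True
      then obtain u i j where c: "c = at u i j" "rect Y u i j" using good_imp_rect by blast
      then have "area c" using acc unfolding area_def by blast
      then show ?thesis using t(1)[of u i j] acc c Z_at(1)[OF c(2)] by simp
    qed simp
  next
    assume "\<not> good Y c"
    then show "\<not> ok Y c \<or> \<not> lft Y c \<and> \<not> good Y (west c) \<or> \<not> bot Y c \<and> \<not> good Y (south c)"
      using good.intros by blast
  next
    assume "area c"
    then obtain u i j a b where c: "c = at u a b" "a \<le> i" "b \<le> j" and rect: "rect Y u i j"
      and acc: "accepting Y (at u i j)"
      unfolding area_def by blast
    note t = t[OF rect acc]
    have in_area: "area (at u a b)" if "a \<le> i" "b \<le> j" for a b
      unfolding area_def using that rect acc by blast
    have Z_in: "blw Z (at u a b) \<longleftrightarrow> t u \<le> b" "row Z (at u a b) \<longleftrightarrow> b = t u"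
      "col Z (at u a b) \<longleftrightarrow> a = reg_val Y u (t u) 0" "sid Z (at u a b) \<longleftrightarrow> a = reg_val Y u (t u) 1"
      "adg Z (at u a b) \<longleftrightarrow> a + b = reg_val Y u (t u) 1" "ltr Z k (at u a b) \<longleftrightarrow> k = l u"
      if "a \<le> i" "b \<le> j" for a b k
      using Z_at[OF rect_mono[OF rect that]] by blast+
    have bdry: "lft Y c \<longleftrightarrow> a = 0" "bot Y c \<longleftrightarrow> b = 0" using rect c by (auto simp: rect_def)
    have rgt: "rgt Y (at u i j)" using acc by (simp add: accepting_def)
    show "chl_west Z c" if *: "\<not> lft Y c"
    proof -
      obtain a' where a: "a = Suc a'" using * bdry by (cases a) auto
      then have "a' \<le> i" using c(2) by simp
      then show ?thesis using c in_area Z_in unfolding chl_west_def Z_chl a by simp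
    qed
    show "chl_south Z c" if *: "\<not> bot Y c"
    proof -
      obtain b' where b: "b = Suc b'" using * bdry by (cases b) auto
      then have "b' \<le> j" using c(3) by simp
      then show ?thesis using c in_area Z_in unfolding chl_south_def Z_chl b by simp
    qed
    show "row Z c \<or> \<not> bot Y c \<and> blw Z (south c)" if "blw Z c"
      using that Z_in c bdry by (cases b) auto
    show "chl_row Y Z c" if "row Z c"
    proof -
      have b: "b = t u" using that Z_in(2) c by simp
      obtain k where k: "k < ntrans" "instr k = Mark (l u)" "trn Y k (at u 0 (t u))"
        using t(2) by (auto simp: mismatch_def)
      then have "trn Y k c" using trn_row[OF rect k(1) c(2,3)] by (simp add: c(1) b)
      moreover have "a = reg_val Y u (t u) n \<longleftrightarrow> \<not> reg Y n c \<and> (lft Y c \<or> reg Y n (west c))" if "n < m" for n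
      proof -
        have r: "reg Y n (at u a' (t u)) \<longleftrightarrow> a' < reg_val Y u (t u) n" if "a' \<le> i" for a'
          using reg_iff_less_reg_val(1)[OF rect rgt \<open>n < m\<close> t(1) that] .
        show ?thesis
          using r[OF c(2)] r[of "a - 1"] c(2) bdry(1) unfolding c(1) b by (cases a) auto
      qed
      ultimately show ?thesis
        using k m Z_in[OF c(2,3)] unfolding chl_row_def c(1) by (auto simp: c(1)[symmetric])
    qed
    show "adg Z c \<longleftrightarrow> sid Z c" if "bot Y c"
      using that Z_in[OF c(2,3)] bdry by (simp add: c(1))
    show "adg Z (west c) \<longleftrightarrow> adg Z (south c)" if *: "\<not> lft Y c \<and> \<not> bot Y c"
    proof -
      obtain a' b' where ab: "a = Suc a'" "b = Suc b'" using * bdry by (cases a; cases b) auto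
      then have "west c = at u a' (Suc b')" "south c = at u (Suc a') b'" by (simp_all add: c(1))
      then show ?thesis using Z_in(5)[of a' "Suc b'"] Z_in(5)[of "Suc a'" b'] c(2,3) ab by simp
    qed
    show "\<forall>k. col Z c \<and> adg Z c \<and> ltr Z k c \<longrightarrow> x c \<noteq> k"
    proof (intro allI impI notI)
      fix k
      assume "col Z c \<and> adg Z c \<and> ltr Z k c" "x c = k"
      then have val: "a = reg_val Y u (t u) 0" "a + b = reg_val Y u (t u) 1" "x c = l u"
        using Z_in[OF c(2,3)] by (simp_all add: c(1))
      have "\<not> cell_check x u (l u) (reg_val Y u (t u))" using t(2) by (simp add: mismatch_def)
      \<comment> \<open>Where the lines meet, the inequality in \<open>cell_check\<close> holds
        automatically, so the failure of the check can only be due to the letter.\<close>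
      moreover have "int b = int (reg_val Y u (t u) 1) - int (reg_val Y u (t u) 0)" using val by linarith
      ultimately show False using val unfolding cell_check_def c(1) at_def by simp
    qed
  qed
  then show ?thesis by blast
qed

section \<open>Passing between functions and finite lists of layers\<close>

lemma guard_cong:
  assumes "\<And>i. i < nY \<Longrightarrow> Y i = Y' i" "j < ntrans"
  shows "guard Y (instr j) c \<longleftrightarrow> guard Y' (instr j) c"
  using instr_regs_less[OF assms(2)] m assms(1) by (cases "instr j") auto

lemma next_bit_cong:
  assumes "\<And>i. i < nY \<Longrightarrow> Y i = Y' i" "j < ntrans" "i < m"
  shows "next_bit Y (instr j) i c \<longleftrightarrow> next_bit Y' (instr j) i c"
  using instr_regs_less[OF assms(2)] m assms(1,3) by (cases "instr j") auto

text \<open>The layers that are read: three sides, \<open>m\<close> registers and one per transition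
  in \<open>Y\<close>; seven layers and one per letter in \<open>Z\<close>.\<close>

lemma refutes_cong:
  assumes Y: "\<And>i. i < nY \<Longrightarrow> Y i = Y' i" and Z: "\<And>i. i < 7 + CARD('a) \<Longrightarrow> Z i = Z' i"
  shows "refutes x Y Z c \<longleftrightarrow> refutes x Y' Z' c"
proof -
  have "trn Y j = trn Y' j" if "j < ntrans" for j using that by (intro Y) simp
  moreover have "reg Y i = reg Y' i" if "i < m" for i using that by (intro Y) simp
  moreover have "Y 0 = Y' 0" "Y (Suc 0) = Y' (Suc 0)" "Y 2 = Y' 2" "Y 3 = Y' 3" "Y 4 = Y' 4"
    using m by (auto intro!: Y)
  moreover have "Z 0 = Z' 0" "Z 1 = Z' 1" "Z 2 = Z' 2" "Z 3 = Z' 3" "Z 4 = Z' 4" "Z 5 = Z' 5" "Z 6 = Z' 6"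
    by (auto intro!: Z)
  moreover have "ltr Z a = ltr Z' a" for a using letter_code_less[of a] by (intro Z) simp
  ultimately show ?thesis
    using guard_cong[OF Y] next_bit_cong[OF Y]
    unfolding refutes_def chl_west_def chl_south_def chl_row_def ok_def ok_west_def ok_south_def accepting_def
    by (simp cong: conj_cong)
qed

lemma list_refutable_iff:
  "(\<forall>Ys. length Ys = nY \<longrightarrow> (\<exists>Zs. length Zs = 7 + CARD('a) \<and>
      (\<forall>c. refutes x (\<lambda>i. (Ys @ Zs) ! i) (\<lambda>i. (Ys @ Zs) ! (nY + i)) c)))
    \<longleftrightarrow> (\<forall>Y. \<exists>Z. \<forall>c. refutes x Y Z c)"
proof (intro iffI allI impI)
  fix Y :: "nat \<Rightarrow> bool config"
  assume *: "\<forall>Ys. length Ys = nY \<longrightarrow> (\<exists>Zs. length Zs = 7 + CARD('a) \<and>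
      (\<forall>c. refutes x (\<lambda>i. (Ys @ Zs) ! i) (\<lambda>i. (Ys @ Zs) ! (nY + i)) c))"
  let ?Ys = "map Y [0..<nY]"
  obtain Zs where Zs: "length Zs = 7 + CARD('a)"
    "\<And>c. refutes x (\<lambda>i. (?Ys @ Zs) ! i) (\<lambda>i. (?Ys @ Zs) ! (nY + i)) c"
    using *[rule_format, of ?Ys] by auto
  have "refutes x Y (\<lambda>i. Zs ! i) c" for c
    using Zs(2)[of c] by (rule refutes_cong[THEN iffD1, rotated -1]) (auto simp: nth_append)
  then show "\<exists>Z. \<forall>c. refutes x Y Z c" by blast
next
  fix Ys :: "bool config list"
  assume "\<forall>Y. \<exists>Z. \<forall>c. refutes x Y Z c" and Ys: "length Ys = nY"
  then obtain Z where Z: "\<And>c. refutes x (\<lambda>i. Ys ! i) Z c" by blast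
  let ?Zs = "map Z [0..<7 + CARD('a)]"
  have "refutes x (\<lambda>i. (Ys @ ?Zs) ! i) (\<lambda>i. (Ys @ ?Zs) ! (nY + i)) c" for c
    using Z[of c] by (rule refutes_cong[THEN iffD1, rotated -1]) (auto simp: nth_append Ys simp del: upt_Suc)
  then show "\<exists>Zs. length Zs = 7 + CARD('a) \<and>
      (\<forall>c. refutes x (\<lambda>i. (Ys @ Zs) ! i) (\<lambda>i. (Ys @ Zs) ! (nY + i)) c)"
    by (intro exI[of _ ?Zs]) auto
qed

theorem refutable_iff:
  "(\<forall>Y. \<exists>Z. \<forall>c. refutes x Y Z c) \<longleftrightarrow> (\<nexists>u s s'. automaton_run (cell_check x u) (set T) 0 s final s')"
  using no_refutation[of x] ex_refutation[of x] by blast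

theorem ex_Pi_bar_formula_no_run:
  assumes "n \<ge> 2"
  shows "\<exists>\<psi> :: ('a, bool) u_mso. Pi_bar_formula n {binary_full_shift} \<psi> \<and>
    models \<psi> = {x. \<nexists>u s s'. automaton_run (cell_check x u) (set T) 0 s final s'}"
  using ex_Pi_bar_formula[OF definable_refutes _ _ assms]
  unfolding list_refutable_iff refutable_iff by simp

end

section \<open>The machine recognizing forbidden patterns\<close>

text \<open>The coordinates of the cell with code \<open>p\<close> are shifted by \<open>n\<close>, which makes them
  nonnegative for \<open>p \<le> n\<close>.\<close>

definition shifted_x :: "nat \<Rightarrow> nat \<Rightarrow> nat" where
  "shifted_x n p = nat (int n + fst (cell_of p))"

definition shifted_y :: "nat \<Rightarrow> nat \<Rightarrow> nat" where
  "shifted_y n p = nat (int n + snd (cell_of p))"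

lemma nat_add_int_decode: "nat (int n + int_decode i) = (if i mod 2 = 0 then n + i div 2 else n - Suc (i div 2))"
  by (auto simp: int_decode_alt even_iff_mod_2_eq_zero nat_add_distrib nat_diff_distrib')

lemma recursive_shifted [recursive_intros]:
  assumes "recursive F" "recursive G"
  shows "recursive (\<lambda>e. shifted_x (F e) (G e))" "recursive (\<lambda>e. shifted_y (F e) (G e))"
  unfolding shifted_x_def shifted_y_def cell_of_eq fst_conv snd_conv nat_add_int_decode
  by (intro recursive_intros assms)+

lemma abs_int_decode_le: "\<bar>int_decode i\<bar> \<le> int i"
  by (cases "even i") (auto elim!: evenE oddE simp: int_decode_alt)

text \<open>Each coordinate is in absolute value at most the code of its cell, so after the shift by
  \<open>n\<close> nothing is truncated by \<open>nat\<close>.\<close>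

lemma shifted_eq:
  assumes "p \<le> n"
  shows "int (shifted_x n p) = int n + fst (cell_of p)" "int (shifted_y n p) = int n + snd (cell_of p)"
proof -
  have "fst (prod_decode p) \<le> p" "snd (prod_decode p) \<le> p"
    using le_prod_encode_1[of "fst (prod_decode p)" "snd (prod_decode p)"]
      le_prod_encode_2[of "snd (prod_decode p)" "fst (prod_decode p)"] by simp_all
  then have "\<bar>fst (cell_of p)\<bar> \<le> int n" "\<bar>snd (cell_of p)\<bar> \<le> int n"
    using abs_int_decode_le[of "fst (prod_decode p)"] abs_int_decode_le[of "snd (prod_decode p)"] assms
    by (simp_all add: cell_of_eq)
  then show "int (shifted_x n p) = int n + fst (cell_of p)" "int (shifted_y n p) = int n + snd (cell_of p)"
    by (simp_all add: shifted_x_def shifted_y_def)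
qed

text \<open>The pattern code \<open>n\<close> doubles as translation: the pattern is read relative
  to \<open>u + (n, n)\<close>, which puts the cells with codes up to \<open>n\<close> weakly to the
  northeast of \<open>u\<close>.\<close>

definition digit_ok :: "'a::finite config \<Rightarrow> cell \<Rightarrow> nat \<Rightarrow> nat \<Rightarrow> 'a \<Rightarrow> bool" where
  "digit_ok x u n p a \<longleftrightarrow> (digit (Suc CARD('a)) n p = Suc (letter_code a) \<longrightarrow>
     x (u + (int (shifted_x n p), int (shifted_y n p))) = a)"

lemma cell_check_shifted:
  assumes "s 0 = shifted_x n p" "s (Suc 0) = shifted_x n p + shifted_y n p"
  shows "cell_check x u a s \<longleftrightarrow> x (u + (int (shifted_x n p), int (shifted_y n p))) = a"
  using assms by (simp add: cell_check_def)

text \<open>Register \<open>2\<close> contains the code of a pattern and register \<open>3\<close> the position of a digit. The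
  coordinates of the tested cell are passed in registers \<open>0\<close> and \<open>1\<close>, and register \<open>4\<close> contains
  intermediate results.\<close>

lemma ex_eval_program:
  assumes "recursive (\<lambda>e. H (e 0) (e 1))" "out < 5" "out \<noteq> 2" "out \<noteq> 3"
  obtains q :: "'a prog" where
    "\<And>chk s s'. (s, s') \<in> sem chk q \<Longrightarrow> s' out = H (s 2) (s 3) \<and> (\<forall>r<5. r \<noteq> out \<longrightarrow> s' r = s r)"
    "\<And>chk s. \<exists>s'. (s, s') \<in> sem chk q"
proof -
  obtain g where g: "\<And>a b y. computes g [a, b] y \<longleftrightarrow> y = H a b"
    using assms(1) by (rule ex_computes_binary) blast
  obtain q :: "'a prog" where q: "implements q 5 [2, 3] out (computes g)"
    using ex_implements[of "[2, 3]" 5 out g] assms by auto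
  show ?thesis
  proof (rule that)
    show "s' out = H (s 2) (s 3) \<and> (\<forall>r<5. r \<noteq> out \<longrightarrow> s' r = s r)" if "(s, s') \<in> sem chk q" for chk s s'
      using implementsD[OF q that] by (auto simp: g)
    show "\<exists>s'. (s, s') \<in> sem chk q" for chk s
      by (rule implementsE[OF q, of s "H (s 2) (s 3)" chk]) (auto simp: g)
  qed
qed

text \<open>The letter of \<open>Mark\<close> is part of the instruction, so letters are tested one
  by one, and \<open>A\<close> collects those handled so far. Registers \<open>2\<close> and
  \<open>3\<close> have to survive a test.\<close>

definition checks_digit :: "'a::finite prog \<Rightarrow> 'a set \<Rightarrow> bool" where
  "checks_digit q A \<longleftrightarrow> (\<forall>x u s.
    (\<forall>s'. (s, s') \<in> sem (cell_check x u) q \<longrightarrow>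
      s' 2 = s 2 \<and> s' 3 = s 3 \<and> (\<forall>a\<in>A. digit_ok x u (s 2) (s 3) a)) \<and>
    ((\<forall>a\<in>A. digit_ok x u (s 2) (s 3) a) \<longrightarrow> (\<exists>s'. (s, s') \<in> sem (cell_check x u) q)))"

lemma checks_digitD:
  assumes "checks_digit q A" "(s, s') \<in> sem (cell_check x u) q"
  shows "s' 2 = s 2" "s' 3 = s 3" "\<And>a. a \<in> A \<Longrightarrow> digit_ok x u (s 2) (s 3) a"
  using assms unfolding checks_digit_def by blast+

lemma checks_digitE:
  assumes "checks_digit q A" "\<And>a. a \<in> A \<Longrightarrow> digit_ok x u (s 2) (s 3) a"
  obtains s' where "(s, s') \<in> sem (cell_check x u) q"
  using assms unfolding checks_digit_def by blast

lemma checks_digit_Seq: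
  fixes q :: "'a::finite prog"
  assumes q: "checks_digit q A" and q': "checks_digit q' B"
  shows "checks_digit (q ;; q') (A \<union> B)"
  unfolding checks_digit_def
proof (intro allI conjI impI)
  fix x u s s'
  assume "(s, s') \<in> sem (cell_check x u) (q ;; q')"
  then obtain t where t: "(s, t) \<in> sem (cell_check x u) q" "(t, s') \<in> sem (cell_check x u) q'" by auto
  note 1 = checks_digitD[OF q t(1)] and 2 = checks_digitD[OF q' t(2)]
  show "s' 2 = s 2" "s' 3 = s 3" using 1(1,2) 2(1,2) by simp_all
  show "\<forall>a\<in>A \<union> B. digit_ok x u (s 2) (s 3) a" using 1 2 by auto
next
  fix x :: "'a config" and u and s :: "nat \<Rightarrow> nat"
  assume ok: "\<forall>a\<in>A \<union> B. digit_ok x u (s 2) (s 3) a"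
  then obtain t where t: "(s, t) \<in> sem (cell_check x u) q" using checks_digitE[OF q, of x u s] by auto
  have "digit_ok x u (t 2) (t 3) a" if "a \<in> B" for a using ok that checks_digitD[OF q t] by simp
  then obtain s' where "(t, s') \<in> sem (cell_check x u) q'" using checks_digitE[OF q', of x u t] by auto
  with t show "\<exists>s'. (s, s') \<in> sem (cell_check x u) (q ;; q')" by auto
qed

lemma ex_checks_digit_singleton: "\<exists>q :: 'a::finite prog. checks_digit q {a}"
proof -
  have "recursive (\<lambda>e. of_bool (digit (Suc CARD('a)) (e 0) (e 1) = Suc (letter_code a)))"
    by (intro recursive_intros)
  then obtain qd :: "'a prog" where qd:
    "\<And>chk s s'. (s, s') \<in> sem chk qd \<Longrightarrow>
      s' 4 = of_bool (digit (Suc CARD('a)) (s 2) (s 3) = Suc (letter_code a)) \<and> (\<forall>r<5. r \<noteq> 4 \<longrightarrow> s' r = s r)"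
    "\<And>chk s. \<exists>s'. (s, s') \<in> sem chk qd"
    by (rule ex_eval_program[of "\<lambda>n p. of_bool (digit (Suc CARD('a)) n p = Suc (letter_code a))" 4]) auto
  have "recursive (\<lambda>e. shifted_x (e 0) (e 1))" by (intro recursive_intros)
  then obtain qx :: "'a prog" where qx:
    "\<And>chk s s'. (s, s') \<in> sem chk qx \<Longrightarrow> s' 0 = shifted_x (s 2) (s 3) \<and> (\<forall>r<5. r \<noteq> 0 \<longrightarrow> s' r = s r)"
    "\<And>chk s. \<exists>s'. (s, s') \<in> sem chk qx"
    by (rule ex_eval_program[of shifted_x 0]) auto
  have "recursive (\<lambda>e. shifted_x (e 0) (e 1) + shifted_y (e 0) (e 1))" by (intro recursive_intros)
  then obtain qy :: "'a prog" where qy: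
    "\<And>chk s s'. (s, s') \<in> sem chk qy \<Longrightarrow>
      s' 1 = shifted_x (s 2) (s 3) + shifted_y (s 2) (s 3) \<and> (\<forall>r<5. r \<noteq> 1 \<longrightarrow> s' r = s r)"
    "\<And>chk s. \<exists>s'. (s, s') \<in> sem chk qy"
    by (rule ex_eval_program[of "\<lambda>n p. shifted_x n p + shifted_y n p" 1]) auto
  define test where "test = qx ;; qy ;; Do (Mark a) ;; Do (Clear 4)"
  \<comment> \<open>A conditional: \<open>test\<close> clears register \<open>4\<close>, so the loop
    runs at most once, and the final \<open>IsZero\<close> forces it to run if the digit stands for
    \<open>a\<close>.\<close>
  define q where "q = qd ;; Star (Do (NonZero 4) ;; test) ;; Do (IsZero 4)"
  have test: "s' 4 = 0 \<and> s' 2 = s 2 \<and> s' 3 = s 3 \<and>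
      x (u + (int (shifted_x (s 2) (s 3)), int (shifted_y (s 2) (s 3)))) = a"
    if run: "(s, s') \<in> sem (cell_check x u) test" for x u s s'
  proof -
    obtain t v where t: "(s, t) \<in> sem (cell_check x u) qx" "(t, v) \<in> sem (cell_check x u) qy"
      "(v, s') \<in> sem (cell_check x u) (Do (Mark a) ;; Do (Clear 4))"
      using run unfolding test_def sem.simps(2)[of _ qx] sem.simps(2)[of _ qy] by blast
    then have v: "cell_check x u a v" "s' = v(4 := 0)" by auto
    show ?thesis
      using qx(1)[OF t(1)] qy(1)[OF t(2)] v(1) cell_check_shifted[of v "s 2" "s 3" x u a]
      by (auto simp: v(2))
  qed
  have test': "\<exists>s'. (s, s') \<in> sem (cell_check x u) test"
    if "x (u + (int (shifted_x (s 2) (s 3)), int (shifted_y (s 2) (s 3)))) = a" for x u s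
  proof -
    obtain t where t: "(s, t) \<in> sem (cell_check x u) qx" using qx(2) by blast
    obtain v where v: "(t, v) \<in> sem (cell_check x u) qy" using qy(2) by blast
    have "cell_check x u a v"
      using qx(1)[OF t] qy(1)[OF v] that cell_check_shifted[of v "s 2" "s 3" x u a] by auto
    then show ?thesis using t v by (intro exI[of _ "v(4 := 0)"]) (auto simp: test_def intro!: relcompI)
  qed
  have "checks_digit q {a}"
    unfolding checks_digit_def
  proof (intro allI conjI impI)
    fix x u s s'
    assume "(s, s') \<in> sem (cell_check x u) q"
    then obtain t where t: "(s, t) \<in> sem (cell_check x u) qd"
      "(t, s') \<in> (sem (cell_check x u) (Do (NonZero 4) ;; test))\<^sup>*" "s' 4 = 0"
      by (auto simp: q_def)
    note d = qd(1)[OF t(1)]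
    have frame: "s' 2 = t 2 \<and> s' 3 = t 3"
      using t(2) by (induction rule: rtrancl_induct) (auto dest!: test)
    then show "s' 2 = s 2" "s' 3 = s 3" using d by auto
    show "\<forall>b\<in>{a}. digit_ok x u (s 2) (s 3) b"
      using t(2)
    proof (cases rule: converse_rtranclE)
      case base
      then show ?thesis using d t(3) by (auto simp: digit_ok_def)
    next
      case (step v)
      then have "(t, v) \<in> sem (cell_check x u) test" by auto
      from test[OF this] show ?thesis using d by (auto simp: digit_ok_def)
    qed
  next
    fix x :: "'a config" and u and s :: "nat \<Rightarrow> nat"
    assume ok: "\<forall>b\<in>{a}. digit_ok x u (s 2) (s 3) b"
    obtain t where t: "(s, t) \<in> sem (cell_check x u) qd" using qd(2) by blast
    note d = qd(1)[OF t]
    show "\<exists>s'. (s, s') \<in> sem (cell_check x u) q"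
    proof (cases "t 4 = 0")
      case True
      then show ?thesis using t by (auto simp: q_def intro!: relcompI exI[of _ t])
    next
      case False
      then have "x (u + (int (shifted_x (t 2) (t 3)), int (shifted_y (t 2) (t 3)))) = a"
        using d ok by (auto simp: digit_ok_def)
      then obtain v where v: "(t, v) \<in> sem (cell_check x u) test" using test' by blast
      then have "(t, v) \<in> sem (cell_check x u) (Do (NonZero 4) ;; test)" using False by auto
      then have "(t, v) \<in> (sem (cell_check x u) (Do (NonZero 4) ;; test))\<^sup>*" by blast
      moreover have "v 4 = 0" using test[OF v] by simp
      ultimately show ?thesis
        using t unfolding q_def sem.simps(2)[of _ qd] sem.simps(2)[of _ "Star _"] sem.simps(3)
        by (intro exI[of _ v] relcompI) auto
    qed
  qed
  then show ?thesis by blast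
qed

lemma ex_checks_digit:
  fixes A :: "'a::finite set"
  shows "\<exists>q. checks_digit q A"
proof -
  have "finite A" by simp
  then show ?thesis
  proof (induction A rule: finite_induct)
    case empty
    show ?case by (intro exI[of _ "Do (Move 0 0)"]) (auto simp: checks_digit_def)
  next
    case (insert a A)
    then show ?case using ex_checks_digit_singleton[of a] checks_digit_Seq[of _ "{a}" _ A] by auto
  qed
qed

text \<open>The pattern code is guessed as the initial content of register \<open>2\<close>. After a
  successful run of \<open>f\<close> on it, a loop verifies the letters at successive positions; at
  the guessed exit the counter in register \<open>3\<close> must equal the code.\<close>

lemma ex_machine:
  "\<exists>q :: 'a::finite prog. \<forall>x u. (\<exists>s s'. (s, s') \<in> sem (cell_check x u) q) \<longleftrightarrow>
     (\<exists>n. (\<exists>y. computes f [n] y) \<and> (\<forall>p<n. \<forall>a. digit_ok x u n p a))"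
proof -
  obtain qf :: "'a prog" where qf: "implements qf 5 [2] 4 (computes f)"
    using ex_implements[of "[2]" 5 4 f] by auto
  obtain qa :: "'a prog" where qa: "checks_digit qa UNIV" using ex_checks_digit by blast
  define loop where "loop = qa ;; Do (Incr 3 3)"
  define q where "q = qf ;; Do (Clear 3) ;; Star loop ;; Do (Same 3 2)"
  have loop: "s' 2 = s 2 \<and> s' 3 = Suc (s 3) \<and> (\<forall>a. digit_ok x u (s 2) (s 3) a)"
    if run: "(s, s') \<in> sem (cell_check x u) loop" for x u s s'
  proof -
    obtain t where t: "(s, t) \<in> sem (cell_check x u) qa" "s' = t(3 := Suc (t 3))"
      using run by (auto simp: loop_def)
    show ?thesis using checks_digitD[OF qa t(1)] t(2) by auto
  qed
  have star: "s' 2 = s 2 \<and> (\<forall>p<s' 3. \<forall>a. digit_ok x u (s 2) p a)"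
    if "(s, s') \<in> (sem (cell_check x u) loop)\<^sup>*" "s 3 = 0" for x u s s'
    using that by (induction rule: rtrancl_induct) (auto simp: less_Suc_eq dest!: loop)
  have star': "\<exists>s'. (s, s') \<in> (sem (cell_check x u) loop)\<^sup>* \<and> s' 2 = s 2 \<and> s' 3 = j"
    if "\<forall>p<j. \<forall>a. digit_ok x u (s 2) p a" "s 3 = 0" for x u s j
    using that(1)
  proof (induction j)
    case 0
    then show ?case using that(2) by blast
  next
    case (Suc j)
    then obtain t where t: "(s, t) \<in> (sem (cell_check x u) loop)\<^sup>*" "t 2 = s 2" "t 3 = j" by auto
    have "\<And>a. digit_ok x u (t 2) (t 3) a" using Suc.prems t by auto
    then obtain v where v: "(t, v) \<in> sem (cell_check x u) qa" by (rule checks_digitE[OF qa])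
    then have w: "(t, v(3 := Suc (v 3))) \<in> sem (cell_check x u) loop" by (auto simp: loop_def)
    show ?case
      using rtrancl_into_rtrancl[OF t(1) w] loop[OF w] t
      by (intro exI[of _ "v(3 := Suc (v 3))"]) (auto simp del: fun_upd_apply)
  qed
  have "(\<exists>s s'. (s, s') \<in> sem (cell_check x u) q) \<longleftrightarrow>
     (\<exists>n. (\<exists>y. computes f [n] y) \<and> (\<forall>p<n. \<forall>a. digit_ok x u n p a))" for x u
  proof
    assume "\<exists>s s'. (s, s') \<in> sem (cell_check x u) q"
    then obtain s t s' where t: "(s, t) \<in> sem (cell_check x u) qf"
      "(t(3 := 0), s') \<in> (sem (cell_check x u) loop)\<^sup>*" "s' 3 = s' 2"
      by (auto simp: q_def)
    have "s' 2 = t 2 \<and> (\<forall>p<s' 3. \<forall>a. digit_ok x u (t 2) p a)" using star[OF t(2)] by simp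
    moreover have "computes f [s 2] (t 4)" "t 2 = s 2" using implementsD[OF qf t(1)] by simp_all
    ultimately show "\<exists>n. (\<exists>y. computes f [n] y) \<and> (\<forall>p<n. \<forall>a. digit_ok x u n p a)"
      using t(3) by (intro exI[of _ "s 2"]) auto
  next
    assume "\<exists>n. (\<exists>y. computes f [n] y) \<and> (\<forall>p<n. \<forall>a. digit_ok x u n p a)"
    then obtain n y where n: "computes f [n] y" "\<forall>p<n. \<forall>a. digit_ok x u n p a" by blast
    then have "computes f (map (\<lambda>_. n) [2 :: nat]) y" by simp
    then obtain t where t: "(\<lambda>_. n, t) \<in> sem (cell_check x u) qf" "\<And>r. r < 5 \<Longrightarrow> r \<noteq> 4 \<Longrightarrow> t r = n"
      by (rule implementsE[OF qf, of _ _ "cell_check x u"]) blast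
    have t2: "(t(3 := 0)) 2 = n" using t(2)[of 2] by simp
    obtain s' where "(t(3 := 0), s') \<in> (sem (cell_check x u) loop)\<^sup>*" "s' 2 = n" "s' 3 = n"
      using star'[of n x u "t(3 := 0)"] n(2) unfolding t2 by auto
    then show "\<exists>s s'. (s, s') \<in> sem (cell_check x u) q"
      using t(1) by (intro exI[of _ "\<lambda>_. n"] exI[of _ s']) (auto simp: q_def intro!: relcompI)
  qed
  then show ?thesis by blast
qed

text \<open>A nonzero digit at \<open>p\<close> gives \<open>b ^ p \<le> n\<close>, and
  \<open>p < b ^ p\<close>. Thus the code itself bounds the positions that the machine has to
  visit.\<close>

lemma digit_nonzero_less:
  assumes "digit b n p \<noteq> 0" "b \<ge> 2"
  shows "p < n"
proof -
  have "n div b ^ p \<noteq> 0" using assms(1) unfolding digit_def by (metis mod_0)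
  then have "b ^ p \<le> n" by (metis div_less not_le_imp_less)
  moreover have "p < b ^ p" using assms(2) by (metis less_exp less_le_trans power_mono zero_le)
  ultimately show ?thesis by simp
qed

lemma digits_ok_iff_extends:
  fixes P :: "'a::finite pattern"
  assumes P: "P \<in> finite_patterns" and n: "n = pattern_code P"
  shows "(\<forall>p<n. \<forall>a. digit_ok x u n p a) \<longleftrightarrow> extends (\<lambda>v. x (u + (int n, int n) + v)) P"
proof -
  have digit: "digit (Suc CARD('a)) n p = (case P (cell_of p) of None \<Rightarrow> 0 | Some a \<Rightarrow> Suc (letter_code a))" for p
    using pattern_digit_eq[OF P, of p] by (simp add: pattern_digit_def n)
  have less: "cell_code v < n" if "P v \<noteq> None" for v
  proof (rule digit_nonzero_less)
    show "digit (Suc CARD('a)) n (cell_code v) \<noteq> 0" using that by (auto simp: digit)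
    show "2 \<le> Suc CARD('a)" by (simp add: Suc_le_eq)
  qed
  have cell: "u + (int (shifted_x n p), int (shifted_y n p)) = u + (int n, int n) + cell_of p" if "p < n" for p
    using shifted_eq[of p n] that by (simp add: prod_eq_iff)
  have "(\<forall>p<n. \<forall>a. digit_ok x u n p a) \<longleftrightarrow>
    (\<forall>p<n. \<forall>a. P (cell_of p) = Some a \<longrightarrow> x (u + (int n, int n) + cell_of p) = a)"
    using inj_letter_code[where 'b='a]
    by (intro all_cong1 imp_cong refl)
      (auto simp: digit_ok_def digit cell inj_eq split: option.splits)
  also have "\<dots> \<longleftrightarrow> (\<forall>v a. P v = Some a \<longrightarrow> x (u + (int n, int n) + v) = a)"
    using less by (metis cell_of_cell_code option.distinct(1))
  also have "\<dots> \<longleftrightarrow> extends (\<lambda>v. x (u + (int n, int n) + v)) P"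
    by (auto simp: extends_def dom_def simp del: split_paired_All)
  finally show ?thesis .
qed

section \<open>From forbidden patterns to the equivalence\<close>

text \<open>No pattern of a defining set belongs to the language, so the complement of the language
  is the largest set of finite patterns defining the subshift.\<close>

lemma subshift_iff_no_forbidden_pattern:
  assumes "subshift X"
  shows "x \<in> X \<longleftrightarrow> (\<nexists>P. P \<in> finite_patterns \<and> P \<notin> language X \<and> occurs_in P (Some \<circ> x))"
proof -
  obtain F where F: "F \<subseteq> finite_patterns" "X = avoiding F" using assms by (auto simp: subshift_def)
  show ?thesis
  proof
    assume "\<nexists>P. P \<in> finite_patterns \<and> P \<notin> language X \<and> occurs_in P (Some \<circ> x)"
    moreover have "P \<notin> language X" if "P \<in> F" for P
      using that by (auto simp: language_def F(2) avoiding_def)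
    ultimately show "x \<in> X" using F by (auto simp: avoiding_def)
  qed (auto simp: language_def)
qed

text \<open>Silent loops at the last state can be cut out of a run; they only let the tableau grow
  beyond its end.\<close>

lemma automaton_run_idle:
  "automaton_run chk (insert (k, Move 0 0, k) T) i s k u \<Longrightarrow> automaton_run chk T i s k u"
proof (induction i s k u rule: automaton_run.induct)
  case (halt i s)
  show ?case by (rule automaton_run.halt)
next
  case (step i a j s t k u)
  then show ?case
    by (cases "(i, a, j) \<in> T") (auto intro: automaton_run.step)
qed

lemma ex_register_bound:
  fixes T :: "'a transition list"
  shows "\<exists>m \<ge> 2. \<forall>(i, a, j) \<in> set T. \<forall>r \<in> instr_regs a. r < m"
proof -
  have "finite (instr_regs a)" for a :: "'a instr" by (cases a) auto
  then have "finite (\<Union>(i, a, j) \<in> set T. instr_regs a)" by auto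
  then obtain m where "\<forall>r \<in> (\<Union>(i, a, j) \<in> set T. instr_regs a). r < m"
    using finite_nat_set_iff_bounded by blast
  then show ?thesis by (intro exI[of _ "m + 2"]) fastforce
qed

theorem theorem3:
  fixes n :: nat and X :: "'a::finite config set"
  assumes "n \<ge> 2"
  shows "Pi01_subshift X \<longleftrightarrow>
    (\<exists>\<psi> :: ('a, bool) u_mso. Pi_bar_formula n {binary_full_shift} \<psi> \<and> X = models \<psi>)"
proof
  assume X: "Pi01_subshift X"
  then obtain f where "- pattern_code ` language X = {k. \<exists>y. computes f [k] y}"
    unfolding Pi01_subshift_def Pi01_def recursively_enumerable_def by blast
  then have f: "k \<notin> pattern_code ` language X \<longleftrightarrow> (\<exists>y. computes f [k] y)" for k
    by blast
  obtain q :: "'a prog" where q: "\<And>x u. (\<exists>s s'. (s, s') \<in> sem (cell_check x u) q) \<longleftrightarrow>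
     (\<exists>n. (\<exists>y. computes f [n] y) \<and> (\<forall>p<n. \<forall>a. digit_ok x u n p a))"
    using ex_machine by blast
  define T where "T = (prog_size q, Move 0 0, prog_size q) # transitions q 0"
  obtain m where m: "m \<ge> 2" "\<forall>(i, a, j) \<in> set T. \<forall>r \<in> instr_regs a. r < m"
    using ex_register_bound[of T] by blast
  interpret tableau T "prog_size q" m
    by standard (use m in \<open>auto simp: T_def\<close>)
  have run: "automaton_run chk (set T) 0 s (prog_size q) s' \<longleftrightarrow> (s, s') \<in> sem chk q" for chk s s'
  proof -
    have "automaton_run chk (set T) 0 s (prog_size q) s'
        \<longleftrightarrow> automaton_run chk (set (transitions q 0)) 0 s (prog_size q) s'"
      unfolding T_def list.set(2)
      by (rule iffI, erule automaton_run_idle, erule automaton_run_mono) blast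
    then show ?thesis using automaton_run_iff_sem[of chk q 0 s s'] by simp
  qed
  have "x \<in> X \<longleftrightarrow> (\<nexists>u s s'. (s, s') \<in> sem (cell_check x u) q)" for x
  proof -
    have "(\<exists>u s s'. (s, s') \<in> sem (cell_check x u) q) \<longleftrightarrow>
      (\<exists>k u. k \<notin> pattern_code ` language X \<and> (\<forall>p<k. \<forall>a. digit_ok x u k p a))"
      unfolding q f[symmetric] by blast
    also have "\<dots> \<longleftrightarrow> (\<exists>(P :: 'a pattern) u. P \<in> finite_patterns \<and> pattern_code P \<notin> pattern_code ` language X \<and>
        (\<forall>p<pattern_code P. \<forall>a. digit_ok x u (pattern_code P) p a))"
    proof
      assume "\<exists>k u. k \<notin> pattern_code ` language X \<and> (\<forall>p<k. \<forall>a. digit_ok x u k p a)"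
      then obtain k u where k: "k \<notin> pattern_code ` language X" "\<forall>p<k. \<forall>a. digit_ok x u k p a" by blast
      obtain P :: "'a pattern" where "P \<in> finite_patterns" "k = pattern_code P" by (rule ex_pattern_code)
      with k show "\<exists>(P :: 'a pattern) u. P \<in> finite_patterns \<and> pattern_code P \<notin> pattern_code ` language X \<and>
        (\<forall>p<pattern_code P. \<forall>a. digit_ok x u (pattern_code P) p a)"
        by (intro exI[of _ P] exI[of _ u]) auto
    qed blast
    also have "\<dots> \<longleftrightarrow> (\<exists>P u. P \<in> finite_patterns \<and> P \<notin> language X \<and>
        extends (\<lambda>v. x (u + (int (pattern_code P), int (pattern_code P)) + v)) P)"
      by (simp only: digits_ok_iff_extends[OF _ refl] pattern_code_in_language_iff cong: conj_cong)
    also have "\<dots> \<longleftrightarrow> (\<exists>P d. P \<in> finite_patterns \<and> P \<notin> language X \<and> extends (\<lambda>v. x (d + v)) P)"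
    proof -
      \<comment> \<open>The offset of the pattern depends on its code, but \<open>u\<close> ranges
        over all cells and absorbs it.\<close>
      have "(\<exists>u. R (u + c)) \<longleftrightarrow> (\<exists>d. R d)" for R and c :: cell
        by (metis diff_add_cancel)
      from this[of "\<lambda>d. extends (\<lambda>v. x (d + v)) _"] show ?thesis by blast
    qed
    also have "\<dots> \<longleftrightarrow> (\<exists>P. P \<in> finite_patterns \<and> P \<notin> language X \<and> occurs_in P (Some \<circ> x))"
      unfolding occurs_in_config by blast
    finally show ?thesis
      using subshift_iff_no_forbidden_pattern[of X x] X unfolding Pi01_subshift_def by blast
  qed
  then have "X = {x. \<nexists>u s s'. automaton_run (cell_check x u) (set T) 0 s (prog_size q) s'}"
    unfolding run by blast
  then show "\<exists>\<psi> :: ('a, bool) u_mso. Pi_bar_formula n {binary_full_shift} \<psi> \<and> X = models \<psi>"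
    using ex_Pi_bar_formula_no_run[OF assms] by auto
next
  assume "\<exists>\<psi> :: ('a, bool) u_mso. Pi_bar_formula n {binary_full_shift} \<psi> \<and> X = models \<psi>"
  then obtain \<psi> :: "('a, bool) u_mso" where "u_mso_over {UNIV} \<psi>" "X = models \<psi>"
    by (auto simp: Pi_bar_formula_def binary_full_shift_def)
  then show "Pi01_subshift X"
    unfolding Pi01_subshift_def using subshift_models Pi01_language_models by blast
qed

end
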